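(* Let $G$ be a finite solvable tidy group. Then $G$ has Fitting height at most $4$ and $G/F(G)$ has derived length at most $4$. If moreover $|G|$ is odd, then $G$ has Fitting height at most $3$ and $G/F(G)$ is abelian or metabelian.
   Context: All groups are finite. For a group $G$ and $x\in G$, let $\mathrm{Cyc}_G(x)=\{g\in G \mid \langle x,g\rangle \text{ is cyclic}\}$. The group $G$ is called tidy if $\mathrm{Cyc}_G(x)$ is a subgroup of $G$ for every $x\in G$. $F(G)$ denotes the Fitting subgroup of $G$. *)

theory Defs
  imports
    "HOL-Algebra.Elementary_Groups"
    "HOL-Algebra.Solvable_Groups"
    "HOL-Library.Extended_Nat"
begin

definition Cyc :: "('a, 'b) monoid_scheme \<Rightarrow> 'a \<Rightarrow> 'a set" where
  "Cyc G x = {g \<in> carrier G. cyclic_group (subgroup_generated G {x, g})}"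

definition tidy :: "('a, 'b) monoid_scheme \<Rightarrow> bool" where
  "tidy G \<longleftrightarrow> (\<forall>x \<in> carrier G. subgroup (Cyc G x) G)"

(* The index is shifted by one against the usual convention: the 0-th term is G itself. *)
primrec lower_central_series :: "('a, 'b) monoid_scheme \<Rightarrow> nat \<Rightarrow> 'a set" where
  "lower_central_series G 0 = carrier G"
| "lower_central_series G (Suc n) =
     generate G (\<Union>h \<in> lower_central_series G n. \<Union>g \<in> carrier G.
       {h \<otimes>\<^bsub>G\<^esub> g \<otimes>\<^bsub>G\<^esub> inv\<^bsub>G\<^esub> h \<otimes>\<^bsub>G\<^esub> inv\<^bsub>G\<^esub> g})"

definition nilpotent_group :: "('a, 'b) monoid_scheme \<Rightarrow> bool" where
  "nilpotent_group G \<longleftrightarrow> (\<exists>n. lower_central_series G n = {\<one>\<^bsub>G\<^esub>})"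

(* The subgroup generated by all nilpotent normal subgroups; for finite G it is, by Fitting's
   theorem, the largest nilpotent normal subgroup. *)
definition Fitting :: "('a, 'b) monoid_scheme \<Rightarrow> 'a set" where
  "Fitting G = generate G (\<Union>{N. N \<lhd> G \<and> nilpotent_group (G\<lparr>carrier := N\<rparr>)})"

(* Upper Fitting series: the (n+1)-st term is the full preimage in G of the Fitting subgroup of
   the quotient of G by the n-th term. *)
primrec Fitting_series :: "('a, 'b) monoid_scheme \<Rightarrow> nat \<Rightarrow> 'a set" where
  "Fitting_series G 0 = {\<one>\<^bsub>G\<^esub>}"
| "Fitting_series G (Suc n) =
     {g \<in> carrier G. Fitting_series G n #>\<^bsub>G\<^esub> g \<in> Fitting (G Mod Fitting_series G n)}"

(* Fitting height and derived length take values in enat, so that they are infinite when the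
   respective series never reaches its end. *)
definition Fitting_height :: "('a, 'b) monoid_scheme \<Rightarrow> enat" where
  "Fitting_height G = Inf (enat ` {n. Fitting_series G n = carrier G})"

definition derived_length :: "('a, 'b) monoid_scheme \<Rightarrow> enat" where
  "derived_length G = Inf (enat ` {n. (derived G ^^ n) (carrier G) = {\<one>\<^bsub>G\<^esub>}})"

definition metabelian :: "('a, 'b) monoid_scheme \<Rightarrow> bool" where
  "metabelian G \<longleftrightarrow> comm_group (G\<lparr>carrier := derived G (carrier G)\<rparr>)"

end

theory Submission
  imports Defs "HOL-Number_Theory.Cong" "HOL-Algebra.Group_Action" "HOL-Algebra.Multiplicative_Group"
    "HOL-Algebra.Sylow" "HOL-Algebra.SndIsomorphismGrp"
begin

text \<open>
  Let \<open>S/T\<close> be a chief factor of \<open>G\<close> with \<open>S\<close> a normal \<open>p\<close>-subgroup. The elements of a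
  finite solvable group that centralize all these chief factors form a nilpotent normal subgroup
  \<open>N\<close>: a nilpotent normal subgroup is a product of normal Sylow subgroups, so its chief factors
  are of this kind, and the lower central series of \<open>N\<close>, once it has entered a nilpotent term
  of its derived series, descends along them (\<open>nilpotent_if_centralizes_chief_pairs\<close>).
  Hence \<open>N\<close> lies in the Fitting subgroup, and it remains to see which terms of the derived
  series act trivially on every \<open>S/T\<close>.

  Tidiness restricts this action. Let a \<open>p'\<close>-element \<open>y\<close> normalize \<open>S\<close> and commute
  with some \<open>x\<close> of order \<open>p\<close> in \<open>S\<close>. The subgroup \<open>Cyc x\<close> contains every
  \<open>p'\<close>-element that commutes with \<open>x\<close>, hence all commutators of \<open>y\<close> with the centralizer
  of \<open>x\<close> in \<open>S\<close>; and every nontrivial \<open>p\<close>-element of \<open>Cyc x\<close> has \<open>x\<close> as a power.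
  So the intersection of \<open>Cyc x\<close> and \<open>S\<close> has only one subgroup of order \<open>p\<close>. For odd \<open>p\<close>
  it is cyclic and \<open>y\<close> centralizes it; then \<open>y\<close> centralizes the centralizer of \<open>x\<close>
  in \<open>S\<close> and, by an argument of Thompson, all of \<open>S\<close>. For \<open>p = 2\<close> the same holds
  unless \<open>S\<close> itself has only one involution (\<open>tidy_coprime_fixed_point\<close>); in that case
  \<open>S/T\<close> has order at most four and the second derived subgroup acts trivially on it.

  Otherwise every element of \<open>G\<close> whose order is a power of a prime other than \<open>p\<close> acts on
  \<open>S/T\<close> trivially or without nontrivial fixed points. Let \<open>H\<close> be the group induced on \<open>S/T\<close>. It has no nontrivial
  normal \<open>p\<close>-subgroup, and for each prime \<open>r\<close> other than \<open>p\<close> its normal \<open>r\<close>-subgroups have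
  at most one subgroup of order \<open>r\<close>, because two commuting elements that generate a group of order
  \<open>r * r\<close> cannot act without fixed points (\<open>fixed_point_free_rank_two\<close>). For odd \<open>r\<close> these
  subgroups are cyclic and the derived subgroup \<open>H'\<close> centralizes them; for \<open>r = 2\<close> they have a
  cyclic subgroup of index at most two, their chief factors have order at most four, and \<open>H''\<close>
  centralizes those. So \<open>H''\<close> is nilpotent by the criterion above. Its Sylow subgroups of odd order
  are central and its Sylow 2-subgroup is metabelian, which gives \<open>H'''' = 1\<close>. If the order is
  odd, then already \<open>H'\<close> is nilpotent with central Sylow subgroups, and \<open>H'' = 1\<close>
  (\<open>derived_length_four_if_unique_prime_subgroups\<close>).

  Therefore \<open>G''''\<close> and a term of the lower central series of \<open>G''\<close> lie in \<open>N\<close>, and \<open>G''\<close>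
  does if the order of \<open>G\<close> is odd. This bounds the derived length of \<open>G/F(G)\<close>, and the
  Fitting series reaches \<open>N\<close>, \<open>G''\<close>, \<open>G'\<close> and \<open>G\<close> after one, two, three and four steps;
  for odd order it reaches \<open>N\<close>, \<open>G'\<close> and \<open>G\<close> after one, two and three.
\<close>

section \<open>Commutators, quotients and fixed points of p-groups\<close>

locale finite_group = group +
  assumes fin: "finite (carrier G)"

text \<open>The convention agrees with the one of the derived series and of the lower central series.\<close>

abbreviation commutator :: "('a, 'b) monoid_scheme \<Rightarrow> 'a \<Rightarrow> 'a \<Rightarrow> 'a" where
  "commutator G x y \<equiv> x \<otimes>\<^bsub>G\<^esub> y \<otimes>\<^bsub>G\<^esub> inv\<^bsub>G\<^esub> x \<otimes>\<^bsub>G\<^esub> inv\<^bsub>G\<^esub> y"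

context group
begin

lemma inv_cancel_left: "\<lbrakk>x \<in> carrier G; y \<in> carrier G\<rbrakk> \<Longrightarrow> inv x \<otimes> (x \<otimes> y) = y"
  by (simp flip: m_assoc)

lemma cancel_inv_left: "\<lbrakk>x \<in> carrier G; y \<in> carrier G\<rbrakk> \<Longrightarrow> x \<otimes> (inv x \<otimes> y) = y"
  by (simp flip: m_assoc)

text \<open>Rewriting with these rules brings a group word into reduced form with brackets to the right, which decides identities between words.\<close>

lemmas word_simps = m_assoc inv_mult_group inv_cancel_left cancel_inv_left

lemma commutator_one_iff:
  assumes "x \<in> carrier G" "y \<in> carrier G"
  shows "commutator G x y = \<one> \<longleftrightarrow> x \<otimes> y = y \<otimes> x"
proof -
  have "commutator G x y = (x \<otimes> y) \<otimes> inv (y \<otimes> x)"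
    using assms by (simp add: word_simps)
  then show ?thesis
    using assms by (metis inv_closed inv_inv inv_equality m_closed r_inv)
qed

lemma conj_pow:
  assumes "x \<in> carrier G" "y \<in> carrier G"
  shows "(x \<otimes> y \<otimes> inv x) [^] (n::nat) = x \<otimes> y [^] n \<otimes> inv x"
proof (induction n)
  case 0 then show ?case using assms by simp
next
  case (Suc n)
  then show ?case using assms by (simp add: word_simps)
qed

lemma ord_conj:
  assumes "x \<in> carrier G" "y \<in> carrier G"
  shows "ord (x \<otimes> y \<otimes> inv x) = ord y"
proof -
  have "(x \<otimes> y \<otimes> inv x) [^] n = \<one> \<longleftrightarrow> y [^] n = \<one>" for n :: nat
  proof -
    have "x \<otimes> y [^] n \<otimes> inv x = \<one> \<longleftrightarrow> x \<otimes> y [^] n = x"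
      using assms inv_solve_right'[of \<one> "x \<otimes> y [^] n" x] by auto
    also have "\<dots> \<longleftrightarrow> y [^] n = \<one>"
      using assms by simp
    finally show ?thesis
      using assms by (simp add: conj_pow)
  qed
  then show ?thesis
    using assms ord_unique[of "x \<otimes> y \<otimes> inv x" "ord y"] pow_eq_id[of y] by simp
qed

lemma subgroup_pow_closed: "\<lbrakk>subgroup H G; x \<in> H\<rbrakk> \<Longrightarrow> x [^] (n::nat) \<in> H"
  by (induction n) (auto simp: subgroup.one_closed subgroup.m_closed)

lemma commuting_if_conj:
  assumes "x \<in> carrier G" "y \<in> carrier G"
  shows "x \<otimes> y \<otimes> inv x = y \<longleftrightarrow> x \<otimes> y = y \<otimes> x"
  using inv_solve_right'[of y "x \<otimes> y" x] assms by auto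

lemma conj_eq_imp_commute:
  assumes u: "u \<in> carrier G" and w: "w \<in> carrier G" and v: "v \<in> carrier G"
    and eq: "u \<otimes> v \<otimes> inv u = w \<otimes> v \<otimes> inv w"
  shows "inv w \<otimes> u \<otimes> v = v \<otimes> (inv w \<otimes> u)"
proof -
  have "inv w \<otimes> u \<otimes> v = inv w \<otimes> (u \<otimes> v \<otimes> inv u) \<otimes> u"
    using u w v by (simp add: word_simps)
  also have "\<dots> = v \<otimes> (inv w \<otimes> u)"
    unfolding eq using u w v by (simp add: word_simps)
  finally show ?thesis .
qed

text \<open>The element \<open>c\<close> measures how far \<open>y\<close> is from commuting with \<open>d\<close>; conjugating \<open>n\<close> times
  multiplies \<open>d\<close> by \<open>c\<close> to the \<open>n\<close>, so \<open>c\<close> has order dividing that of \<open>y\<close>.\<close>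

lemma coprime_conj_trivial:
  assumes y: "y \<in> carrier G" and d: "d \<in> carrier G" and c: "c \<in> carrier G"
    and eq: "y \<otimes> d \<otimes> inv y = d \<otimes> c" and yc: "y \<otimes> c = c \<otimes> y"
    and cop: "coprime (ord y) (ord c)"
  shows "y \<otimes> d = d \<otimes> y"
proof -
  have yd: "y \<otimes> d = d \<otimes> c \<otimes> y"
    using eq y d c by (metis inv_solve_right m_closed)
  have "y [^] n \<otimes> d = d \<otimes> c [^] n \<otimes> y [^] n" for n :: nat
  proof (induction n)
    case 0 then show ?case using d by simp
  next
    case (Suc n)
    have cy: "y \<otimes> c [^] n = c [^] n \<otimes> y"
      using group_commutes_pow[of c y n] yc y c by simp
    have "y [^] Suc n \<otimes> d = y \<otimes> (y [^] n \<otimes> d)"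
      using y d nat_pow_Suc2[OF y, of n] by (metis m_assoc nat_pow_closed)
    also have "\<dots> = y \<otimes> d \<otimes> c [^] n \<otimes> y [^] n"
      using y d c Suc by (metis m_assoc m_closed nat_pow_closed)
    also have "\<dots> = d \<otimes> c \<otimes> (y \<otimes> c [^] n) \<otimes> y [^] n"
      using y d c by (simp add: yd m_assoc)
    also have "\<dots> = d \<otimes> (c \<otimes> c [^] n) \<otimes> (y \<otimes> y [^] n)"
      using y d c by (simp add: cy m_assoc)
    also have "\<dots> = d \<otimes> c [^] Suc n \<otimes> y [^] Suc n"
      using nat_pow_Suc2[OF y, of n] nat_pow_Suc2[OF c, of n] by metis
    finally show ?case .
  qed
  from this[of "ord y"] have "d = d \<otimes> c [^] ord y"
    using y c d by simp
  then have "c [^] ord y = \<one>"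
    using d c by (metis l_cancel_one' nat_pow_closed)
  then have "ord c dvd ord y"
    using pow_eq_id c by blast
  then have "ord c = 1"
    using cop by (metis coprime_common_divisor dvd_refl nat_dvd_1_iff_1)
  then have "c = \<one>"
    using c ord_eq_1 by simp
  then show ?thesis
    using yd d y by simp
qed

end

lemma (in normal) group_hom_Mod: "group_hom G (G Mod H) (\<lambda>a. H #> a)"
  by (intro group_hom.intro group_hom_axioms.intro is_group factorgroup_is_group r_coset_hom_Mod)

lemma (in normal) Mod_eq_one_iff:
  assumes "x \<in> carrier G"
  shows "H #> x = H \<longleftrightarrow> x \<in> H"
  using assms coset_join1[OF _ _ is_subgroup] coset_join2[OF _ is_subgroup] by blast

lemma (in normal) commute_Mod_iff:
  assumes x: "x \<in> carrier G" and y: "y \<in> carrier G"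
  shows "(H #> x) \<otimes>\<^bsub>G Mod H\<^esub> (H #> y) = (H #> y) \<otimes>\<^bsub>G Mod H\<^esub> (H #> x) \<longleftrightarrow> commutator G x y \<in> H"
proof -
  interpret h: group_hom G "G Mod H" "\<lambda>a. H #> a" by (rule group_hom_Mod)
  have "commutator (G Mod H) (H #> x) (H #> y) = H #> commutator G x y"
    using x y h.hom_mult[of "x \<otimes> y \<otimes> inv x" "inv y"] h.hom_mult[of "x \<otimes> y" "inv x"] h.hom_mult[of x y]
      h.hom_inv[of x] h.hom_inv[of y] by simp
  then have "commutator G x y \<in> H \<longleftrightarrow> commutator (G Mod H) (H #> x) (H #> y) = \<one>\<^bsub>G Mod H\<^esub>"
    using Mod_eq_one_iff[of "commutator G x y"] x y by simp
  then show ?thesis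
    using h.H.commutator_one_iff[OF h.hom_closed[OF x] h.hom_closed[OF y]] by simp
qed

context group
begin

lemma normal_preimage_Mod:
  assumes N: "N \<lhd> G" and K: "K \<lhd> G Mod N"
  shows "{g \<in> carrier G. N #> g \<in> K} \<lhd> G"
proof -
  interpret N: normal N G by (rule N)
  interpret K: normal K "G Mod N" by (rule K)
  interpret h: group_hom G "G Mod N" "\<lambda>a. N #> a" by (rule N.group_hom_Mod)
  note mult_FactGroup [simp del] one_FactGroup [simp del]
  let ?P = "{g \<in> carrier G. N #> g \<in> K}"
  show ?thesis
  proof (rule normal_invI)
    show "subgroup ?P G"
    proof (rule subgroupI)
      have "\<one> \<in> ?P" using h.hom_one K.one_closed by simp
      then show "?P \<noteq> {}" by blast
      show "inv a \<in> ?P" if "a \<in> ?P" for a using that h.hom_inv K.m_inv_closed by simp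
      show "a \<otimes> b \<in> ?P" if "a \<in> ?P" "b \<in> ?P" for a b
        using that h.hom_mult[of a b] K.m_closed by simp
    qed blast
    show "g \<otimes> u \<otimes> inv g \<in> ?P" if "g \<in> carrier G" "u \<in> ?P" for g u
      using that K.inv_op_closed2[of "N #> g" "N #> u"] h.hom_mult[of "g \<otimes> u" "inv g"] h.hom_mult[of g u] h.hom_inv[of g]
        h.hom_closed[of g] by simp
  qed
qed

end

context finite_group
begin

lemma finite_subgroup: "subgroup H G \<Longrightarrow> finite H"
  using fin subgroup.subset finite_subset by blast

lemma card_subgroup_dvd:
  assumes "subgroup H G" "subgroup K G" "H \<subseteq> K"
  shows "card H dvd card K"
proof -
  interpret K: group "G\<lparr>carrier := K\<rparr>"
    using assms(2) by (rule subgroup_imp_group)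
  have "subgroup H (G\<lparr>carrier := K\<rparr>)"
    using subgroup_incl assms by blast
  from K.lagrange[OF this] show ?thesis
    unfolding order_def by (auto intro: dvdI simp: mult.commute dest: sym)
qed

lemma ord_dvd_card:
  assumes "subgroup H G" "x \<in> H"
  shows "ord x dvd card H"
proof -
  have x: "x \<in> carrier G"
    using assms subgroup.subset by blast
  have "generate G {x} \<subseteq> H"
    using assms generate_subgroup_incl by simp
  then show ?thesis
    using card_subgroup_dvd[OF generate_is_subgroup assms(1)] generate_pow_card[OF x] x by simp
qed

lemma ord_prime_power:
  assumes "subgroup H G" "card H = p ^ n" "prime p" "x \<in> H"
  obtains k where "ord x = p ^ k"
  using ord_dvd_card[OF assms(1,4)] that divides_primepow_nat[OF assms(3)] unfolding assms(2) by blast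

lemma ord_pos: "x \<in> carrier G \<Longrightarrow> ord x > 0"
  using ord_ge_1[OF fin, of x] by simp

lemma mem_generate_singleton:
  "x \<in> carrier G \<Longrightarrow> y \<in> generate G {x} \<longleftrightarrow> (\<exists>k::nat. y = x [^] k)"
  using generate_pow_on_finite_carrier[OF fin] by auto

text \<open>Every orbit has \<open>p\<close>-power size, so an orbit that is not a fixed point contributes a multiple of \<open>p\<close>.\<close>

lemma fixed_points_cong:
  fixes act :: "'a \<Rightarrow> 'x \<Rightarrow> 'x"
  assumes P: "subgroup P G" and card: "card P = p ^ n" and p: "prime p" and X: "finite X"
    and closed: "\<And>g x. \<lbrakk>g \<in> P; x \<in> X\<rbrakk> \<Longrightarrow> act g x \<in> X"
    and one: "\<And>x. x \<in> X \<Longrightarrow> act \<one> x = x"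
    and mult: "\<And>g h x. \<lbrakk>g \<in> P; h \<in> P; x \<in> X\<rbrakk> \<Longrightarrow> act (g \<otimes> h) x = act g (act h x)"
  shows "[card X = card {x \<in> X. \<forall>g\<in>P. act g x = x}] (mod p)"
proof -
  interpret P: subgroup P G by (rule P)
  let ?P = "G\<lparr>carrier := P\<rparr>"
  let ?a = "\<lambda>g. restrict (act g) X"
  interpret Pg: group ?P using P by (rule subgroup_imp_group)
  have bij: "?a g \<in> Bij X" if "g \<in> P" for g
  proof -
    have "bij_betw (act g) X X"
    proof (rule bij_betwI[where g="act (inv g)"])
      show "act (inv g) (act g x) = x" "act g (act (inv g) x) = x" if "x \<in> X" for x
        using that \<open>g \<in> P\<close> one mult[of "inv g" g x] mult[of g "inv g" x] by simp_all
    qed (use that closed in auto)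
    then show ?thesis
      by (simp add: Bij_def)
  qed
  have hom: "?a \<in> hom ?P (BijGroup X)"
  proof (rule homI)
    fix g assume "g \<in> carrier ?P"
    then show "?a g \<in> carrier (BijGroup X)"
      using bij by (simp add: BijGroup_def)
  next
    fix g h assume gh: "g \<in> carrier ?P" "h \<in> carrier ?P"
    have "?a (g \<otimes> h) = compose X (?a g) (?a h)"
      unfolding compose_def
    proof (rule restrict_ext)
      fix x assume "x \<in> X"
      then show "act (g \<otimes> h) x = ?a g (?a h x)"
        using gh mult closed by simp
    qed
    then show "?a (g \<otimes>\<^bsub>?P\<^esub> h) = ?a g \<otimes>\<^bsub>BijGroup X\<^esub> ?a h"
      using bij gh by (simp add: BijGroup_def)
  qed
  interpret group_action ?P X ?a
    by (intro group_action.intro group_hom.intro group_hom_axioms.intro hom group_BijGroup Pg.is_group)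
  let ?F = "{x \<in> X. \<forall>g\<in>P. act g x = x}"
  have orb: "orbit ?P ?a x = (\<lambda>g. act g x) ` P" if "x \<in> X" for x
    using that unfolding orbit_def by auto
  have orbcard: "[card Y = (if Y \<in> (\<lambda>x. {x}) ` ?F then 1 else 0)] (mod p)" if "Y \<in> orbits ?P X ?a" for Y
  proof -
    obtain x where x: "x \<in> X" "Y = orbit ?P ?a x"
      using \<open>Y \<in> orbits ?P X ?a\<close> unfolding orbits_def by blast
    have "card Y dvd p ^ n"
      using orbit_stabilizer_theorem[OF x(1)] x(2) card unfolding order_def by (auto dest: sym)
    then obtain k where k: "card Y = p ^ k"
      using p divides_primepow_nat by blast
    show ?thesis
    proof (cases "k = 0")
      case True
      then obtain y where y: "Y = {y}"
        using k card_1_singletonE by auto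
      then have "x = y"
        using x orbit_refl by blast
      then have "x \<in> ?F"
        using x y orb by auto
      then show ?thesis
        using y k True \<open>x = y\<close> by auto
    next
      case False
      then have "p dvd card Y"
        using k by simp
      moreover have "Y \<notin> (\<lambda>x. {x}) ` ?F"
        using k False prime_gt_1_nat[OF p] one_less_power[of p k] by auto
      ultimately show ?thesis
        by (simp add: cong_0_iff)
    qed
  qed
  have fin_orbs: "finite (orbits ?P X ?a)"
    using X unfolding orbits_def by auto
  have singl: "(\<lambda>x. {x}) ` ?F \<subseteq> orbits ?P X ?a"
  proof
    fix Y assume "Y \<in> (\<lambda>x. {x}) ` ?F"
    then obtain x where x: "x \<in> ?F" "Y = {x}" by auto
  then have xX: "x \<in> X" and "\<And>g. g \<in> P \<Longrightarrow> act g x = x" by simp_all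
    then have "(\<lambda>g. act g x) ` P = (\<lambda>_. x) ` P"
      by (intro image_cong refl)
    also have "\<dots> = {x}"
      using P.one_closed by (rule image_constant)
    finally have "orbit ?P ?a x = {x}"
      using orb[OF xX] by metis
    then have "Y = orbit ?P ?a x"
      using x(2) by metis
    then show "Y \<in> orbits ?P X ?a"
      unfolding orbits_def using xX by blast
  qed
  have "card X = (\<Sum>Y\<in>orbits ?P X ?a. \<Sum>x\<in>Y. 1)"
    using disjoint_sum[OF X, of "\<lambda>_. 1::nat"] by simp
  also have "\<dots> = (\<Sum>Y\<in>orbits ?P X ?a. card Y)"
    by simp
  also have "[\<dots> = (\<Sum>Y\<in>orbits ?P X ?a. if Y \<in> (\<lambda>x. {x}) ` ?F then 1 else 0)] (mod p)"
    by (rule cong_sum) (rule orbcard)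
  also have "(\<Sum>Y\<in>orbits ?P X ?a. if Y \<in> (\<lambda>x. {x}) ` ?F then 1 else 0) = card ((\<lambda>x. {x}) ` ?F)"
    using fin_orbs singl by (simp add: sum.If_cases Int_absorb1)
  also have "\<dots> = card ?F"
    by (rule card_image) auto
  finally show ?thesis .
qed

text \<open>Modulo \<open>Z\<close> this subgroup is the centre of \<open>R\<close>; with \<open>Z\<close> trivial it is the centre itself.\<close>

lemma subgroup_centralizing_mod:
  assumes "subgroup R G" "subgroup Z G" "Z \<subseteq> R"
    and "\<And>h z. \<lbrakk>h \<in> R; z \<in> Z\<rbrakk> \<Longrightarrow> h \<otimes> z \<otimes> inv h \<in> Z"
  shows "subgroup {x \<in> R. \<forall>h\<in>R. commutator G h x \<in> Z} G"
proof -
  interpret R: subgroup R G by fact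
  interpret Z: subgroup Z G by fact
  show ?thesis
  proof (rule subgroupI)
    show "{x \<in> R. \<forall>h\<in>R. commutator G h x \<in> Z} \<subseteq> carrier G"
      using R.subset by blast
    have "\<one> \<in> {x \<in> R. \<forall>h\<in>R. commutator G h x \<in> Z}"
      by simp
    then show "{x \<in> R. \<forall>h\<in>R. commutator G h x \<in> Z} \<noteq> {}"
      by (metis empty_iff)
  next
    fix x assume x: "x \<in> {x \<in> R. \<forall>h\<in>R. commutator G h x \<in> Z}"
    have "commutator G h (inv x) \<in> Z" if h: "h \<in> R" for h
    proof -
      have "inv (commutator G h x) \<in> Z"
        using x h by simp
      then have "inv x \<otimes> inv (commutator G h x) \<otimes> inv (inv x) \<in> Z"
        using x assms(4)[of "inv x" "inv (commutator G h x)"] by simp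
      moreover have "inv x \<otimes> inv (commutator G h x) \<otimes> inv (inv x) = commutator G h (inv x)"
        using x h by (simp add: word_simps)
      ultimately show ?thesis by simp
    qed
    then show "inv x \<in> {x \<in> R. \<forall>h\<in>R. commutator G h x \<in> Z}"
      using x by simp
  next
    fix x y assume x: "x \<in> {x \<in> R. \<forall>h\<in>R. commutator G h x \<in> Z}"
      and y: "y \<in> {x \<in> R. \<forall>h\<in>R. commutator G h x \<in> Z}"
    have "commutator G h (x \<otimes> y) \<in> Z" if h: "h \<in> R" for h
    proof -
      have "x \<otimes> commutator G h y \<otimes> inv x \<in> Z"
        using x y h assms(4) by simp
      then have "commutator G h x \<otimes> (x \<otimes> commutator G h y \<otimes> inv x) \<in> Z"
        using x h by simp
      moreover have "commutator G h x \<otimes> (x \<otimes> commutator G h y \<otimes> inv x) = commutator G h (x \<otimes> y)"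
        using x y h by (simp add: word_simps)
      ultimately show ?thesis by simp
    qed
    then show "x \<otimes> y \<in> {x \<in> R. \<forall>h\<in>R. commutator G h x \<in> Z}"
      using x y by simp
  qed
qed

text \<open>The nontrivial \<open>p\<close>-group \<open>R/Z\<close> has a central element of order \<open>p\<close>. The statement speaks
  of representatives in \<open>R\<close>, so that it can be used without passing to a quotient.\<close>

lemma p_group_central_mod:
  assumes R: "subgroup R G" and card: "card R = p ^ n" and p: "prime p"
    and Z: "subgroup Z G" "Z \<subseteq> R" "Z \<noteq> R"
    and norm: "\<And>h z. \<lbrakk>h \<in> R; z \<in> Z\<rbrakk> \<Longrightarrow> h \<otimes> z \<otimes> inv h \<in> Z"
  obtains g where "g \<in> R" "g \<notin> Z" "g [^] p \<in> Z" "\<And>h. h \<in> R \<Longrightarrow> commutator G h g \<in> Z"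
proof -
  interpret R: subgroup R G by fact
  interpret Z: subgroup Z G by fact
  (* R acts by conjugation on the cosets of Z in R. Their number is a positive power of p
     and Z itself is fixed, so there is a second fixed coset. *)
  let ?X = "(\<lambda>r. Z #> r) ` R"
  let ?act = "\<lambda>h X. (\<lambda>x. h \<otimes> x \<otimes> inv h) ` X"
  let ?F = "{X \<in> ?X. \<forall>h\<in>R. ?act h X = X}"
  interpret RG: group "G\<lparr>carrier := R\<rparr>" using R by (rule subgroup_imp_group)
  have act_coset: "?act h (Z #> r) = Z #> (h \<otimes> r \<otimes> inv h)" if "h \<in> R" "r \<in> R" for h r
  proof
    show "?act h (Z #> r) \<subseteq> Z #> (h \<otimes> r \<otimes> inv h)"
    proof
      fix x assume "x \<in> ?act h (Z #> r)"
      then obtain z where z: "z \<in> Z" "x = h \<otimes> (z \<otimes> r) \<otimes> inv h"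
        unfolding r_coset_def by auto
      then have "x = (h \<otimes> z \<otimes> inv h) \<otimes> (h \<otimes> r \<otimes> inv h)"
        using that by (simp add: word_simps)
      then show "x \<in> Z #> (h \<otimes> r \<otimes> inv h)"
        using norm[OF \<open>h \<in> R\<close> z(1)] unfolding r_coset_def by auto
    qed
    show "Z #> (h \<otimes> r \<otimes> inv h) \<subseteq> ?act h (Z #> r)"
    proof
      fix x assume "x \<in> Z #> (h \<otimes> r \<otimes> inv h)"
      then obtain z where z: "z \<in> Z" "x = z \<otimes> (h \<otimes> r \<otimes> inv h)"
        unfolding r_coset_def by auto
      have "inv h \<otimes> z \<otimes> inv (inv h) \<in> Z"
        using norm[of "inv h" z] z that by simp
      then have "(inv h \<otimes> z \<otimes> h) \<otimes> r \<in> Z #> r"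
        using that unfolding r_coset_def by auto
      moreover have "x = h \<otimes> ((inv h \<otimes> z \<otimes> h) \<otimes> r) \<otimes> inv h"
        using z that by (simp add: word_simps)
      ultimately show "x \<in> ?act h (Z #> r)" by blast
    qed
  qed
  have Xsub: "X \<subseteq> carrier G" if "X \<in> ?X" for X
    using that r_coset_subset_G[OF Z.subset R.mem_carrier] by blast
  have ZR: "subgroup Z (G\<lparr>carrier := R\<rparr>)"
    using subgroup_incl Z(1,2) R by blast
  have "?X = rcosets\<^bsub>G\<lparr>carrier := R\<rparr>\<^esub> Z"
    unfolding RCOSETS_def by auto
  then have cardX: "card ?X * card Z = p ^ n"
    using RG.lagrange[OF ZR] card unfolding order_def by simp
  then obtain k where k: "card ?X = p ^ k"
    using divides_primepow_nat[OF p] by (metis dvd_triv_left)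
  have "k \<noteq> 0"
  proof
    assume "k = 0"
    then have "card Z = card R"
      using cardX k card by simp
    then show False
      using Z(2,3) finite_subgroup[OF R] card_subset_eq by metis
  qed
  then have pX: "p dvd card ?X"
    using k by simp
  have "[card ?X = card ?F] (mod p)"
  proof (rule fixed_points_cong[OF R card p])
    show "finite ?X" using finite_subgroup[OF R] by simp
    show "?act h X \<in> ?X" if "h \<in> R" "X \<in> ?X" for h X
      using that act_coset by fastforce
    show "?act \<one> X = X" if "X \<in> ?X" for X
    proof -
      have "X \<subseteq> carrier G"
        using that Xsub by blast
      then have "(\<lambda>x. \<one> \<otimes> x \<otimes> inv \<one>) ` X = (\<lambda>x. x) ` X"
        by (intro image_cong) auto
      then show ?thesis by simp
    qed
    show "?act (g \<otimes> h) X = ?act g (?act h X)" if "g \<in> R" "h \<in> R" "X \<in> ?X" for g h X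
    proof -
      have "X \<subseteq> carrier G"
        using that(3) Xsub by blast
      then show ?thesis
        unfolding image_image using that(1,2) by (intro image_cong) (auto simp: word_simps)
    qed
  qed
  then have pF: "p dvd card ?F"
    using pX cong_dvd_iff by blast
  have ZF: "Z \<in> ?F"
  proof -
    have "Z = Z #> \<one>" using Z.subset by simp
    then have "?act h Z = Z" if "h \<in> R" for h
      using act_coset[OF that R.one_closed] that by simp
    moreover have "Z \<in> ?X" using \<open>Z = Z #> \<one>\<close> R.one_closed by (rule image_eqI)
    ultimately show ?thesis by blast
  qed
  have "card ?F \<noteq> 1"
    using pF prime_gt_1_nat[OF p] nat_dvd_1_iff_1 by (metis less_irrefl)
  then have "?F \<noteq> {Z}"
    by auto
  moreover have "\<And>A z. \<lbrakk>A \<noteq> {z}; z \<in> A\<rbrakk> \<Longrightarrow> \<exists>X\<in>A. X \<noteq> z"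
    by auto
  ultimately obtain X where X: "X \<in> ?F" "X \<noteq> Z"
    using ZF by meson
  then obtain r where r: "r \<in> R" "X = Z #> r" by blast
  have rZ: "r \<notin> Z"
    using X(2) r coset_join2[OF R.mem_carrier[OF r(1)] Z(1)] by metis
  have fixed: "?act h X = X" if "h \<in> R" for h
    using X(1) that by simp
  let ?C = "{x \<in> R. \<forall>h\<in>R. commutator G h x \<in> Z}"
  have C: "subgroup ?C G"
    using subgroup_centralizing_mod[OF R Z(1,2) norm] .
  have rC: "r \<in> ?C"
  proof -
    have "commutator G h r \<in> Z" if h: "h \<in> R" for h
    proof -
      have "Z #> (h \<otimes> r \<otimes> inv h) = Z #> r"
        using fixed[OF h] r(2) act_coset[OF h r(1)] by metis
      then have "h \<otimes> r \<otimes> inv h \<in> Z #> r"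
        using rcos_self[OF _ Z(1), of "h \<otimes> r \<otimes> inv h"] h r(1) by auto
      then show ?thesis
        using Z.rcos_module_imp[OF is_group] r(1) by simp
    qed
    then show ?thesis using r by simp
  qed
  (* The last p-power of r outside Z has its own p-th power in Z. *)
  have ex: "\<exists>k. r [^] (p ^ k) \<in> Z"
  proof -
    obtain k where "ord r = p ^ k" using ord_prime_power[OF R card p r(1)] .
    then have "r [^] (p ^ k) = \<one>" using r(1) by (metis R.mem_carrier pow_ord_eq_1)
    then show ?thesis by (metis Z.one_closed)
  qed
  define k where "k = (LEAST k. r [^] (p ^ k) \<in> Z)"
  have k: "r [^] (p ^ k) \<in> Z" unfolding k_def using ex by (rule LeastI_ex)
  have "k \<noteq> 0" using k rZ r(1) by (metis R.mem_carrier nat_pow_eone power_0)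
  then obtain j where j: "k = Suc j" using not0_implies_Suc by blast
  show thesis
  proof (rule that[of "r [^] (p ^ j)"])
    show "r [^] (p ^ j) \<notin> Z"
      using j not_less_Least[of j "\<lambda>k. r [^] (p ^ k) \<in> Z"] unfolding k_def by simp
    show "r [^] (p ^ j) \<in> R" using R r(1) subgroup_pow_closed by blast
    show "(r [^] (p ^ j)) [^] p \<in> Z"
      using k j r(1) by (simp add: nat_pow_pow mult.commute)
    show "commutator G h (r [^] (p ^ j)) \<in> Z" if "h \<in> R" for h
      using subgroup_pow_closed[OF C rC, of "p ^ j"] that by blast
  qed
qed

lemma p_group_central:
  assumes R: "subgroup R G" and "card R = p ^ n" "prime p" "R \<noteq> {\<one>}"
  obtains z where "z \<in> R" "z \<noteq> \<one>" "z [^] p = \<one>" "\<And>h. h \<in> R \<Longrightarrow> commutator G h z = \<one>"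
proof -
  interpret R: subgroup R G by (rule R)
  have "h \<otimes> z \<otimes> inv h \<in> {\<one>}" if "h \<in> R" "z \<in> {\<one>}" for h z
    using that by simp
  then show thesis
    using p_group_central_mod[OF R assms(2,3) triv_subgroup] assms(4) R.one_closed that
    by (metis empty_subsetI insert_subset singletonD)
qed

lemma finite_group_Mod:
  assumes "N \<lhd> G"
  shows "finite_group (G Mod N)"
proof -
  interpret N: normal N G by (rule assms)
  interpret Q: group "G Mod N" by (rule N.factorgroup_is_group)
  show ?thesis
    by unfold_locales (simp add: carrier_FactGroup fin)
qed

end

section \<open>The p-groups with one subgroup of order p\<close>

lemma (in group) commute_inv:
  assumes x: "x \<in> carrier G" and y: "y \<in> carrier G" and xy: "x \<otimes> y = y \<otimes> x"
  shows "inv x \<otimes> y = y \<otimes> inv x"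
proof -
  have "inv x \<otimes> y = inv x \<otimes> (y \<otimes> x) \<otimes> inv x"
    using x y by (simp add: word_simps)
  also have "\<dots> = y \<otimes> inv x"
    using x y by (simp add: xy[symmetric] inv_cancel_left)
  finally show ?thesis .
qed

lemma (in group) subgroup_centralizer:
  assumes R: "subgroup R G" and g: "g \<in> carrier G"
  shows "subgroup {x \<in> R. x \<otimes> g = g \<otimes> x} G"
proof -
  interpret R: subgroup R G by (rule R)
  show ?thesis
  proof (rule subgroupI)
    show "{x \<in> R. x \<otimes> g = g \<otimes> x} \<subseteq> carrier G"
      using R.subset by blast
    have "\<one> \<in> {x \<in> R. x \<otimes> g = g \<otimes> x}"
      using g by simp
    then show "{x \<in> R. x \<otimes> g = g \<otimes> x} \<noteq> {}"
      by (metis empty_iff)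
    show "inv x \<in> {x \<in> R. x \<otimes> g = g \<otimes> x}" if "x \<in> {x \<in> R. x \<otimes> g = g \<otimes> x}" for x
      using that commute_inv[of x g] g by simp
    show "x \<otimes> y \<in> {x \<in> R. x \<otimes> g = g \<otimes> x}"
      if x: "x \<in> {x \<in> R. x \<otimes> g = g \<otimes> x}" and y: "y \<in> {x \<in> R. x \<otimes> g = g \<otimes> x}" for x y
    proof -
      have car: "x \<in> carrier G" "y \<in> carrier G" using x y by simp_all
      have "x \<otimes> y \<otimes> g = x \<otimes> (y \<otimes> g)" using car g by (simp add: m_assoc)
      also have "\<dots> = x \<otimes> (g \<otimes> y)" using y by simp
      also have "\<dots> = x \<otimes> g \<otimes> y" using car g by (simp add: m_assoc)
      also have "\<dots> = g \<otimes> x \<otimes> y" using x by simp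
      also have "\<dots> = g \<otimes> (x \<otimes> y)" using car g by (simp add: m_assoc)
      finally show ?thesis using x y by simp
    qed
  qed
qed

lemma (in group) commute_pow_class_two:
  assumes x: "x \<in> carrier G" and y: "y \<in> carrier G" and e: "e \<in> carrier G"
    and ex: "e \<otimes> x = x \<otimes> e" and ey: "e \<otimes> y = y \<otimes> e" and xy: "x \<otimes> y = e \<otimes> y \<otimes> x"
  shows "x [^] n \<otimes> y = e [^] n \<otimes> y \<otimes> x [^] (n::nat)"
proof (induction n)
  case 0 then show ?case using y by simp
next
  case (Suc n)
  have eny: "e [^] n \<otimes> e = e \<otimes> e [^] n"
    using e by (metis nat_pow_Suc nat_pow_Suc2)
  have enx: "x \<otimes> e [^] n = e [^] n \<otimes> x"
    using group_commutes_pow[OF ex e x, of n] by simp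
  have "x [^] Suc n \<otimes> y = x \<otimes> (x [^] n \<otimes> y)"
    using x y nat_pow_Suc2[OF x, of n] by (metis m_assoc nat_pow_closed)
  also have "\<dots> = (x \<otimes> e [^] n) \<otimes> (y \<otimes> x [^] n)"
    using Suc x y e by (simp add: m_assoc)
  also have "\<dots> = e [^] n \<otimes> (x \<otimes> y) \<otimes> x [^] n"
    using x y e by (simp add: enx m_assoc)
  also have "\<dots> = e [^] n \<otimes> e \<otimes> y \<otimes> (x \<otimes> x [^] n)"
    using x y e by (simp add: xy m_assoc)
  also have "\<dots> = e [^] Suc n \<otimes> y \<otimes> x [^] Suc n"
    using nat_pow_Suc2[OF x, of n] by simp
  finally show ?case .
qed

text \<open>The collection formula for two elements whose commutator \<open>e\<close> is central in the group that they generate.\<close>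

lemma (in group) pow_mult_class_two:
  assumes x: "x \<in> carrier G" and y: "y \<in> carrier G" and e: "e \<in> carrier G"
    and ex: "e \<otimes> x = x \<otimes> e" and ey: "e \<otimes> y = y \<otimes> e" and xy: "x \<otimes> y = e \<otimes> y \<otimes> x"
  shows "(y \<otimes> x) [^] n = e [^] (n * (n - 1) div 2) \<otimes> y [^] n \<otimes> x [^] (n::nat)"
proof (induction n)
  case 0 then show ?case by simp
next
  case (Suc n)
  let ?t = "n * (n - 1) div 2"
  have t: "Suc n * (Suc n - 1) div 2 = ?t + n"
    by (cases n) (auto simp: algebra_simps)
  have yne: "y [^] n \<otimes> e [^] n = e [^] n \<otimes> y [^] n"
  proof -
    have "y [^] n \<otimes> e = e \<otimes> y [^] n"
      using group_commutes_pow[of y e n] ey y e by simp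
    then have "e [^] n \<otimes> y [^] n = y [^] n \<otimes> e [^] n"
      using group_commutes_pow[of e "y [^] n" n] y e by simp
    then show ?thesis by simp
  qed
  have "(y \<otimes> x) [^] Suc n = e [^] ?t \<otimes> y [^] n \<otimes> (x [^] n \<otimes> y) \<otimes> x"
    using Suc x y e by (simp add: m_assoc)
  also have "\<dots> = e [^] ?t \<otimes> y [^] n \<otimes> (e [^] n \<otimes> y \<otimes> x [^] n) \<otimes> x"
    using commute_pow_class_two[OF assms, of n] by simp
  also have "\<dots> = e [^] ?t \<otimes> (y [^] n \<otimes> e [^] n) \<otimes> (y \<otimes> (x [^] n \<otimes> x))"
    using x y e by (simp add: m_assoc)
  also have "\<dots> = (e [^] ?t \<otimes> e [^] n) \<otimes> (y [^] n \<otimes> y) \<otimes> (x [^] n \<otimes> x)"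
    using x y e by (simp add: yne m_assoc)
  also have "\<dots> = e [^] (Suc n * (Suc n - 1) div 2) \<otimes> y [^] Suc n \<otimes> x [^] Suc n"
    using e t by (simp add: nat_pow_mult)
  finally show ?case .
qed

text \<open>For a prime \<open>p\<close> this says that \<open>R\<close> has at most one subgroup of order \<open>p\<close>.\<close>

definition (in group) unique_prime_subgroup :: "nat \<Rightarrow> 'a set \<Rightarrow> bool" where
  "unique_prime_subgroup p R \<longleftrightarrow>
     (\<forall>x\<in>R. \<forall>y\<in>R. ord x = p \<longrightarrow> ord y = p \<longrightarrow> (\<exists>j::nat. y = x [^] j))"

lemma (in group) unique_prime_subgroupD:
  "\<lbrakk>unique_prime_subgroup p R; x \<in> R; y \<in> R; ord x = p; ord y = p\<rbrakk> \<Longrightarrow> \<exists>j::nat. y = x [^] j"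
  unfolding unique_prime_subgroup_def by blast

lemma (in group) unique_prime_subgroup_mono:
  "\<lbrakk>unique_prime_subgroup p R; S \<subseteq> R\<rbrakk> \<Longrightarrow> unique_prime_subgroup p S"
  unfolding unique_prime_subgroup_def by blast

context finite_group
begin

lemma ord_eq_prime:
  assumes "x \<in> carrier G" "x [^] p = \<one>" "x \<noteq> \<one>" "prime p"
  shows "ord x = p"
proof -
  have "ord x dvd p" using assms pow_eq_id by blast
  moreover have "ord x \<noteq> 1" using assms ord_eq_1 by blast
  ultimately show ?thesis using assms(4) by (metis prime_nat_iff)
qed

text \<open>Induction on the order of \<open>b\<close>. The \<open>p\<close>-th power of \<open>b\<close> is a power of that of \<open>a\<close>, so
  \<open>b\<close> is a power of \<open>a\<close> times an element \<open>w\<close> whose \<open>p\<close>-th power is \<open>1\<close>; and \<open>w\<close> lies in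
  the one subgroup of order \<open>p\<close>, which consists of powers of \<open>a\<close>.\<close>

lemma commuting_pow_if_ord_le:
  assumes R: "subgroup R G" and card: "card R = p ^ n" and p: "prime p"
    and uniq: "unique_prime_subgroup p R"
    and "a \<in> R" "b \<in> R" "a \<otimes> b = b \<otimes> a" "ord b \<le> ord a"
  shows "\<exists>j::nat. b = a [^] j"
proof -
  interpret R: subgroup R G by (rule R)
  obtain k where "ord b = p ^ k" using ord_prime_power[OF R card p \<open>b \<in> R\<close>] .
  with assms(5-8) show ?thesis
  proof (induction k arbitrary: a b)
    case 0
    then have "b = \<one>" using ord_eq_1 by simp
    then show ?case by (metis nat_pow_0)
  next
    case (Suc k)
    have a: "a \<in> carrier G" and b: "b \<in> carrier G" using Suc by auto
    obtain m where m: "ord a = p ^ m" using ord_prime_power[OF R card p \<open>a \<in> R\<close>] .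
    have "p > 1" using p prime_gt_1_nat by blast
    then have "Suc k \<le> m" using m Suc.prems power_le_imp_le_exp by metis
    then obtain l where l: "m = Suc l" by (cases m) auto
    have bp: "ord (b [^] p) = p ^ k" and ap: "ord (a [^] p) = p ^ l"
      using ord_pow[of b p] ord_pow[of a p] a b m l Suc.prems(5) p \<open>p > 1\<close> by auto
    have al: "ord (a [^] (p ^ l)) = p"
      using ord_pow[of a "p ^ l"] a m l p \<open>p > 1\<close> by simp
    have com: "a [^] p \<otimes> b [^] p = b [^] p \<otimes> a [^] p"
      using group_commutes_pow[of b a p] group_commutes_pow[of a "b [^] p" p] Suc.prems(3) a b by simp
    have "\<exists>j::nat. b [^] p = (a [^] p) [^] j"
    proof (rule Suc.IH[of "a [^] p" "b [^] p"])
      show "ord (b [^] p) \<le> ord (a [^] p)"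
        using bp ap l \<open>Suc k \<le> m\<close> \<open>p > 1\<close> by simp
    qed (use Suc.prems R subgroup_pow_closed com bp in auto)
    then obtain j :: nat where j: "b [^] p = (a [^] p) [^] j" by blast
    define w where "w = inv (a [^] j) \<otimes> b"
    have ajb: "inv (a [^] j) \<otimes> b = b \<otimes> inv (a [^] j)"
    proof -
      have "a [^] j \<otimes> b = b \<otimes> a [^] j"
        using group_commutes_pow[of a b j] Suc.prems(3) a b by simp
      then show ?thesis
        using a b by (metis inv_solve_left' inv_solve_right m_assoc inv_closed nat_pow_closed m_closed)
    qed
    have "w [^] p = inv (a [^] j) [^] p \<otimes> b [^] p"
      unfolding w_def using pow_mult_distrib[OF ajb] a b by simp
    also have "\<dots> = inv ((a [^] j) [^] p) \<otimes> (a [^] p) [^] j"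
      using j a by (simp add: nat_pow_inv)
    also have "\<dots> = \<one>"
      using a by (simp add: nat_pow_pow mult.commute)
    finally have wp: "w [^] p = \<one>" .
    have wR: "w \<in> R" unfolding w_def using R Suc.prems subgroup_pow_closed by auto
    have bw: "b = a [^] j \<otimes> w"
      unfolding w_def using a b by (simp add: cancel_inv_left)
    show ?case
    proof (cases "w = \<one>")
      case True then show ?thesis using bw a by auto
    next
      case False
      then have "ord w = p" using ord_eq_prime wp p wR by simp
      moreover have "a [^] (p ^ l) \<in> R" using R Suc.prems subgroup_pow_closed by auto
      ultimately obtain i :: nat where "w = (a [^] (p ^ l)) [^] i"
        using unique_prime_subgroupD[OF uniq _ wR al] by blast
      then have "b = a [^] (j + p ^ l * i)"
        using bw a by (simp add: nat_pow_pow nat_pow_mult)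
      then show ?thesis by blast
    qed
  qed
qed

text \<open>By the preceding lemma the centre \<open>Z\<close> is generated by an element \<open>u\<close>. If \<open>R\<close> is not
  abelian, choose \<open>g\<close> outside \<open>Z\<close> that is central of order \<open>p\<close> modulo \<open>Z\<close>, and \<open>h\<close> that does
  not commute with \<open>g\<close>. Then \<open>g\<close> and \<open>h\<close> have the same order, the \<open>p\<close>-th power of \<open>h\<close> is a
  power of that of \<open>g\<close>, and by the collection formula a quotient of \<open>h\<close> by a power of
  \<open>g\<close> has so small an order that it lies in \<open>Z\<close>. But then \<open>h\<close> commutes with \<open>g\<close>. For \<open>p = 2\<close>
  the collection formula leaves a factor of order two; the central element of order four
  makes up for it, and the quaternion group of order eight shows that it cannot be left out.\<close>

lemma unique_prime_subgroup_cyclic: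
  assumes R: "subgroup R G" and card: "card R = p ^ n" and p: "prime p"
    and uniq: "unique_prime_subgroup p R"
    and two: "p = 2 \<Longrightarrow> \<exists>w\<in>R. ord w = 4 \<and> (\<forall>h\<in>R. h \<otimes> w = w \<otimes> h)"
  shows "\<exists>a\<in>R. \<forall>b\<in>R. \<exists>j::nat. b = a [^] j"
proof -
  interpret R: subgroup R G by (rule R)
  have p1: "p > 1" using p prime_gt_1_nat by blast
  define Z where "Z = {z \<in> R. \<forall>h\<in>R. commutator G h z \<in> {\<one>}}"
  have Zsub: "subgroup Z G"
    unfolding Z_def
  proof (rule subgroup_centralizing_mod[OF R])
    show "subgroup {\<one>} G" by (rule triv_subgroup)
  qed auto
  interpret Z: subgroup Z G by (rule Zsub)
  have Z_iff: "z \<in> Z \<longleftrightarrow> z \<in> R \<and> (\<forall>h\<in>R. h \<otimes> z = z \<otimes> h)" for z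
    unfolding Z_def using commutator_one_iff by (auto simp del: One_nat_def)
  have ZR: "Z \<subseteq> R" unfolding Z_def by blast
  have finZ: "finite Z" using finite_subgroup[OF Zsub] .
  have "\<exists>u\<in>Z. \<forall>z\<in>Z. ord z \<le> ord u"
  proof -
    have ne: "ord ` Z \<noteq> {}" using Z.one_closed by blast
    have fi: "finite (ord ` Z)" using finZ by simp
    obtain u where "u \<in> Z" "ord u = Max (ord ` Z)" using Max_in[OF fi ne] by auto
    then have "\<forall>z\<in>Z. ord z \<le> ord u" using Max_ge[OF fi] by simp
    then show ?thesis using \<open>u \<in> Z\<close> by blast
  qed
  then obtain u where u: "u \<in> Z" and umax: "\<And>z. z \<in> Z \<Longrightarrow> ord z \<le> ord u" by blast
  have uR: "u \<in> R" using u ZR by blast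
  have small: "\<exists>j::nat. v = u [^] j" if "v \<in> R" "ord v \<le> ord u" for v
    using commuting_pow_if_ord_le[OF R card p uniq uR that(1) _ that(2)] u that(1) Z_iff by metis
  have smallZ: "v \<in> Z" if "v \<in> R" "ord v \<le> ord u" for v
    using small[OF that] subgroup_pow_closed[OF Zsub u] by auto
  show ?thesis
  proof (cases "Z = R")
    case True
    then show ?thesis using small umax uR by blast
  next
    case False
    have "h \<otimes> z \<otimes> inv h \<in> Z" if "h \<in> R" "z \<in> Z" for h z
    proof -
      have "h \<otimes> z \<otimes> inv h = z"
        using that Z_iff[of z] commuting_if_conj[of h z] R.mem_carrier by blast
      then show ?thesis using that by simp
    qed
    then obtain g where g: "g \<in> R" "g \<notin> Z" "g [^] p \<in> Z" and gZ: "\<And>h. h \<in> R \<Longrightarrow> commutator G h g \<in> Z"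
      using p_group_central_mod[OF R card p Zsub ZR False] by metis
    obtain h where h: "h \<in> R" "h \<otimes> g \<noteq> g \<otimes> h" using g Z_iff by auto
    have gc: "g \<in> carrier G" and hc: "h \<in> carrier G" using g h by auto
    define c where "c = commutator G h g"
    have cZ: "c \<in> Z" unfolding c_def using gZ h by blast
    have cc: "c \<in> carrier G" using cZ by simp
    have hg: "h \<otimes> g = c \<otimes> g \<otimes> h" unfolding c_def using gc hc by (simp add: word_simps)
    have ch: "c \<otimes> h = h \<otimes> c" and cg: "c \<otimes> g = g \<otimes> c" using cZ Z_iff g h by auto
    have c1: "c \<noteq> \<one>" using hg h gc hc by auto
    have hgp: "h \<otimes> g [^] k \<otimes> inv h = c [^] k \<otimes> g [^] k" for k :: nat
    proof -
      have "h \<otimes> g [^] k \<otimes> inv h = (h \<otimes> g \<otimes> inv h) [^] k" using conj_pow gc hc by simp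
      also have "h \<otimes> g \<otimes> inv h = c \<otimes> g" unfolding c_def using gc hc by (simp add: word_simps)
      finally show ?thesis using pow_mult_distrib[OF cg cc gc] by simp
    qed
    (* Conjugation by h multiplies the p-th power of g, which is central, by that of c. *)
    have cp: "c [^] p = \<one>"
    proof -
      have "h \<otimes> g [^] p \<otimes> inv h = g [^] p"
        using g(3) Z_iff[of "g [^] p"] h(1) commuting_if_conj[OF hc nat_pow_closed[OF gc]] by blast
      then have "c [^] p \<otimes> g [^] p = g [^] p" using hgp by simp
      then show ?thesis using gc cc by simp
    qed
    have big: "ord u < ord v" if "v \<in> R" "v \<notin> Z" for v
      using smallZ that not_le by blast
    obtain k where k: "ord u = p ^ k" using ord_prime_power[OF R card p uR] .
    have "ord c = p" using ord_eq_prime[OF cc cp c1 p] .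
    then have "p ^ 1 \<le> p ^ k" using umax[OF cZ] k by simp
    then have k1: "k \<ge> 1" using p1 power_le_imp_le_exp by blast
    obtain a where a: "ord g = p ^ a" using ord_prime_power[OF R card p g(1)] .
    obtain b where b: "ord h = p ^ b" using ord_prime_power[OF R card p h(1)] .
    have hZ: "h \<notin> Z" using Z_iff g(1) h(2) by metis
    have ka: "k < a" using big[OF g(1,2)] k a p1 by simp
    have kb: "k < b" using big[OF h(1) hZ] k b p1 by simp
    have gp: "ord (g [^] p) = p ^ (a - 1)"
    proof -
      have "p ^ a = p * p ^ (a - 1)" using ka by (cases a) auto
      then show ?thesis using ord_pow[of g p] a gc p1 by simp
    qed
    have hp: "ord (h [^] p) = p ^ (b - 1)"
    proof -
      have "p ^ b = p * p ^ (b - 1)" using kb by (cases b) auto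
      then show ?thesis using ord_pow[of h p] b hc p1 by simp
    qed
    have "p ^ (a - 1) \<le> p ^ k" using umax[OF g(3)] gp k by simp
    then have ak: "a = Suc k" using ka p1 by simp
    have hpg: "h [^] p \<otimes> g = g \<otimes> h [^] p"
      using commute_pow_class_two[OF hc gc cc ch cg hg, of p] cp gc hc by simp
    have bk: "b = Suc k"
    proof (rule ccontr)
      assume "b \<noteq> Suc k"
      then have "a \<le> b - 1" using kb ak by simp
      then have "ord g \<le> ord (h [^] p)" using a hp p1 by simp
      moreover have "h [^] p \<in> R" using R h subgroup_pow_closed by blast
      ultimately obtain i :: nat where "g = (h [^] p) [^] i"
        using commuting_pow_if_ord_le[OF R card p uniq _ g(1) hpg] by blast
      then have "g = h [^] (p * i)" using hc by (simp add: nat_pow_pow)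
      then have "h \<otimes> g = g \<otimes> h" using hc by (metis nat_pow_Suc nat_pow_Suc2)
      then show False using h(2) by simp
    qed
    have hpR: "h [^] p \<in> R" and gpR: "g [^] p \<in> R" using R h g subgroup_pow_closed by blast+
    have "g [^] p \<otimes> h [^] p = h [^] p \<otimes> g [^] p"
      using g(3) hpR Z_iff by metis
    then obtain j :: nat where j: "h [^] p = (g [^] p) [^] j"
      using commuting_pow_if_ord_le[OF R card p uniq gpR hpR] hp gp ak bk by auto
    define y where "y = inv (g [^] j)"
    define e where "e = inv (c [^] j)"
    have yc: "y \<in> carrier G" unfolding y_def using gc by simp
    have eZ: "e \<in> Z" unfolding e_def using subgroup_pow_closed[OF Zsub cZ] by simp
    have ec: "e \<in> carrier G" using eZ by simp
    have yR: "y \<in> R" unfolding y_def using R g subgroup_pow_closed by auto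
    have eh: "e \<otimes> h = h \<otimes> e" and ey: "e \<otimes> y = y \<otimes> e" using eZ Z_iff h(1) yR by auto
    have hy: "h \<otimes> y = e \<otimes> y \<otimes> h"
    proof -
      have "h \<otimes> y \<otimes> inv h = inv (h \<otimes> g [^] j \<otimes> inv h)"
        unfolding y_def using gc hc by (simp add: word_simps)
      also have "\<dots> = y \<otimes> e"
        unfolding hgp y_def e_def using gc cc by (simp add: inv_mult_group)
      finally have "h \<otimes> y \<otimes> inv h = e \<otimes> y" using ey by simp
      then show ?thesis using inv_solve_right'[of "e \<otimes> y" "h \<otimes> y" h] hc yc ec by simp
    qed
    (* Here y is the inverse of the power of g with the same p-th power as h, so in the
       collection formula for w only the power of e survives. *)
    define w where "w = y \<otimes> h"
    have wR: "w \<in> R" unfolding w_def using yR h by simp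
    have wc: "w \<in> carrier G" using wR by simp
    have ep: "e [^] p = \<one>"
    proof -
      have "(c [^] j) [^] p = (c [^] p) [^] j" using cc by (simp add: nat_pow_pow mult.commute)
      then show ?thesis unfolding e_def using cc cp by (simp add: nat_pow_inv)
    qed
    have yp: "y [^] p \<otimes> h [^] p = \<one>"
    proof -
      have "y [^] p = inv (h [^] p)"
        unfolding y_def j using gc by (simp add: nat_pow_inv nat_pow_pow mult.commute)
      then show ?thesis using hc by simp
    qed
    have wp: "w [^] p = e [^] (p * (p - 1) div 2)"
      unfolding w_def pow_mult_class_two[OF hc yc ec eh ey hy, of p]
      using yp yc ec hc by (simp add: m_assoc)
    have "ord w \<le> ord u"
    proof (cases "p = 2")
      case True
      have "w [^] (4::nat) = (w [^] p) [^] (2::nat)" using wc True by (simp add: nat_pow_pow)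
      also have "\<dots> = \<one>" using wp ep True ec by (simp add: nat_pow_pow)
      finally have "ord w dvd 4" using wc pow_eq_id by blast
      then have "ord w \<le> 4" by (simp add: dvd_imp_le)
      also have "4 \<le> ord u" using two[OF True] umax Z_iff by metis
      finally show ?thesis .
    next
      case False
      then have "odd p" using p prime_odd_nat p1 by (metis less_2_cases_iff nat_less_le not_less_iff_gr_or_eq prime_ge_2_nat)
      (* For odd p the exponent p * (p - 1) div 2 is a multiple of the order of e. *)
      then have "even (p - 1)" by simp
      then have "p * (p - 1) div 2 = p * ((p - 1) div 2)" by (simp add: div_mult_swap)
      then have "e [^] (p * (p - 1) div 2) = \<one>" using ep ec by (metis nat_pow_one nat_pow_pow)
      then have "ord w dvd p" using wp wc pow_eq_id by simp
      then have "ord w \<le> p ^ 1" using p1 by (simp add: dvd_imp_le)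
      also have "\<dots> \<le> ord u" using k k1 p1 by (metis less_imp_le_nat power_increasing)
      finally show ?thesis .
    qed
    then have "w \<in> Z" using smallZ wR by blast
    then have wg: "g \<otimes> w = w \<otimes> g" using Z_iff g(1) by blast
    have hw: "h = g [^] j \<otimes> w"
      unfolding w_def y_def using gc hc by (simp add: cancel_inv_left)
    have "g \<otimes> h = g \<otimes> g [^] j \<otimes> w" using hw gc wc by (simp add: m_assoc)
    also have "\<dots> = g [^] j \<otimes> (g \<otimes> w)" using gc wc nat_pow_Suc nat_pow_Suc2 by (metis m_assoc nat_pow_closed)
    also have "\<dots> = h \<otimes> g" using hw gc wc wg by (simp add: m_assoc)
    finally show ?thesis using h(2) by simp
  qed
qed

text \<open>If \<open>R\<close> has more than two elements, some \<open>g\<close> of order four generates a normal subgroup of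
  \<open>R\<close>. Its centralizer has index at most two and is cyclic, since \<open>g\<close> is central in it. The
  condition on products expresses the bound on the index.\<close>

lemma unique_involution_cyclic_index_two:
  assumes R: "subgroup R G" and card: "card R = 2 ^ n" and uniq: "unique_prime_subgroup 2 R"
  obtains a where "a \<in> R"
    "\<And>x y. \<lbrakk>x \<in> R; y \<in> R; x \<notin> generate G {a}; y \<notin> generate G {a}\<rbrakk> \<Longrightarrow> x \<otimes> y \<in> generate G {a}"
proof -
  interpret R: subgroup R G by (rule R)
  show thesis
  proof (cases "R = {\<one>}")
    case True
    then show ?thesis using that[of \<one>] generate_one by simp
  next
    case False
    then obtain z where z: "z \<in> R" "z \<noteq> \<one>" "z [^] (2::nat) = \<one>"
      and zc: "\<And>h. h \<in> R \<Longrightarrow> commutator G h z = \<one>"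
      using p_group_central[OF R card two_is_prime_nat False] by metis
    have zcar: "z \<in> carrier G" using z by simp
    have zcomm: "h \<otimes> z = z \<otimes> h" if "h \<in> R" for h
      using zc[OF that] commutator_one_iff that zcar by simp
    have zz: "z \<otimes> z = \<one>" using z(3) zcar by (simp add: numeral_2_eq_2)
    have oz: "ord z = 2" using ord_eq_prime[OF zcar z(3,2)] by simp
    have zpow: "z [^] j \<in> {\<one>, z}" for j :: nat
      using zz zcar by (induction j) auto
    have Zsub: "subgroup {\<one>, z} G"
    proof (rule subgroupI)
      have "inv z = z" using zz zcar inv_equality by blast
      then show "inv a \<in> {\<one>, z}" if "a \<in> {\<one>, z}" for a using that by auto
    qed (use zz zcar in auto)
    show ?thesis
    proof (cases "R = {\<one>, z}")
      case True
      have "z \<in> generate G {z}" "\<one> \<in> generate G {z}"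
        by (auto intro: generate.incl generate.one)
      then show ?thesis using that[of z] True z(1) by blast
    next
      case False
      have "h \<otimes> x \<otimes> inv h \<in> {\<one>, z}" if "h \<in> R" "x \<in> {\<one>, z}" for h x
        using that zcomm[OF that(1)] commuting_if_conj[of h z] zcar by auto
      then obtain g where g: "g \<in> R" "g \<notin> {\<one>, z}" "g [^] (2::nat) \<in> {\<one>, z}"
        and gZ: "\<And>h. h \<in> R \<Longrightarrow> commutator G h g \<in> {\<one>, z}"
        using p_group_central_mod[OF R card two_is_prime_nat Zsub] False z(1) R.one_closed by (metis empty_subsetI insert_subset)
      have gc: "g \<in> carrier G" using g by simp
      have g2: "g [^] (2::nat) = z"
      proof (rule ccontr)
        assume "g [^] (2::nat) \<noteq> z"
        then have "g [^] (2::nat) = \<one>" using g(3) by blast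
        then have "ord g = 2" using ord_eq_prime[OF gc] g(2) by simp
        then show False using unique_prime_subgroupD[OF uniq z(1) g(1) oz] zpow g(2) by blast
      qed
      have og: "ord g = 4"
      proof -
        have "g [^] (4::nat) = (g [^] (2::nat)) [^] (2::nat)" using gc by (simp add: nat_pow_pow)
        then have "g [^] (4::nat) = \<one>" using g2 z(3) by simp
        then have "ord g dvd 2 ^ 2" using gc pow_eq_id by simp
        then obtain i where i: "i \<le> 2" "ord g = 2 ^ i" using divides_primepow_nat[OF two_is_prime_nat] by blast
        have "\<not> ord g dvd 2" using g2 z(2) gc pow_eq_id by metis
        then have "i \<noteq> 0" "i \<noteq> 1" using i(2) by (metis one_dvd power_0, metis dvd_refl power_one_right)
        then have "i = 2" using i(1) by simp
        then show ?thesis using i by simp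
      qed
      define C where "C = {x \<in> R. x \<otimes> g = g \<otimes> x}"
      have C: "subgroup C G"
        unfolding C_def using subgroup_centralizer[OF R gc] .
      have CR: "C \<subseteq> R" unfolding C_def by blast
      obtain m where m: "card C = 2 ^ m"
        using card_subgroup_dvd[OF C R CR] card divides_primepow_nat[OF two_is_prime_nat] by metis
      have gC: "g \<in> C" using g unfolding C_def by simp
      have "\<exists>a\<in>C. \<forall>b\<in>C. \<exists>j::nat. b = a [^] j"
      proof (rule unique_prime_subgroup_cyclic[OF C m two_is_prime_nat unique_prime_subgroup_mono[OF uniq CR]])
        show "\<exists>w\<in>C. ord w = 4 \<and> (\<forall>h\<in>C. h \<otimes> w = w \<otimes> h)"
          using og gC unfolding C_def by blast
      qed
      then obtain a where a: "a \<in> C" and pow: "\<And>b. b \<in> C \<Longrightarrow> \<exists>j::nat. b = a [^] j" by blast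
      have ac: "a \<in> carrier G" using a unfolding C_def by simp
      have gen: "generate G {a} = C"
      proof
        show "generate G {a} \<subseteq> C" using generate_subgroup_incl[of "{a}" C] a C by simp
        show "C \<subseteq> generate G {a}" using pow mem_generate_singleton[OF ac] by blast
      qed
      show ?thesis
      proof (rule that[of a])
        show "a \<in> R" using a CR by blast
        fix x y assume xy: "x \<in> R" "y \<in> R" "x \<notin> generate G {a}" "y \<notin> generate G {a}"
        (* Both x and y send g to z g, so their product commutes with g. *)
        have conj: "v \<otimes> g = z \<otimes> g \<otimes> v" if "v \<in> R" "v \<notin> generate G {a}" for v
        proof -
          have "commutator G v g \<noteq> \<one>"
            using that gen commutator_one_iff[of v g] gc unfolding C_def by simp
          then have "commutator G v g = z" using gZ[OF that(1)] by blast
          moreover have "v \<otimes> g = commutator G v g \<otimes> g \<otimes> v"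
            using that gc by (simp add: word_simps)
          ultimately show ?thesis by simp
        qed
        have "x \<otimes> y \<otimes> g = x \<otimes> (z \<otimes> g \<otimes> y)" using xy conj gc by (simp add: m_assoc)
        also have "\<dots> = z \<otimes> (x \<otimes> g) \<otimes> y"
          using xy gc zcar zcomm[OF xy(1)] by (metis R.mem_carrier m_assoc m_closed)
        also have "\<dots> = (z \<otimes> z) \<otimes> g \<otimes> (x \<otimes> y)" using xy conj gc zcar by (simp add: m_assoc)
        also have "\<dots> = g \<otimes> (x \<otimes> y)" using zz gc xy by simp
        finally show "x \<otimes> y \<in> generate G {a}" using gen xy unfolding C_def by simp
      qed
    qed
  qed
qed

text \<open>Membership in \<open>A\<close> is a parity: it is compatible with products and inverses, and commutators are even.\<close>

lemma derived_le_of_index_two: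
  assumes R: "subgroup R G" and A: "subgroup A G" "A \<subseteq> R"
    and ind: "\<And>x y. \<lbrakk>x \<in> R; y \<in> R; x \<notin> A; y \<notin> A\<rbrakk> \<Longrightarrow> x \<otimes> y \<in> A"
  shows "derived G R \<subseteq> A"
proof -
  interpret R: subgroup R G by (rule R)
  interpret A: subgroup A G by (rule A)
  have inv_notin: "inv x \<notin> A" if "x \<in> R" "x \<notin> A" for x
    using that A.m_inv_closed[of "inv x"] by auto
  have mixed: "x \<otimes> y \<notin> A" if "x \<in> R" "x \<notin> A" "y \<in> A" for x y
  proof
    assume "x \<otimes> y \<in> A"
    then have "x \<otimes> y \<otimes> inv y \<in> A" using that by simp
    then show False using that by (simp add: m_assoc)
  qed
  have mixed': "y \<otimes> x \<notin> A" if "x \<in> R" "x \<notin> A" "y \<in> A" for x y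
  proof
    assume "y \<otimes> x \<in> A"
    then have "inv y \<otimes> (y \<otimes> x) \<in> A" using that by simp
    then show False using that by (simp add: inv_cancel_left)
  qed
  have par: "x \<otimes> y \<in> A \<longleftrightarrow> (x \<in> A \<longleftrightarrow> y \<in> A)" if "x \<in> R" "y \<in> R" for x y
    using that mixed[of x y] mixed'[of y x] ind[of x y] by auto
  have inv_in: "inv x \<in> A \<longleftrightarrow> x \<in> A" if "x \<in> R" for x
    using inv_notin[OF that] by auto
  have "derived_set G R \<subseteq> A"
  proof
    fix c assume "c \<in> derived_set G R"
    then obtain x y where xy: "x \<in> R" "y \<in> R" "c = commutator G x y" by blast
    then show "c \<in> A" by (auto simp: par inv_in)
  qed
  then show ?thesis unfolding derived_def by (rule generate_subgroup_incl[OF _ A(1)])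
qed

end

lemma (in group) derived_trivial_if_commuting:
  assumes H: "H \<subseteq> carrier G" and comm: "\<And>x y. \<lbrakk>x \<in> H; y \<in> H\<rbrakk> \<Longrightarrow> x \<otimes> y = y \<otimes> x"
  shows "derived G H = {\<one>}"
proof -
  have "derived_set G H \<subseteq> {\<one>}"
  proof
    fix c assume "c \<in> derived_set G H"
    then obtain x y where xy: "x \<in> H" "y \<in> H" "c = commutator G x y" by blast
    then show "c \<in> {\<one>}" using commutator_one_iff[of x y] comm H by auto
  qed
  then have "derived G H \<subseteq> {\<one>}"
    unfolding derived_def by (rule generate_subgroup_incl[OF _ triv_subgroup])
  then show ?thesis using subgroup.one_closed[OF derived_is_subgroup[OF H]] by blast
qed

context finite_group
begin

lemma generate_singleton_commute:
  assumes "a \<in> carrier G" "x \<in> generate G {a}" "y \<in> generate G {a}"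
  shows "x \<otimes> y = y \<otimes> x"
  using assms mem_generate_singleton nat_pow_comm by metis

lemma unique_involution_metabelian:
  assumes R: "subgroup R G" and card: "card R = 2 ^ n" and uniq: "unique_prime_subgroup 2 R"
  shows "derived G (derived G R) = {\<one>}"
proof -
  obtain a where a: "a \<in> R" "\<And>x y. \<lbrakk>x \<in> R; y \<in> R; x \<notin> generate G {a}; y \<notin> generate G {a}\<rbrakk> \<Longrightarrow> x \<otimes> y \<in> generate G {a}"
    using unique_involution_cyclic_index_two[OF assms] by metis
  have ac: "a \<in> carrier G" using a(1) R subgroup.mem_carrier by metis
  have "derived G R \<subseteq> generate G {a}"
  proof (rule derived_le_of_index_two[OF R generate_is_subgroup])
    show "generate G {a} \<subseteq> R" using generate_subgroup_incl[of "{a}" R] a(1) R by simp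
  qed (use ac a in auto)
  then show ?thesis
    using derived_trivial_if_commuting[of "derived G R"] generate_singleton_commute[OF ac]
      derived_in_carrier[OF subgroup.subset[OF R]] by blast
qed

end

section \<open>Coprime action in a tidy group\<close>

context finite_group
begin

lemma pow_cong_ord:
  assumes "x \<in> carrier G" "[a = b] (mod ord x)"
  shows "x [^] a = x [^] (b::nat)"
proof -
  have "x [^] a = x [^] (a mod ord x)" for a :: nat
  proof -
    have "x [^] a = x [^] (ord x * (a div ord x) + a mod ord x)" by simp
    also have "\<dots> = (x [^] ord x) [^] (a div ord x) \<otimes> x [^] (a mod ord x)"
      using assms(1) by (simp only: nat_pow_mult nat_pow_pow)
    also have "\<dots> = x [^] (a mod ord x)" using assms(1) by simp
    finally show ?thesis .
  qed
  then show ?thesis using assms(2) unfolding cong_def by metis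
qed

text \<open>If the order of a representative \<open>g\<close> is \<open>s\<close> times a power of \<open>r\<close>, with \<open>s\<close> prime to \<open>r\<close>,
  then \<open>y\<close> is the power of \<open>g\<close> with exponent \<open>s * t\<close>, where \<open>s * t = 1\<close> modulo the order of \<open>X\<close>.\<close>

lemma lift_prime_power_ord:
  assumes N: "N \<lhd> G" and r: "prime r" and X: "X \<in> carrier (G Mod N)" and oX: "group.ord (G Mod N) X = r ^ k"
  obtains y j where "y \<in> carrier G" "X = N #> y" "ord y = r ^ j"
proof -
  interpret N: normal N G by (rule N)
  interpret Q: finite_group "G Mod N" by (rule finite_group_Mod[OF N])
  interpret h: group_hom G "G Mod N" "\<lambda>a. N #> a" by (rule N.group_hom_Mod)
  obtain g where g: "g \<in> carrier G" "X = N #> g" using X by (auto simp: carrier_FactGroup)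
  have "ord g \<noteq> 0" using ord_pos[OF g(1)] by simp
  then obtain a s where as: "ord g = r ^ a * s" "\<not> r dvd s"
    using multiplicity_decompose'[of "ord g" r] r by (metis not_prime_unit)
  have "coprime s (r ^ k)" using as(2) r by (metis coprime_commute coprime_power_left_iff prime_imp_coprime)
  then obtain t where t: "[s * t = Suc 0] (mod (r ^ k))" using cong_solve_coprime_nat[of s "r ^ k"] by blast
  define y where "y = g [^] (s * t)"
  have yc: "y \<in> carrier G" unfolding y_def using g by simp
  have "N #> y = X [^]\<^bsub>G Mod N\<^esub> (s * t)" unfolding y_def g(2) using N.FactGroup_pow[OF g(1), of "s * t"] by simp
  also have "\<dots> = X [^]\<^bsub>G Mod N\<^esub> Suc 0" using Q.pow_cong_ord[OF X] t oX by metis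
  also have "\<dots> = X" using X Q.l_one by (simp del: mult_FactGroup one_FactGroup)
  finally have yX: "X = N #> y" by simp
  have "y [^] (r ^ a) = (g [^] ord g) [^] t"
    unfolding y_def as(1) using g(1) by (simp add: nat_pow_pow mult.assoc mult.commute mult.left_commute)
  also have "\<dots> = \<one>" using g(1) by simp
  finally have "ord y dvd r ^ a" using pow_eq_id[OF yc] by blast
  then obtain j where "ord y = r ^ j" using divides_primepow_nat[OF r] by blast
  then show thesis using that yc yX by blast
qed

text \<open>A generator \<open>c\<close> of the cyclic group has to be found inside the group generated by \<open>x\<close> and \<open>g\<close>.\<close>

lemma mem_CycI:
  assumes "x \<in> carrier G" "g \<in> carrier G" "c \<in> generate G {x, g}"
    "x = c [^] (i::nat)" "g = c [^] (j::nat)"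
  shows "g \<in> Cyc G x"
proof -
  have xg: "{x, g} \<subseteq> carrier G" using assms by simp
  have c: "c \<in> carrier G" using generate_in_carrier[OF xg assms(3)] .
  have "generate G {x, g} = generate G {c}"
  proof
    have "x \<in> generate G {c}" "g \<in> generate G {c}"
      unfolding mem_generate_singleton[OF c] using assms(4,5) by blast+
    then show "generate G {x, g} \<subseteq> generate G {c}"
      using c by (intro generate_subgroup_incl generate_is_subgroup) auto
    show "generate G {c} \<subseteq> generate G {x, g}"
      using assms(3) xg by (intro generate_subgroup_incl generate_is_subgroup) auto
  qed
  moreover have "carrier G \<inter> {x, g} = {x, g}" "carrier G \<inter> {c} = {c}" using xg c by auto
  ultimately have "subgroup_generated G {x, g} = subgroup_generated G {c}"
    unfolding subgroup_generated_def by simp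
  then show ?thesis
    unfolding Cyc_def using cyclic_group_generated[of c] assms(2) by simp
qed

lemma mem_CycE:
  assumes "g \<in> Cyc G x" "x \<in> carrier G"
  obtains c and i j :: nat where "c \<in> carrier G" "x = c [^] i" "g = c [^] j"
proof -
  have g: "g \<in> carrier G" using assms(1) unfolding Cyc_def by simp
  let ?H = "generate G {x, g}"
  have xg: "{x, g} \<subseteq> carrier G" using assms(2) g by simp
  have H: "subgroup ?H G" using generate_is_subgroup[OF xg] .
  have int: "carrier G \<inter> {x, g} = {x, g}" using xg by blast
  have "cyclic_group (G\<lparr>carrier := ?H\<rparr>)"
    using assms(1) int unfolding Cyc_def subgroup_generated_def by simp
  then obtain c where c: "c \<in> ?H" "subgroup_generated (G\<lparr>carrier := ?H\<rparr>) {c} = G\<lparr>carrier := ?H\<rparr>"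
    unfolding cyclic_group_def by auto
  have "generate (G\<lparr>carrier := ?H\<rparr>) {c} = ?H"
    using arg_cong[OF c(2), of carrier] c(1) unfolding carrier_subgroup_generated by simp
  then have "generate G {c} = ?H"
    using generate_consistent[OF _ H, of "{c}"] c(1) by simp
  moreover have "x \<in> ?H" "g \<in> ?H" by (auto intro: generate.incl)
  moreover have "c \<in> carrier G" using c(1) generate_in_carrier[OF xg] by blast
  ultimately show thesis using that mem_generate_singleton[of c] by metis
qed

text \<open>By the Chinese remainder theorem \<open>x\<close> and \<open>y\<close> are powers of \<open>x \<otimes> y\<close>.\<close>

lemma coprime_commuting_mem_Cyc:
  assumes x: "x \<in> carrier G" and y: "y \<in> carrier G" and xy: "x \<otimes> y = y \<otimes> x"
    and cop: "coprime (ord x) (ord y)"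
  shows "y \<in> Cyc G x"
proof -
  obtain i where i: "[i = 1] (mod ord x)" "[i = 0] (mod ord y)"
    using binary_chinese_remainder_nat[OF cop] by blast
  obtain j where j: "[j = 0] (mod ord x)" "[j = 1] (mod ord y)"
    using binary_chinese_remainder_nat[OF cop] by blast
  have "(x \<otimes> y) [^] i = x"
    using pow_mult_distrib[OF xy x y, of i] pow_cong_ord[OF x i(1)] pow_cong_ord[OF y i(2)] x by simp
  moreover have "(x \<otimes> y) [^] j = y"
    using pow_mult_distrib[OF xy x y, of j] pow_cong_ord[OF x j(1)] pow_cong_ord[OF y j(2)] y by simp
  moreover have "x \<otimes> y \<in> generate G {x, y}"
    by (auto intro: generate.incl generate.eng)
  ultimately show ?thesis using mem_CycI[OF x y, of "x \<otimes> y" i j] by simp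
qed

lemma pow_prime_ord_sym:
  assumes a: "a \<in> carrier G" and p: "prime p" and oa: "ord a = p" and ob: "ord (a [^] j) = p"
  shows "\<exists>i::nat. a = (a [^] (j::nat)) [^] i"
proof -
  have "\<not> p dvd j"
  proof
    assume "p dvd j"
    then have "a [^] j = \<one>" using pow_eq_id[OF a] oa by simp
    then have "p = 1" using ob by (simp only: ord_id)
    then show False using p by simp
  qed
  then have "coprime j p" using p by (meson coprime_commute prime_imp_coprime)
  then obtain i where "[j * i = 1] (mod p)" using cong_solve_coprime_nat by auto
  then have "a [^] (j * i) = a [^] (1::nat)" using pow_cong_ord[OF a] oa by simp
  then have "a = (a [^] j) [^] i" using a by (simp add: nat_pow_pow)
  then show ?thesis by blast
qed

text \<open>A finite cyclic group has only one subgroup of order \<open>p\<close>; here it is generated by \<open>x\<close>, and a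
  power of \<open>d\<close> generates it as well. The proof carries this out with exponents of a common
  generator \<open>c\<close>.\<close>

lemma Cyc_prime_ord_pow:
  assumes x: "x \<in> carrier G" and p: "prime p" and ox: "ord x = p" and d: "d \<in> Cyc G x"
    and od: "ord d = p ^ k" and d1: "d \<noteq> \<one>"
  shows "\<exists>j::nat. x = d [^] j"
proof -
  obtain c and i j :: nat where c: "c \<in> carrier G" "x = c [^] i" "d = c [^] j"
    using mem_CycE[OF d x] .
  have p0: "p > 0" using p prime_gt_0_nat by blast
  have dc: "d \<in> carrier G" using c by simp
  have k: "k \<noteq> 0" using od d1 ord_eq_1[OF dc] by (cases k) auto
  let ?q = "p ^ (k - 1)"
  have "p ^ k = p * ?q" using k by (cases k) auto
  then have pq: "j * ?q * p = j * p ^ k" by simp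
  have "c [^] (j * ?q * p) = \<one>"
  proof -
    have "(c [^] j) [^] (p ^ k) = \<one>" using pow_ord_eq_1[OF dc, unfolded od] c(3) by metis
    then show ?thesis using pq nat_pow_pow[OF c(1)] by metis
  qed
  then have n2: "ord c dvd j * ?q * p" using pow_eq_id[OF c(1)] by blast
  have "d [^] ?q \<noteq> \<one>"
  proof
    assume "d [^] ?q = \<one>"
    then have "p ^ k dvd ?q" using pow_eq_id[OF dc] od by simp
    then have "k \<le> k - 1" using power_dvd_imp_le prime_gt_1_nat[OF p] by blast
    then show False using k by simp
  qed
  then have n3: "\<not> ord c dvd j * ?q" using pow_eq_id[OF c(1)] c by (simp add: nat_pow_pow)
  have "c [^] (i * p) = \<one>"
    using pow_ord_eq_1[OF x, unfolded ox] c nat_pow_pow[OF c(1)] by metis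
  then have n1: "ord c dvd i * p" using pow_eq_id[OF c(1)] by blast
  have "x [^] ord c = \<one>"
    unfolding c(2) using c(1) by (metis mult.commute nat_pow_one nat_pow_pow pow_ord_eq_1)
  then have "p dvd ord c" using pow_eq_id[OF x] ox by simp
  then obtain m where m: "ord c = m * p" by (metis dvd_def mult.commute)
  obtain i' where i': "i = m * i'" using n1 m p0 by (metis dvd_def dvd_mult_cancel_right nat_mult_dvd_cancel_disj mult.commute not_gr_zero)
  obtain j' where j': "j * ?q = m * j'" using n2 m p0 by (metis dvd_def nat_mult_dvd_cancel_disj mult.commute not_gr_zero)
  have "\<not> p dvd j'" using n3 m j' by auto
  then have "coprime j' p" using p by (meson coprime_commute prime_imp_coprime)
  then obtain t where t: "[j' * t = 1] (mod p)" using cong_solve_coprime_nat by auto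
  then have "[j' * t * i' = 1 * i'] (mod p)" by (rule cong_scalar_right)
  then have "[m * (j' * t * i') = m * (1 * i')] (mod (m * p))"
    using cong_cmult_leftI by blast
  then have "[j * ?q * (t * i') = i] (mod ord c)"
    using i' j' m by (simp add: mult.assoc)
  then have "c [^] (j * ?q * (t * i')) = c [^] i" using pow_cong_ord[OF c(1)] by blast
  then have "x = d [^] (?q * (t * i'))" using c by (simp add: nat_pow_pow mult.assoc)
  then show ?thesis by blast
qed

lemma coprime_ord_p_subgroup:
  assumes "subgroup S G" "card S = p ^ n" "prime p" "coprime m p" "c \<in> S"
  shows "coprime m (ord c)"
  using ord_prime_power[OF assms(1-3,5)] assms(4) by (metis coprime_power_right_iff)

text \<open>Induction on the order of \<open>d\<close>. If \<open>y\<close> commutes with the \<open>p\<close>-th power of \<open>d\<close>, then the element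
  \<open>c\<close> by which \<open>y\<close> moves \<open>d\<close> has \<open>p\<close>-th power \<open>1\<close>. So \<open>c\<close> is a power of \<open>x\<close> and commutes
  with \<open>y\<close>, and since the orders are coprime it is trivial.\<close>

lemma centralizes_abelian_unique_prime_subgroup:
  assumes D: "subgroup D G" and card: "card D = p ^ n" and p: "prime p"
    and comm: "\<And>a b. \<lbrakk>a \<in> D; b \<in> D\<rbrakk> \<Longrightarrow> a \<otimes> b = b \<otimes> a"
    and uniq: "unique_prime_subgroup p D"
    and y: "y \<in> carrier G" and norm: "\<And>d. d \<in> D \<Longrightarrow> y \<otimes> d \<otimes> inv y \<in> D"
    and cop: "coprime (ord y) p"
    and x: "x \<in> D" "ord x = p" "y \<otimes> x = x \<otimes> y" and "d \<in> D"
  shows "y \<otimes> d = d \<otimes> y"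
proof -
  interpret D: subgroup D G by (rule D)
  obtain k where "ord d = p ^ k" using ord_prime_power[OF D card p \<open>d \<in> D\<close>] .
  with \<open>d \<in> D\<close> show ?thesis
  proof (induction k arbitrary: d)
    case 0
    then show ?case using ord_eq_1[of d] y by simp
  next
    case (Suc k)
    have dc: "d \<in> carrier G" using Suc.prems by simp
    have dp: "d [^] p \<in> D" using subgroup_pow_closed[OF D] Suc.prems by blast
    have "ord (d [^] p) = p ^ k"
      using ord_pow[OF dc, of p] Suc.prems p prime_gt_0_nat[OF p] by simp
    then have "y \<otimes> d [^] p = d [^] p \<otimes> y" using Suc.IH dp by blast
    then have fixd: "(y \<otimes> d \<otimes> inv y) [^] p = d [^] p"
      using conj_pow[OF y dc] commuting_if_conj[OF y, of "d [^] p"] dc by simp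
    define c where "c = inv d \<otimes> (y \<otimes> d \<otimes> inv y)"
    have e: "y \<otimes> d \<otimes> inv y \<in> D" using norm Suc.prems by blast
    have cD: "c \<in> D" unfolding c_def using e Suc.prems by simp
    have "c [^] p = inv d [^] p \<otimes> (y \<otimes> d \<otimes> inv y) [^] p"
      unfolding c_def using comm[of "inv d" "y \<otimes> d \<otimes> inv y"] e Suc.prems
      by (intro pow_mult_distrib) auto
    also have "\<dots> = \<one>" unfolding fixd using dc by (simp add: nat_pow_inv)
    finally have cp: "c [^] p = \<one>" .
    have yc: "y \<otimes> c = c \<otimes> y"
    proof (cases "c = \<one>")
      case True then show ?thesis using y by simp
    next
      case False
      then have "ord c = p" using ord_eq_prime cp p cD by simp
      then obtain j :: nat where "c = x [^] j"
        using unique_prime_subgroupD[OF uniq x(1) cD x(2)] by blast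
      then show ?thesis using group_commutes_pow[of x y j] x y by simp
    qed
    show ?case
    proof (rule coprime_conj_trivial[OF y dc _ _ yc])
      show "y \<otimes> d \<otimes> inv y = d \<otimes> c" unfolding c_def using y dc by (simp add: cancel_inv_left)
      show "coprime (ord y) (ord c)" using coprime_ord_p_subgroup[OF D card p cop cD] .
    qed (use cD in simp)
  qed
qed

text \<open>A case of Thompson's lemma on the coprime action of a direct product. Let \<open>C\<close> be the
  centralizer of \<open>y\<close> in \<open>S\<close> and \<open>Z\<close> the largest normal subgroup of \<open>S\<close> inside \<open>C\<close>. If
  \<open>Z\<close> is not \<open>S\<close>, take \<open>g\<close> outside \<open>Z\<close> that is central modulo \<open>Z\<close>. It normalizes \<open>C\<close>, so
  the element by which \<open>y\<close> moves \<open>g\<close> centralizes \<open>C\<close> and in particular \<open>x\<close>; by hypothesis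
  \<open>y\<close> commutes with it, and coprimality makes it trivial. Hence \<open>g\<close> and with it all conjugates
  of \<open>g\<close> lie in \<open>C\<close>, which puts \<open>g\<close> into \<open>Z\<close>.\<close>

lemma centralizes_if_centralizes_centralizer:
  assumes S: "subgroup S G" and card: "card S = p ^ n" and p: "prime p"
    and y: "y \<in> carrier G" and norm: "\<And>s. s \<in> S \<Longrightarrow> y \<otimes> s \<otimes> inv y \<in> S"
    and cop: "coprime (ord y) p"
    and x: "x \<in> S" "y \<otimes> x = x \<otimes> y"
    and cent: "\<And>a. \<lbrakk>a \<in> S; a \<otimes> x = x \<otimes> a\<rbrakk> \<Longrightarrow> y \<otimes> a = a \<otimes> y"
    and "s \<in> S"
  shows "y \<otimes> s = s \<otimes> y"
proof -
  interpret S: subgroup S G by (rule S)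
  define C where "C = {s \<in> S. s \<otimes> y = y \<otimes> s}"
  have C: "subgroup C G" unfolding C_def using subgroup_centralizer[OF S y] .
  interpret C: subgroup C G by (rule C)
  define Z where "Z = {z \<in> S. \<forall>h\<in>S. h \<otimes> z \<otimes> inv h \<in> C}"
  have Z: "subgroup Z G"
  proof (rule subgroupI)
    show "Z \<subseteq> carrier G" unfolding Z_def using S.subset by blast
    have "\<one> \<in> Z" unfolding Z_def by simp
    then show "Z \<noteq> {}" by blast
    show "inv a \<in> Z" if "a \<in> Z" for a
    proof -
      have "h \<otimes> inv a \<otimes> inv h \<in> C" if h: "h \<in> S" for h
      proof -
        have "inv (h \<otimes> a \<otimes> inv h) \<in> C" using \<open>a \<in> Z\<close> h unfolding Z_def by simp
        then show ?thesis using \<open>a \<in> Z\<close> h unfolding Z_def by (simp add: word_simps)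
      qed
      then show ?thesis using that unfolding Z_def by simp
    qed
    show "a \<otimes> b \<in> Z" if "a \<in> Z" "b \<in> Z" for a b
    proof -
      have ab: "a \<in> S" "b \<in> S" using that unfolding Z_def by simp_all
      have "h \<otimes> (a \<otimes> b) \<otimes> inv h \<in> C" if h: "h \<in> S" for h
      proof -
        have "h \<otimes> a \<otimes> inv h \<in> C" "h \<otimes> b \<otimes> inv h \<in> C"
          using \<open>a \<in> Z\<close> \<open>b \<in> Z\<close> h unfolding Z_def by simp_all
        then have "(h \<otimes> a \<otimes> inv h) \<otimes> (h \<otimes> b \<otimes> inv h) \<in> C" by (rule C.m_closed)
        moreover have "(h \<otimes> a \<otimes> inv h) \<otimes> (h \<otimes> b \<otimes> inv h) = h \<otimes> (a \<otimes> b) \<otimes> inv h"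
          using ab h by (simp add: word_simps)
        ultimately show ?thesis by simp
      qed
      then show ?thesis using ab unfolding Z_def by simp
    qed
  qed
  interpret Z: subgroup Z G by (rule Z)
  have ZS: "Z \<subseteq> S" unfolding Z_def by blast
  have ZC: "Z \<subseteq> C"
  proof
    fix z assume z: "z \<in> Z"
    then have "\<one> \<otimes> z \<otimes> inv \<one> \<in> C" unfolding Z_def using S.one_closed by blast
    then show "z \<in> C" using z by simp
  qed
  have Znorm: "h \<otimes> z \<otimes> inv h \<in> Z" if h: "h \<in> S" and z: "z \<in> Z" for h z
  proof -
    have zS: "z \<in> S" using z ZS by blast
    have "k \<otimes> (h \<otimes> z \<otimes> inv h) \<otimes> inv k \<in> C" if k: "k \<in> S" for k
    proof -
      have "(k \<otimes> h) \<otimes> z \<otimes> inv (k \<otimes> h) \<in> C" using z k h unfolding Z_def by simp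
      then show ?thesis using zS h k by (simp add: word_simps)
    qed
    then show ?thesis unfolding Z_def using zS h by simp
  qed
  have "Z = S"
  proof (rule ccontr)
    assume "Z \<noteq> S"
    then obtain g where g: "g \<in> S" "g \<notin> Z" and gZ: "\<And>h. h \<in> S \<Longrightarrow> commutator G h g \<in> Z"
      using p_group_central_mod[OF S card p Z ZS _ Znorm] by metis
    have gc: "g \<in> carrier G" using g by simp
    have gnorm: "g \<otimes> c \<otimes> inv g \<in> C" if c: "c \<in> C" for c
    proof -
      have cS: "c \<in> S" using c unfolding C_def by simp
      have "inv (commutator G c g) \<otimes> c \<in> C" using gZ[OF cS] ZC c by blast
      moreover have "inv (commutator G c g) \<otimes> c = g \<otimes> c \<otimes> inv g"
        using cS gc by (simp add: word_simps)
      ultimately show ?thesis by simp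
    qed
    define e where "e = inv g \<otimes> (y \<otimes> g \<otimes> inv y)"
    have eS: "e \<in> S" unfolding e_def using g norm by simp
    have ec: "e \<in> carrier G" using eS by simp
    have ecomm: "e \<otimes> x = x \<otimes> e"
    proof -
      have xC: "x \<in> C" using x unfolding C_def by simp
      have xc: "x \<in> carrier G" using xC by simp
      define t where "t = g \<otimes> x \<otimes> inv g"
      have tC: "t \<in> C" unfolding t_def using gnorm xC by blast
      have tc: "t \<in> carrier G" using tC by simp
      have yt: "y \<otimes> t \<otimes> inv y = t" using tC commuting_if_conj[OF y tc] unfolding C_def by simp
      have yx: "inv y \<otimes> x \<otimes> y = x"
        using x(2) xc y by (simp add: m_assoc flip: x(2)) (simp add: inv_cancel_left)
      have "e \<otimes> x \<otimes> inv e = inv g \<otimes> (y \<otimes> (g \<otimes> (inv y \<otimes> x \<otimes> y) \<otimes> inv g) \<otimes> inv y) \<otimes> g"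
        unfolding e_def using gc xc y by (simp add: word_simps)
      also have "\<dots> = inv g \<otimes> t \<otimes> g" unfolding yx using yt t_def by simp
      also have "\<dots> = x" unfolding t_def using gc xc by (simp add: word_simps)
      finally show ?thesis using commuting_if_conj[OF ec xc] by simp
    qed
    have "y \<otimes> g = g \<otimes> y"
    proof (rule coprime_conj_trivial[OF y gc ec])
      show "y \<otimes> g \<otimes> inv y = g \<otimes> e" unfolding e_def using y gc by (simp add: cancel_inv_left)
      show "y \<otimes> e = e \<otimes> y" using cent[OF eS ecomm] .
      show "coprime (ord y) (ord e)" using coprime_ord_p_subgroup[OF S card p cop eS] .
    qed
    then have gC: "g \<in> C" using g unfolding C_def by simp
    have "h \<otimes> g \<otimes> inv h \<in> C" if h: "h \<in> S" for h
    proof -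
      have "commutator G h g \<otimes> g \<in> C" using gZ[OF h] ZC gC by blast
      moreover have "commutator G h g \<otimes> g = h \<otimes> g \<otimes> inv h" using h gc by (simp add: word_simps)
      ultimately show ?thesis by simp
    qed
    then show False using g unfolding Z_def by blast
  qed
  then have "s \<in> C" using \<open>s \<in> S\<close> ZC by blast
  then show ?thesis unfolding C_def by simp
qed

lemma pow_of_ord_four:
  assumes "subgroup S G" "card S = 2 ^ n" "s \<in> S" "s [^] (2::nat) \<noteq> \<one>"
  obtains j :: nat where "ord (s [^] j) = 4"
proof -
  have s: "s \<in> carrier G" using assms(1,3) subgroup.mem_carrier by metis
  obtain k where k: "ord s = 2 ^ k" using ord_prime_power[OF assms(1,2) two_is_prime_nat assms(3)] .
  have "\<not> 2 ^ k dvd (2::nat)" using assms(4) pow_eq_id[OF s] k by metis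
  then have "k \<noteq> 0" "k \<noteq> 1" by (metis one_dvd power_0, metis dvd_refl power_one_right)
  then have "k = (k - 2) + 2" by linarith
  then obtain l where l: "k = l + 2" by blast
  have "ord (s [^] ((2::nat) ^ l)) = 2 ^ k div 2 ^ l" using ord_pow[OF s, of "2 ^ l"] k l by simp
  also have "\<dots> = 4" using l by simp
  finally show thesis using that by blast
qed

text \<open>The elements \<open>g\<close> and \<open>g \<otimes> z\<close> have the same square, and both lie in its cyclicizer. As this is a
  subgroup, it contains \<open>z\<close>; but two involutions of a cyclic group are equal.\<close>

lemma tidy_ord_four_square:
  assumes tidy: "tidy G" and S: "subgroup S G" and z: "z \<in> S" "ord z = 2"
    and zc: "\<And>s. s \<in> S \<Longrightarrow> s \<otimes> z = z \<otimes> s"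
    and g: "g \<in> S" "ord g = 4"
  shows "g [^] (2::nat) = z"
proof -
  interpret S: subgroup S G by (rule S)
  have gc: "g \<in> carrier G" and zcar: "z \<in> carrier G" using g z by simp_all
  let ?x = "g [^] (2::nat)"
  have xc: "?x \<in> carrier G" using gc by simp
  have ox: "ord ?x = 2" using ord_pow[OF gc, of 2] g by simp
  have zz: "z [^] (2::nat) = \<one>" using pow_ord_eq_1[OF zcar] z by simp
  have gz: "(g \<otimes> z) [^] (2::nat) = ?x"
    using pow_mult_distrib[OF zc[OF g(1)] gc zcar, of 2] zz gc by simp
  have mem: "h \<in> Cyc G ?x" if "h \<in> carrier G" "h [^] (2::nat) = ?x" for h
  proof (rule mem_CycI[OF xc that(1)])
    show "h \<in> generate G {?x, h}" by (auto intro: generate.incl)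
    show "?x = h [^] (2::nat)" "h = h [^] (1::nat)" using that by simp_all
  qed
  have "subgroup (Cyc G ?x) G" using tidy xc unfolding tidy_def by blast
  moreover have "g \<in> Cyc G ?x" "g \<otimes> z \<in> Cyc G ?x" using mem gc zcar gz by simp_all
  ultimately have "inv g \<otimes> (g \<otimes> z) \<in> Cyc G ?x"
    by (meson subgroup.m_closed subgroup.m_inv_closed)
  then have "z \<in> Cyc G ?x" using gc zcar by (simp add: inv_cancel_left)
  moreover have "z \<noteq> \<one>" using z(2) by auto
  ultimately obtain j :: nat where j: "?x = z [^] j"
    using Cyc_prime_ord_pow[OF xc two_is_prime_nat ox, of z 1] z(2) by auto
  have "z [^] i \<in> {\<one>, z}" for i :: nat
    using zz zcar by (induction i) (auto simp: numeral_2_eq_2)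
  moreover have "?x \<noteq> \<one>" using ox by auto
  ultimately show ?thesis using j by auto
qed

text \<open>Pass to a power \<open>x\<close> of \<open>x0\<close> of order \<open>p\<close> and let \<open>D\<close> be the intersection of \<open>Cyc x\<close> and \<open>S\<close>. It has
  only one subgroup of order \<open>p\<close>. If \<open>D\<close> is abelian, then \<open>y\<close> centralizes \<open>D\<close>. For \<open>a\<close> in \<open>S\<close>
  commuting with \<open>x\<close>, the conjugate of \<open>y\<close> by the inverse of \<open>a\<close> commutes with \<open>x\<close> and lies in
  \<open>Cyc x\<close>, as \<open>y\<close> does; so \<open>y\<close> moves \<open>a\<close> by an element of \<open>D\<close>, which it centralizes, and
  coprimality shows that \<open>y\<close> commutes with \<open>a\<close>. Now Thompson's lemma applies. For odd \<open>p\<close>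
  the group \<open>D\<close> is cyclic.

  For \<open>p = 2\<close> let \<open>z\<close> be a central involution of \<open>S\<close>; all elements of order four square to
  \<open>z\<close>. If \<open>x\<close> is not \<open>z\<close>, this leaves no element of order four in \<open>D\<close>. If \<open>x = z\<close> and there
  is another involution \<open>t\<close> in \<open>S\<close>, then all elements of \<open>S\<close> outside \<open>D\<close> are involutions, so
  \<open>t\<close> inverts \<open>D\<close>, and a group inverted by an automorphism is abelian.\<close>

theorem tidy_coprime_fixed_point:
  assumes tidy: "tidy G" and S: "subgroup S G" and card: "card S = p ^ n" and p: "prime p"
    and y: "y \<in> carrier G" and norm: "\<And>s. s \<in> S \<Longrightarrow> y \<otimes> s \<otimes> inv y \<in> S"
    and cop: "coprime (ord y) p"
    and x0: "x0 \<in> S" "x0 \<noteq> \<one>" "y \<otimes> x0 = x0 \<otimes> y"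
    and not2: "\<not> (p = 2 \<and> unique_prime_subgroup 2 S)"
    and "s \<in> S"
  shows "y \<otimes> s = s \<otimes> y"
proof -
  interpret S: subgroup S G by (rule S)
  have p1: "p > 1" using p prime_gt_1_nat by blast
  obtain k where k: "ord x0 = p ^ k" using ord_prime_power[OF S card p x0(1)] .
  have "k \<noteq> 0" using k x0 ord_eq_1[of x0] by (cases k) auto
  then obtain l where l: "k = Suc l" by (cases k) auto
  define x where "x = x0 [^] (p ^ l)"
  have xS: "x \<in> S" unfolding x_def using subgroup_pow_closed[OF S x0(1)] .
  have xc: "x \<in> carrier G" using xS by simp
  have ox: "ord x = p" unfolding x_def using ord_pow[of x0 "p ^ l"] k l x0 p1 by simp
  have x1: "x \<noteq> \<one>" using ox p1 by auto
  have yx: "y \<otimes> x = x \<otimes> y"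
    unfolding x_def using group_commutes_pow[of x0 y "p ^ l"] x0 y by simp
  have CycS: "subgroup (Cyc G x) G" using tidy xc unfolding tidy_def by blast
  interpret Cy: subgroup "Cyc G x" G by (rule CycS)
  have mem_cop: "v \<in> Cyc G x" if "v \<in> carrier G" "v \<otimes> x = x \<otimes> v" "coprime (ord v) p" for v
    using coprime_commuting_mem_Cyc[OF xc that(1)] that ox by (simp add: coprime_commute)
  have yCyc: "y \<in> Cyc G x" using mem_cop y yx cop by blast
  (* Being cyclic over x makes D small: each of its nontrivial elements has x as a power. *)
  define D where "D = Cyc G x \<inter> S"
  have D: "subgroup D G" unfolding D_def using subgroups_Inter_pair[OF CycS S] .
  interpret D: subgroup D G by (rule D)
  have DS: "D \<subseteq> S" unfolding D_def by blast
  obtain m where m: "card D = p ^ m"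
    using card_subgroup_dvd[OF D S DS] card divides_primepow_nat[OF p] by metis
  have xD: "x \<in> D"
  proof -
    have "x \<in> Cyc G x"
    proof (rule mem_CycI[OF xc xc])
      show "x \<in> generate G {x, x}" by (auto intro: generate.incl)
      show "x = x [^] (1::nat)" "x = x [^] (1::nat)" using xc by simp_all
    qed
    then show ?thesis using xS unfolding D_def by blast
  qed
  have Dx: "\<exists>j::nat. x = d [^] j" if d: "d \<in> D" and d1: "d \<noteq> \<one>" for d
  proof -
    obtain k where "ord d = p ^ k" using ord_prime_power[OF D m p d] .
    then show ?thesis using Cyc_prime_ord_pow[OF xc p ox _ _ d1] d unfolding D_def by blast
  qed
  have uniqD: "unique_prime_subgroup p D"
    unfolding unique_prime_subgroup_def
  proof (intro ballI impI)
    fix a b assume a: "a \<in> D" "ord a = p" and b: "b \<in> D" "ord b = p"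
    have ne: "a \<noteq> \<one>" "b \<noteq> \<one>" using a b p1 by auto
    obtain i :: nat where i: "x = a [^] i" using Dx[OF a(1) ne(1)] by blast
    obtain j :: nat where j: "x = b [^] j" using Dx[OF b(1) ne(2)] by blast
    obtain j' :: nat where "b = x [^] j'" using pow_prime_ord_sym[of b p j] p b j ox by auto
    then have "b = a [^] (i * j')" using i a by (simp add: nat_pow_pow)
    then show "\<exists>j::nat. b = a [^] j" by blast
  qed
  have normD: "y \<otimes> d \<otimes> inv y \<in> D" if "d \<in> D" for d
    using that norm yCyc unfolding D_def by simp
  have abel: ?thesis if comm: "\<And>a b. \<lbrakk>a \<in> D; b \<in> D\<rbrakk> \<Longrightarrow> a \<otimes> b = b \<otimes> a"
  proof -
    have yD: "y \<otimes> d = d \<otimes> y" if "d \<in> D" for d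
      using centralizes_abelian_unique_prime_subgroup[OF D m p comm uniqD y normD cop xD ox yx that] by simp
    show ?thesis
    proof (rule centralizes_if_centralizes_centralizer[OF S card p y norm cop xS yx _ \<open>s \<in> S\<close>])
      fix a assume a: "a \<in> S" "a \<otimes> x = x \<otimes> a"
      have ac: "a \<in> carrier G" using a by simp
      define c where "c = inv a \<otimes> (y \<otimes> a \<otimes> inv y)"
      have cS: "c \<in> S" unfolding c_def using a norm by simp
      have v: "inv a \<otimes> y \<otimes> a \<in> Cyc G x"
      proof (rule mem_cop)
        have ia: "inv a \<otimes> x = x \<otimes> inv a" using commute_inv[OF ac xc a(2)] .
        have "inv a \<otimes> y \<otimes> a \<otimes> x = inv a \<otimes> y \<otimes> (x \<otimes> a)" using a ac xc y by (simp add: m_assoc)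
        also have "\<dots> = inv a \<otimes> (y \<otimes> x) \<otimes> a" using ac xc y by (simp add: m_assoc)
        also have "\<dots> = (inv a \<otimes> x) \<otimes> y \<otimes> a" unfolding yx using ac xc y by (simp add: m_assoc)
        also have "\<dots> = x \<otimes> (inv a \<otimes> y \<otimes> a)" unfolding ia using ac xc y by (simp add: m_assoc)
        finally show "inv a \<otimes> y \<otimes> a \<otimes> x = x \<otimes> (inv a \<otimes> y \<otimes> a)" .
        show "coprime (ord (inv a \<otimes> y \<otimes> a)) p"
          using ord_conj[of "inv a" y] ac y cop by simp
      qed (use ac y in simp)
      have "c = (inv a \<otimes> y \<otimes> a) \<otimes> inv y" unfolding c_def using ac y by (simp add: m_assoc)
      then have "c \<in> Cyc G x" using v yCyc by simp
      then have cD: "c \<in> D" using cS unfolding D_def by blast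
      show "y \<otimes> a = a \<otimes> y"
      proof (rule coprime_conj_trivial[OF y ac])
        show "c \<in> carrier G" using cS by simp
        show "y \<otimes> a \<otimes> inv y = a \<otimes> c" unfolding c_def using y ac by (simp add: cancel_inv_left)
        show "y \<otimes> c = c \<otimes> y" using yD[OF cD] .
        show "coprime (ord y) (ord c)" using coprime_ord_p_subgroup[OF S card p cop cS] .
      qed
    qed
  qed
  show ?thesis
  proof (cases "p = 2")
    case False
    then obtain a where a: "a \<in> D" "\<And>b. b \<in> D \<Longrightarrow> \<exists>j::nat. b = a [^] j"
      using unique_prime_subgroup_cyclic[OF D m p uniqD] by blast
    show ?thesis
    proof (rule abel)
      fix b c assume "b \<in> D" "c \<in> D"
      then show "b \<otimes> c = c \<otimes> b" using a nat_pow_comm[of a] D.mem_carrier by metis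
    qed
  next
    case True
    then have nu: "\<not> unique_prime_subgroup 2 S" using not2 by blast
    have card2: "card S = 2 ^ n" and m2: "card D = 2 ^ m" and ox2: "ord x = 2" using card m ox True by simp_all
    have "S \<noteq> {\<one>}" using x1 xS by blast
    then obtain z where z: "z \<in> S" "z \<noteq> \<one>" "z [^] (2::nat) = \<one>"
      and zcomm: "\<And>h. h \<in> S \<Longrightarrow> commutator G h z = \<one>"
      using p_group_central[OF S card2 two_is_prime_nat \<open>S \<noteq> {\<one>}\<close>] by metis
    have zc: "z \<in> carrier G" using z by simp
    have oz: "ord z = 2" using ord_eq_prime[OF zc z(3,2)] by simp
    have zS: "h \<otimes> z = z \<otimes> h" if "h \<in> S" for h
      using zcomm[OF that] commutator_one_iff[of h z] that zc by simp
    have four: "g [^] (2::nat) = z" if "g \<in> S" "ord g = 4" for g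
      using tidy_ord_four_square[OF tidy S z(1) oz zS that] by simp
    have xpow: "x [^] i \<in> {\<one>, x}" for i :: nat
    proof -
      have "x \<otimes> x = \<one>" using pow_ord_eq_1[OF xc] xc ox2 by (simp add: numeral_2_eq_2)
      then show ?thesis using xc by (induction i) auto
    qed
    have zpow: "z [^] i \<in> {\<one>, z}" for i :: nat
    proof -
      have "z \<otimes> z = \<one>" using z(3) zc by (simp add: numeral_2_eq_2)
      then show ?thesis using zc by (induction i) auto
    qed
    show ?thesis
    proof (cases "x = z")
      case False
      have "d \<in> {\<one>, x}" if d: "d \<in> D" for d
      proof (cases "d [^] (2::nat) = \<one>")
        case True
        show ?thesis
        proof (cases "d = \<one>")
          case False
          then have "ord d = 2" using ord_eq_prime[of d 2] True d by simp
          then have "\<exists>j::nat. d = x [^] j" using unique_prime_subgroupD[OF uniqD xD d] ox \<open>p = 2\<close> by simp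
          then show ?thesis using xpow by auto
        qed simp
      next
        case False
        obtain j :: nat where j: "ord (d [^] j) = 4" using pow_of_ord_four[OF D m2 d False] .
        let ?e = "d [^] j"
        have eD: "?e \<in> D" using subgroup_pow_closed[OF D d] .
        have e2: "?e [^] (2::nat) = z" using four[OF _ j] eD DS by blast
        have "z \<in> D" using subgroup_pow_closed[OF D eD, of 2] e2 by simp
        then obtain i :: nat where "z = x [^] i"
          using unique_prime_subgroupD[OF uniqD xD _ ox, of z] oz \<open>p = 2\<close> by auto
        then show ?thesis using xpow[of i] z(2) \<open>x \<noteq> z\<close> by auto
      qed
      then have Dx2: "d = \<one> \<or> d = x" if "d \<in> D" for d using that by blast
      show ?thesis
      proof (rule abel)
        fix a b assume "a \<in> D" "b \<in> D"
        then have "a = \<one> \<or> a = x" "b = \<one> \<or> b = x" using Dx2 by blast+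
        then show "a \<otimes> b = b \<otimes> a" using xc by (elim disjE) simp_all
      qed
    next
      case True
      obtain u v where uv: "u \<in> S" "v \<in> S" "ord u = 2" "ord v = 2" "\<nexists>j::nat. v = u [^] j"
        using nu unfolding unique_prime_subgroup_def by blast
      (* S has a second involution t. A nontrivial element with x among its powers lies in
         Cyc x, so elements outside D have order two. *)
      have "\<exists>t\<in>S. ord t = 2 \<and> t \<noteq> x"
      proof (cases "u = x")
        case True
        then have "v \<noteq> x" using uv(5) xc by (metis nat_pow_eone)
        then show ?thesis using uv by blast
      next
        case False then show ?thesis using uv by blast
      qed
      then obtain t where t: "t \<in> S" "ord t = 2" "t \<noteq> x" by blast
      have tc: "t \<in> carrier G" using t by simp
      have tD: "t \<notin> D"
      proof
        assume "t \<in> D"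
        then obtain j :: nat where "t = x [^] j" using unique_prime_subgroupD[OF uniqD xD _ ox] t True \<open>p = 2\<close> by auto
        then show False using xpow[of j] t by auto
      qed
      have inv2: "w [^] (2::nat) = \<one>" if w: "w \<in> S" "w \<notin> D" for w
      proof (rule ccontr)
        assume ne: "w [^] (2::nat) \<noteq> \<one>"
        have wc: "w \<in> carrier G" using w by simp
        obtain j :: nat where j: "ord (w [^] j) = 4" using pow_of_ord_four[OF S card2 w(1) ne] .
        have "(w [^] j) [^] (2::nat) = x" using four[OF subgroup_pow_closed[OF S w(1)] j] True by simp
        then have "x = w [^] (j * 2)" using wc by (simp add: nat_pow_pow)
        then have "w \<in> Cyc G x"
          using mem_CycI[OF xc wc, of w "j * 2" 1] wc by (auto intro: generate.incl)
        then show False using w unfolding D_def by blast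
      qed
      have tt: "t \<otimes> t = \<one>" using inv2[OF t(1) tD] tc by (simp add: numeral_2_eq_2)
      have tinv: "t \<otimes> d \<otimes> t = inv d" if d: "d \<in> D" for d
      proof -
        have dc: "d \<in> carrier G" and dS: "d \<in> S" using d DS by auto
        have "t \<otimes> d \<notin> D"
        proof
          assume "t \<otimes> d \<in> D"
          then have "t \<otimes> d \<otimes> inv d \<in> D" using d by blast
          then show False using tD tc dc by (simp add: m_assoc)
        qed
        then have "(t \<otimes> d) \<otimes> (t \<otimes> d) = \<one>"
          using inv2[of "t \<otimes> d"] t(1) dS tc dc by (simp add: numeral_2_eq_2)
        then have "(t \<otimes> d \<otimes> t) \<otimes> d = \<one>" using tc dc by (simp add: m_assoc)
        then show ?thesis using inv_equality[of "t \<otimes> d \<otimes> t" d] tc dc by simp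
      qed
      show ?thesis
      proof (rule abel)
        fix a b assume ab: "a \<in> D" "b \<in> D"
        have abc: "a \<in> carrier G" "b \<in> carrier G" using ab by auto
        have "inv (b \<otimes> a) = t \<otimes> (b \<otimes> a) \<otimes> t" using tinv[of "b \<otimes> a"] ab by simp
        also have "\<dots> = (t \<otimes> b \<otimes> (t \<otimes> t) \<otimes> a \<otimes> t)" using tt tc abc by (simp add: m_assoc)
        also have "\<dots> = (t \<otimes> b \<otimes> t) \<otimes> (t \<otimes> a \<otimes> t)" using tc abc by (simp add: m_assoc)
        also have "\<dots> = inv b \<otimes> inv a" using tinv ab by simp
        also have "\<dots> = inv (a \<otimes> b)" using abc by (simp add: inv_mult_group)
        finally have "inv (inv (b \<otimes> a)) = inv (inv (a \<otimes> b))" by simp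
        then show "a \<otimes> b = b \<otimes> a" using abc by simp
      qed
    qed
  qed
qed

end

section \<open>Nilpotent normal subgroups and chief factors\<close>

text \<open>The lower central series of \<open>A\<close> as a group of its own; its terms are subgroups of \<open>G\<close>.\<close>

abbreviation lcs_of :: "('a, 'b) monoid_scheme \<Rightarrow> 'a set \<Rightarrow> nat \<Rightarrow> 'a set" where
  "lcs_of G A n \<equiv> lower_central_series (G\<lparr>carrier := A\<rparr>) n"

context group
begin

text \<open>The three facts are proved together, because the inclusion in \<open>A\<close> is what turns
  inverses and generated subgroups of \<open>A\<close> into those of \<open>G\<close>.\<close>

lemma lcs_of_subgroup_and_Suc:
  assumes A: "subgroup A G"
  shows "subgroup (lcs_of G A n) G \<and> lcs_of G A n \<subseteq> A \<and>
    lcs_of G A (Suc n) = generate G (\<Union>h\<in>lcs_of G A n. \<Union>g\<in>A. {commutator G h g})"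
proof -
  interpret A: subgroup A G by (rule A)
  have step: "lcs_of G A (Suc n) = generate G (\<Union>h\<in>lcs_of G A n. \<Union>g\<in>A. {commutator G h g})
      \<and> (\<Union>h\<in>lcs_of G A n. \<Union>g\<in>A. {commutator G h g}) \<subseteq> A"
    if sub: "lcs_of G A n \<subseteq> A" for n
  proof -
    have eq: "(\<Union>h\<in>lcs_of G A n. \<Union>g\<in>A. {commutator (G\<lparr>carrier := A\<rparr>) h g})
        = (\<Union>h\<in>lcs_of G A n. \<Union>g\<in>A. {commutator G h g})" (is "?L = ?R")
    proof (intro SUP_cong refl)
      fix h g assume "h \<in> lcs_of G A n" "g \<in> A"
      then have "h \<in> A" "g \<in> A" using sub by blast+
      then show "{commutator (G\<lparr>carrier := A\<rparr>) h g} = {commutator G h g}"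
        using m_inv_consistent[OF A] by simp
    qed
    have sub': "?R \<subseteq> A" using sub A.m_closed A.m_inv_closed by blast
    have "lcs_of G A (Suc n) = generate (G\<lparr>carrier := A\<rparr>) ?L" by simp
    also have "\<dots> = generate G ?R" unfolding eq by (rule generate_consistent[OF sub' A])
    finally show ?thesis using sub' by blast
  qed
  have "subgroup (lcs_of G A n) G \<and> lcs_of G A n \<subseteq> A" for n
  proof (induction n)
    case 0 then show ?case using A by simp
  next
    case (Suc n)
    then have s: "lcs_of G A (Suc n) = generate G (\<Union>h\<in>lcs_of G A n. \<Union>g\<in>A. {commutator G h g})"
      and sub: "(\<Union>h\<in>lcs_of G A n. \<Union>g\<in>A. {commutator G h g}) \<subseteq> A"
      using step[of n] by blast+
    then have sub2: "(\<Union>h\<in>lcs_of G A n. \<Union>g\<in>A. {commutator G h g}) \<subseteq> carrier G"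
      using A.subset by blast
    show ?case
      unfolding s using generate_is_subgroup[OF sub2] generate_subgroup_incl[OF sub A] by blast
  qed
  then show ?thesis using step by blast
qed

lemmas lcs_of_subgroup = lcs_of_subgroup_and_Suc[THEN conjunct1]
lemmas lcs_of_subset = lcs_of_subgroup_and_Suc[THEN conjunct2, THEN conjunct1]
lemmas lcs_of_Suc = lcs_of_subgroup_and_Suc[THEN conjunct2, THEN conjunct2]

lemma lcs_of_commutator:
  assumes A: "subgroup A G" and "h \<in> lcs_of G A n" "g \<in> A"
  shows "commutator G h g \<in> lcs_of G A (Suc n)"
  unfolding lcs_of_Suc[OF A] using assms(2,3) by (blast intro: generate.incl)

lemma lcs_of_Suc_least:
  assumes A: "subgroup A G" and K: "subgroup K G"
    and "\<And>h g. \<lbrakk>h \<in> lcs_of G A n; g \<in> A\<rbrakk> \<Longrightarrow> commutator G h g \<in> K"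
  shows "lcs_of G A (Suc n) \<subseteq> K"
  unfolding lcs_of_Suc[OF A] using assms(3) by (intro generate_subgroup_incl[OF _ K]) blast

lemma lcs_of_one_le_derived:
  assumes "subgroup A G"
  shows "lcs_of G A (Suc 0) \<subseteq> derived G A"
proof (rule lcs_of_Suc_least[OF assms derived_is_subgroup[OF subgroup.subset[OF assms]]])
  fix h g assume "h \<in> lcs_of G A 0" "g \<in> A"
  then have "commutator G h g \<in> derived_set G A" by auto
  then show "commutator G h g \<in> derived G A" unfolding derived_def by (rule generate.incl)
qed

lemma lcs_of_mono:
  assumes A: "subgroup A G" and B: "subgroup B G" and AB: "A \<subseteq> B"
  shows "lcs_of G A n \<subseteq> lcs_of G B n"
proof (induction n)
  case 0 then show ?case using AB by simp
next
  case (Suc n)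
  show ?case
    using Suc AB by (intro lcs_of_Suc_least[OF A lcs_of_subgroup[OF B]] lcs_of_commutator[OF B]) blast+
qed

lemma lcs_of_antimono:
  assumes A: "subgroup A G" and "m \<le> n"
  shows "lcs_of G A n \<subseteq> lcs_of G A m"
proof -
  interpret A: subgroup A G by (rule A)
  have "g \<otimes> h \<otimes> inv g \<in> lcs_of G A n \<and> lcs_of G A (Suc n) \<subseteq> lcs_of G A n"
    if "g \<in> A" "h \<in> lcs_of G A n" for g h n
    using that
  proof (induction n arbitrary: g h)
    case 0
    then show ?case using lcs_of_subset[OF A, of "Suc 0"] by simp
  next
    case (Suc n)
    have le: "lcs_of G A (Suc n) \<subseteq> lcs_of G A n"
      using Suc.IH[OF A.one_closed subgroup.one_closed[OF lcs_of_subgroup[OF A]]] by blast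
    have conj: "g \<otimes> h \<otimes> inv g \<in> lcs_of G A (Suc n)" if g: "g \<in> A" and h: "h \<in> lcs_of G A (Suc n)" for g h
    proof -
      have "commutator G h g \<in> lcs_of G A (Suc n)"
        using lcs_of_commutator[OF A _ g] h le by blast
      then have "inv (commutator G h g) \<otimes> h \<in> lcs_of G A (Suc n)"
        using h subgroup.m_closed[OF lcs_of_subgroup[OF A]] subgroup.m_inv_closed[OF lcs_of_subgroup[OF A]] by blast
      moreover have "inv (commutator G h g) \<otimes> h = g \<otimes> h \<otimes> inv g"
        using h g lcs_of_subset[OF A] A.mem_carrier by (simp add: word_simps subset_iff del: lower_central_series.simps)
      ultimately show ?thesis by simp
    qed
    have "lcs_of G A (Suc (Suc n)) \<subseteq> lcs_of G A (Suc n)"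
    proof (rule lcs_of_Suc_least[OF A lcs_of_subgroup[OF A]])
      fix h g assume h: "h \<in> lcs_of G A (Suc n)" and g: "g \<in> A"
      have hc: "h \<in> carrier G" using h lcs_of_subset[OF A] A.mem_carrier by blast
      have "inv h \<in> lcs_of G A (Suc n)" using h lcs_of_subgroup[OF A] subgroup.m_inv_closed by metis
      then have "h \<otimes> (g \<otimes> inv h \<otimes> inv g) \<in> lcs_of G A (Suc n)"
        using conj[OF g] h subgroup.m_closed[OF lcs_of_subgroup[OF A]] by blast
      then show "commutator G h g \<in> lcs_of G A (Suc n)" using hc g by (simp add: m_assoc del: lower_central_series.simps)
    qed
    then show ?case using conj Suc.prems by blast
  qed
  then have "lcs_of G A (Suc n) \<subseteq> lcs_of G A n" for n
    using A.one_closed subgroup.one_closed[OF lcs_of_subgroup[OF A]] by blast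
  then show ?thesis using \<open>m \<le> n\<close> by (rule lift_Suc_antimono_le)
qed

lemma nilpotent_group_iff: "nilpotent_group (G\<lparr>carrier := A\<rparr>) \<longleftrightarrow> (\<exists>n. lcs_of G A n = {\<one>})"
  unfolding nilpotent_group_def by simp

lemma nilpotent_groupI:
  assumes A: "subgroup A G" and "lcs_of G A n \<subseteq> {\<one>}"
  shows "nilpotent_group (G\<lparr>carrier := A\<rparr>)"
  using assms subgroup.one_closed[OF lcs_of_subgroup[OF A, of n]] unfolding nilpotent_group_iff by blast

lemma nilpotent_subgroup:
  assumes "subgroup A G" "subgroup B G" "A \<subseteq> B" "nilpotent_group (G\<lparr>carrier := B\<rparr>)"
  shows "nilpotent_group (G\<lparr>carrier := A\<rparr>)"
  using assms lcs_of_mono[OF assms(1-3)] nilpotent_groupI[OF assms(1)] unfolding nilpotent_group_iff by metis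

text \<open>If one term of the lower central series lies in \<open>K\<close>, then the preceding term normalizes \<open>K\<close>.\<close>

lemma nilpotent_normalizer_grows:
  assumes A: "subgroup A G" and nil: "nilpotent_group (G\<lparr>carrier := A\<rparr>)"
    and K: "subgroup K G" "K \<subseteq> A" "K \<noteq> A"
  obtains g where "g \<in> A" "g \<notin> K" "\<And>k. k \<in> K \<Longrightarrow> g \<otimes> k \<otimes> inv g \<in> K"
    "\<And>k. k \<in> K \<Longrightarrow> inv g \<otimes> k \<otimes> g \<in> K"
proof -
  interpret A: subgroup A G by (rule A)
  interpret K: subgroup K G by (rule K)
  have ex: "\<exists>n. lcs_of G A n \<subseteq> K"
    using nil K.one_closed unfolding nilpotent_group_iff by (metis empty_subsetI insert_subset)
  define n where "n = (LEAST n. lcs_of G A n \<subseteq> K)"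
  have n: "lcs_of G A n \<subseteq> K" unfolding n_def using ex by (rule LeastI_ex)
  have "n \<noteq> 0" using n K by auto
  then obtain m where m: "n = Suc m" using not0_implies_Suc by blast
  have "\<not> lcs_of G A m \<subseteq> K"
    using m not_less_Least[of m "\<lambda>n. lcs_of G A n \<subseteq> K"] unfolding n_def by simp
  then obtain g where g: "g \<in> lcs_of G A m" "g \<notin> K" by blast
  have gA: "g \<in> A" using g lcs_of_subset[OF A] by blast
  have ig: "inv g \<in> lcs_of G A m" using g lcs_of_subgroup[OF A] subgroup.m_inv_closed by metis
  have *: "v \<otimes> k \<otimes> inv v \<in> K" if v: "v \<in> lcs_of G A m" and k: "k \<in> K" for v k
  proof -
    have vc: "v \<in> carrier G" using v lcs_of_subset[OF A] A.mem_carrier by blast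
    have "commutator G v k \<in> K" using lcs_of_commutator[OF A v, of k] k K(2) n m by blast
    then have "commutator G v k \<otimes> k \<in> K" using k by blast
    moreover have "commutator G v k \<otimes> k = v \<otimes> k \<otimes> inv v" using vc k by (simp add: word_simps)
    ultimately show ?thesis by simp
  qed
  show thesis using that[OF gA g(2)] *[OF g(1)] *[OF ig] gA by simp
qed

end

context finite_group
begin

text \<open>The order of the image of \<open>x\<close> in \<open>K/S\<close> is a power of \<open>p\<close> and divides \<open>m\<close>.\<close>

lemma normal_p_element_mem:
  assumes K: "subgroup K G" and S: "subgroup S G" "S \<subseteq> K"
    and norm: "\<And>k s. \<lbrakk>k \<in> K; s \<in> S\<rbrakk> \<Longrightarrow> k \<otimes> s \<otimes> inv k \<in> S"
    and p: "prime p" and ind: "card K = card S * m" "\<not> p dvd m"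
    and x: "x \<in> K" "ord x = p ^ k"
  shows "x \<in> S"
proof -
  let ?K = "G\<lparr>carrier := K\<rparr>"
  interpret K: group ?K using subgroup_imp_group[OF K] .
  have SK: "subgroup S ?K" using subgroup_incl[OF S(1) K S(2)] .
  interpret N: normal S ?K
  proof (rule K.normal_invI[OF SK])
    fix k s assume "k \<in> carrier ?K" "s \<in> S"
    then show "k \<otimes>\<^bsub>?K\<^esub> s \<otimes>\<^bsub>?K\<^esub> inv\<^bsub>?K\<^esub> k \<in> S" using norm m_inv_consistent[OF K] by simp
  qed
  have xc: "x \<in> carrier G" using K x subgroup.mem_carrier by metis
  have fS: "card S > 0" using subgroup.finite_imp_card_positive[OF S(1) fin] .
  have "card (rcosets\<^bsub>?K\<^esub> S) * card S = m * card S"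
    using K.lagrange[OF SK] ind unfolding order_def by (simp add: mult.commute)
  then have om: "order (?K Mod S) = m"
    using fS unfolding order_def FactGroup_def by simp
  interpret Q: group "?K Mod S" by (rule N.factorgroup_is_group)
  have "(S #>\<^bsub>?K\<^esub> x) [^]\<^bsub>?K Mod S\<^esub> m = \<one>\<^bsub>?K Mod S\<^esub>"
    using Q.pow_order_eq_1[of "S #>\<^bsub>?K\<^esub> x"] x(1) unfolding om carrier_FactGroup by simp
  then have "S #>\<^bsub>?K\<^esub> (x [^]\<^bsub>?K\<^esub> m) = S"
    using N.FactGroup_pow[of x m] x(1) by simp
  then have "S #> (x [^] m) = S" by (simp flip: nat_pow_consistent)
  then have xm: "x [^] m \<in> S" using coset_join1[OF _ _ S(1)] xc by simp
  have "coprime m (p ^ k)" using ind(2) p by (metis coprime_commute coprime_power_left_iff prime_imp_coprime)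
  then obtain i where "[m * i = Suc 0] (mod (p ^ k))" using cong_solve_coprime_nat[of m "p ^ k"] by blast
  then have "x [^] (m * i) = x [^] Suc 0" using pow_cong_ord[OF xc] x(2) by metis
  then have "x = (x [^] m) [^] i" using xc by (simp add: nat_pow_pow)
  then show ?thesis using subgroup_pow_closed[OF S(1) xm, of i] by simp
qed

text \<open>Let \<open>K\<close> be the normalizer in \<open>A\<close> of a Sylow \<open>p\<close>-subgroup \<open>S\<close>. Since \<open>S\<close> consists of all
  \<open>p\<close>-elements of \<open>K\<close>, whatever normalizes \<open>K\<close> normalizes \<open>S\<close>. So \<open>K\<close> is its own normalizer,
  and in a nilpotent group this means \<open>K = A\<close>.\<close>

lemma nilpotent_sylow:
  assumes A: "subgroup A G" and nil: "nilpotent_group (G\<lparr>carrier := A\<rparr>)" and p: "prime p"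
  obtains S a m where "subgroup S G" "S \<subseteq> A" "card S = p ^ a" "card A = p ^ a * m" "\<not> p dvd m"
    "\<And>x k. \<lbrakk>x \<in> A; ord x = p ^ k\<rbrakk> \<Longrightarrow> x \<in> S"
proof -
  interpret A: subgroup A G by (rule A)
  let ?A = "G\<lparr>carrier := A\<rparr>"
  interpret Ag: group ?A using subgroup_imp_group[OF A] .
  have "card A \<noteq> 0" using A.finite_imp_card_positive[OF fin] by simp
  then obtain a m where am: "card A = p ^ a * m" "\<not> p dvd m"
    using multiplicity_decompose'[of "card A" p] p by (metis not_prime_unit)
  obtain S where "subgroup S ?A" and cS: "card S = p ^ a"
    using sylow_thm[OF p Ag.is_group, of a m] am finite_subgroup[OF A] unfolding order_def by auto
  then have S: "subgroup S G" and SA: "S \<subseteq> A"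
    using incl_subgroup[OF A] subgroup.subset by (blast, fastforce)
  interpret S: subgroup S G by (rule S)
  (* Both conditions are imposed so that K is visibly closed under inverses. *)
  define K where "K = {g \<in> A. \<forall>s\<in>S. g \<otimes> s \<otimes> inv g \<in> S \<and> inv g \<otimes> s \<otimes> g \<in> S}"
  have K: "subgroup K G"
  proof (rule subgroupI)
    show "K \<subseteq> carrier G" unfolding K_def using A.subset by blast
    have "\<one> \<in> K" unfolding K_def by simp
    then show "K \<noteq> {}" by blast
    show "inv g \<in> K" if "g \<in> K" for g using that unfolding K_def by simp
    show "g \<otimes> h \<in> K" if "g \<in> K" "h \<in> K" for g h
    proof -
      have gh: "g \<in> A" "h \<in> A" using that unfolding K_def by simp_all
      have "(g \<otimes> h) \<otimes> s \<otimes> inv (g \<otimes> h) \<in> S \<and> inv (g \<otimes> h) \<otimes> s \<otimes> (g \<otimes> h) \<in> S" if s: "s \<in> S" for s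
      proof -
        have "h \<otimes> s \<otimes> inv h \<in> S" "inv g \<otimes> s \<otimes> g \<in> S"
          using \<open>g \<in> K\<close> \<open>h \<in> K\<close> s unfolding K_def by simp_all
        then have "g \<otimes> (h \<otimes> s \<otimes> inv h) \<otimes> inv g \<in> S" "inv h \<otimes> (inv g \<otimes> s \<otimes> g) \<otimes> h \<in> S"
          using \<open>g \<in> K\<close> \<open>h \<in> K\<close> unfolding K_def by blast+
        then show ?thesis using gh s by (simp add: word_simps)
      qed
      then show ?thesis using gh unfolding K_def by simp
    qed
  qed
  have KA: "K \<subseteq> A" unfolding K_def by blast
  have SK: "S \<subseteq> K" unfolding K_def using SA by auto
  have Kmem: "x \<in> S" if x: "x \<in> K" "ord x = p ^ k" for x k
  proof -
    obtain m' where m': "card K = card S * m'" using card_subgroup_dvd[OF S K SK] by (metis dvd_def)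
    have "card S * m' dvd card S * m" using card_subgroup_dvd[OF K A KA] m' am cS by simp
    then have "m' dvd m" using S.finite_imp_card_positive[OF fin] by simp
    then have "\<not> p dvd m'" using am(2) dvd_trans by blast
    then show ?thesis
      using normal_p_element_mem[OF K S SK _ p m' _ x] unfolding K_def by blast
  qed
  have "K = A"
  proof (rule ccontr)
    assume "K \<noteq> A"
    then obtain g where g: "g \<in> A" "g \<notin> K" and gK: "\<And>k. k \<in> K \<Longrightarrow> g \<otimes> k \<otimes> inv g \<in> K"
      "\<And>k. k \<in> K \<Longrightarrow> inv g \<otimes> k \<otimes> g \<in> K"
      using nilpotent_normalizer_grows[OF A nil K KA] by metis
    have gc: "g \<in> carrier G" using g by simp
    have "g \<otimes> s \<otimes> inv g \<in> S \<and> inv g \<otimes> s \<otimes> g \<in> S" if s: "s \<in> S" for s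
    proof -
      obtain k where k: "ord s = p ^ k" using ord_prime_power[OF S cS p s] .
      have sc: "s \<in> carrier G" and sK: "s \<in> K" using s SK by auto
      have "ord (g \<otimes> s \<otimes> inv g) = p ^ k" "ord (inv g \<otimes> s \<otimes> g) = p ^ k"
        using ord_conj[OF gc sc] ord_conj[of "inv g" s] gc sc k by simp_all
      then show ?thesis using Kmem gK sK by blast
    qed
    then show False using g unfolding K_def by blast
  qed
  then show thesis using that[OF S SA cS am] Kmem by blast
qed

lemma normal_sylow_of_nilpotent:
  assumes A: "A \<lhd> G" and nil: "nilpotent_group (G\<lparr>carrier := A\<rparr>)" and p: "prime p"
  obtains S a m where "S \<lhd> G" "S \<subseteq> A" "card S = p ^ a" "card A = p ^ a * m" "\<not> p dvd m"
proof -
  interpret A: normal A G by (rule A)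
  obtain S a m where S: "subgroup S G" "S \<subseteq> A" "card S = p ^ a" "card A = p ^ a * m" "\<not> p dvd m"
    and mem: "\<And>x k. \<lbrakk>x \<in> A; ord x = p ^ k\<rbrakk> \<Longrightarrow> x \<in> S"
    using nilpotent_sylow[OF A.is_subgroup nil p] by metis
  have "S \<lhd> G"
  proof (rule normal_invI[OF S(1)])
    fix g s assume g: "g \<in> carrier G" and s: "s \<in> S"
    obtain k where k: "ord s = p ^ k" using ord_prime_power[OF S(1,3) p s] .
    have sA: "s \<in> A" using s S(2) by blast
    have "g \<otimes> s \<otimes> inv g \<in> A" using A.inv_op_closed2[OF g sA] .
    moreover have "ord (g \<otimes> s \<otimes> inv g) = p ^ k" using ord_conj[OF g] sA k by simp
    ultimately show "g \<otimes> s \<otimes> inv g \<in> S" using mem by blast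
  qed
  then show thesis using that S by blast
qed

end

text \<open>A chief factor \<open>S/T\<close> of \<open>G\<close> inside a normal \<open>p\<close>-subgroup, kept as a pair of normal subgroups
  so that centralizing it is a condition on commutators in \<open>G\<close>.\<close>

definition (in group) chief_pair :: "nat \<Rightarrow> 'a set \<Rightarrow> 'a set \<Rightarrow> bool" where
  "chief_pair p S T \<longleftrightarrow> prime p \<and> S \<lhd> G \<and> T \<lhd> G \<and> T \<subset> S \<and> (\<exists>n. card S = p ^ n) \<and>
     (\<forall>K. K \<lhd> G \<longrightarrow> T \<subseteq> K \<longrightarrow> K \<subseteq> S \<longrightarrow> K = T \<or> K = S)"

definition (in group) centralizes_factor :: "'a set \<Rightarrow> 'a set \<Rightarrow> 'a set \<Rightarrow> bool" where
  "centralizes_factor L S T \<longleftrightarrow> (\<forall>l\<in>L. \<forall>s\<in>S. commutator G l s \<in> T)"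

context group
begin

lemma chief_pairE:
  assumes "chief_pair p S T"
  obtains n where "prime p" "S \<lhd> G" "T \<lhd> G" "T \<subseteq> S" "T \<noteq> S" "card S = p ^ n"
    "\<And>K. \<lbrakk>K \<lhd> G; T \<subseteq> K; K \<subseteq> S\<rbrakk> \<Longrightarrow> K = T \<or> K = S"
proof -
  obtain n where "card S = p ^ n" using assms unfolding chief_pair_def by (elim conjE exE)
  with assms show thesis
    unfolding chief_pair_def by (intro that) (elim conjE; simp)+
qed

lemma chief_pair_oneE:
  assumes "chief_pair p V {\<one>}"
  obtains n where "prime p" "V \<lhd> G" "V \<noteq> {\<one>}" "card V = p ^ n"
    "\<And>K. \<lbrakk>K \<lhd> G; K \<subseteq> V\<rbrakk> \<Longrightarrow> K = {\<one>} \<or> K = V"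
proof (rule chief_pairE[OF assms])
  fix n assume n: "prime p" "V \<lhd> G" "{\<one>} \<noteq> V" "card V = p ^ n"
    and min: "\<And>K. \<lbrakk>K \<lhd> G; {\<one>} \<subseteq> K; K \<subseteq> V\<rbrakk> \<Longrightarrow> K = {\<one>} \<or> K = V"
  have "{\<one>} \<subseteq> K" if "K \<lhd> G" for K
    using subgroup.one_closed[OF normal_imp_subgroup[OF that]] by simp
  then show thesis using that n min by metis
qed

lemma set_mult_upper:
  assumes A: "subgroup A G" and B: "subgroup B G"
  shows "A \<subseteq> A <#> B" "B \<subseteq> A <#> B"
proof -
  interpret A: subgroup A G by (rule A)
  interpret B: subgroup B G by (rule B)
  have "a = a \<otimes> \<one>" if "a \<in> A" for a using that by simp
  then show "A \<subseteq> A <#> B" unfolding set_mult_def using B.one_closed by blast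
  have "b = \<one> \<otimes> b" if "b \<in> B" for b using that by simp
  then show "B \<subseteq> A <#> B" unfolding set_mult_def using A.one_closed by blast
qed

end

context finite_group
begin

text \<open>Take \<open>B\<close> maximal and a prime \<open>p\<close> dividing the index of \<open>B\<close> in \<open>A\<close>. The Sylow \<open>p\<close>-subgroup \<open>S\<close> of
  \<open>A\<close> is normal in \<open>G\<close> and not contained in \<open>B\<close>, so \<open>A\<close> is the product of \<open>B\<close> and \<open>S\<close>, and
  \<open>A/B\<close> is isomorphic to the chief factor of \<open>S\<close> by its intersection with \<open>B\<close>, which \<open>L\<close>
  centralizes.\<close>

lemma nilpotent_normal_descends:
  assumes A: "A \<lhd> G" and nil: "nilpotent_group (G\<lparr>carrier := A\<rparr>)" and A1: "A \<noteq> {\<one>}"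
    and L: "L \<subseteq> carrier G" and cent: "\<forall>p S T. chief_pair p S T \<longrightarrow> centralizes_factor L S T"
  obtains B where "B \<lhd> G" "B \<subset> A" "\<And>l a. \<lbrakk>l \<in> L; a \<in> A\<rbrakk> \<Longrightarrow> commutator G l a \<in> B"
proof -
  interpret A: normal A G by (rule A)
  have finA: "finite A" using finite_subgroup[OF A.is_subgroup] .
  let ?B = "{B. B \<lhd> G \<and> B \<subset> A}"
  have "?B \<subseteq> Pow A" by blast
  then have "finite ?B" using finA finite_subset finite_Pow_iff by metis
  moreover have "{\<one>} \<subset> A" using A1 A.one_closed by auto
  then have "?B \<noteq> {}" using one_is_normal by (metis (mono_tags, lifting) empty_iff mem_Collect_eq)
  ultimately have "\<exists>B\<in>?B. \<forall>C\<in>?B. B \<subseteq> C \<longrightarrow> B = C" by (rule finite_has_maximal)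
  then obtain B where B: "B \<lhd> G \<and> B \<subset> A" and max: "\<And>C. \<lbrakk>C \<lhd> G; C \<subset> A; B \<subseteq> C\<rbrakk> \<Longrightarrow> B = C"
    by (elim bexE) simp
  have BG: "B \<lhd> G" and BA: "B \<subset> A" using B by blast+
  interpret B: normal B G by (rule BG)
  obtain q where q: "card A = card B * q"
    using card_subgroup_dvd[OF B.is_subgroup A.is_subgroup] BA by (metis dvd_def psubsetE)
  have "q \<noteq> 1" using q psubset_card_mono[OF finA BA] by auto
  then obtain p where p: "prime p" "p dvd q" using prime_factor_nat by blast
  obtain S a m where S: "S \<lhd> G" "S \<subseteq> A" "card S = p ^ a" "card A = p ^ a * m" "\<not> p dvd m"
    using normal_sylow_of_nilpotent[OF A nil p(1)] .
  interpret S: normal S G by (rule S)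
  have notSB: "\<not> S \<subseteq> B"
  proof
    assume "S \<subseteq> B"
    then obtain c where c: "card B = card S * c"
      using card_subgroup_dvd[OF S.is_subgroup B.is_subgroup] by (metis dvd_def)
    have "p ^ a * (c * q) = p ^ a * m" using q S(3,4) c by (metis mult.assoc)
    moreover have "p ^ a \<noteq> 0" using prime_gt_0_nat[OF p(1)] by simp
    ultimately have "c * q = m" by (metis mult_left_cancel)
    then show False using p(2) S(5) by auto
  qed
  have BX: "B <#> X = A" if X: "X \<lhd> G" "X \<subseteq> A" "\<not> X \<subseteq> B" for X
  proof (rule ccontr)
    assume ne: "B <#> X \<noteq> A"
    interpret X: normal X G by (rule X)
    have N: "B <#> X \<lhd> G" using normal_subgroup_set_mult_closed[OF BG X(1)] .
    have sub: "B <#> X \<subseteq> A" using BA X(2) A.m_closed unfolding set_mult_def by blast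
    have Bsub: "B \<subseteq> B <#> X" and Xsub: "X \<subseteq> B <#> X"
      using set_mult_upper[OF B.is_subgroup X.is_subgroup] .
    have "B = B <#> X" using max[OF N _ Bsub] sub ne by blast
    then show False using Xsub X(3) by blast
  qed
  let ?T = "S \<inter> B"
  have "chief_pair p S ?T"
    unfolding chief_pair_def
  proof (intro conjI allI impI)
    show "?T \<lhd> G" using normal_subgroup_intersect[OF S(1) BG] .
    show "?T \<subset> S" using notSB by blast
    show "\<exists>n. card S = p ^ n" using S by blast
    fix K assume K: "K \<lhd> G" "?T \<subseteq> K" "K \<subseteq> S"
    interpret K: normal K G by (rule K)
    show "K = ?T \<or> K = S"
    proof (cases "K \<subseteq> B")
      case True then show ?thesis using K by blast
    next
      case False
      then have BK: "B <#> K = A" using BX[OF K(1)] K(3) S(2) by blast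
      have "S \<subseteq> K"
      proof
        fix s assume s: "s \<in> S"
        then obtain b k where bk: "b \<in> B" "k \<in> K" "s = b \<otimes> k"
          using BK S(2) unfolding set_mult_def by blast
        have "b = s \<otimes> inv k" using bk by (simp add: m_assoc)
        then have "b \<in> S" using s bk(2) K(3) by blast
        then have "b \<in> K" using bk(1) K(2) by blast
        then show "s \<in> K" using bk by simp
      qed
      then show ?thesis using K(3) by blast
    qed
  qed (rule p(1), rule S(1))
  then have cS: "\<And>l s. \<lbrakk>l \<in> L; s \<in> S\<rbrakk> \<Longrightarrow> commutator G l s \<in> B"
    using cent unfolding centralizes_factor_def by blast
  show thesis
  proof (rule that[OF BG BA])
    fix l x assume l: "l \<in> L" and x: "x \<in> A"
    have lc: "l \<in> carrier G" using l L by blast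
    obtain b s where bs: "b \<in> B" "s \<in> S" "x = b \<otimes> s"
      using BX[OF S(1,2) notSB] x unfolding set_mult_def by blast
    have "l \<otimes> b \<otimes> inv l \<in> B" using B.inv_op_closed2[OF lc bs(1)] .
    moreover have "b \<otimes> commutator G l s \<otimes> inv b \<in> B"
      using B.inv_op_closed2[OF _ cS[OF l bs(2)], of b] bs by simp
    ultimately have "(l \<otimes> b \<otimes> inv l \<otimes> inv b) \<otimes> (b \<otimes> commutator G l s \<otimes> inv b) \<in> B"
      using bs(1) by simp
    moreover have "(l \<otimes> b \<otimes> inv l \<otimes> inv b) \<otimes> (b \<otimes> commutator G l s \<otimes> inv b) = commutator G l x"
      using lc bs by (simp add: word_simps)
    ultimately show "commutator G l x \<in> B" by simp
  qed
qed

text \<open>By the preceding lemma each step of the series descends at least one step in a chain of normal subgroups from \<open>A\<close> to \<open>1\<close>.\<close>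

lemma lcs_of_reaches_one:
  assumes L: "subgroup L G" and cent: "\<forall>p S T. chief_pair p S T \<longrightarrow> centralizes_factor L S T"
    and "A \<lhd> G" "nilpotent_group (G\<lparr>carrier := A\<rparr>)" "lcs_of G L i \<subseteq> A"
  shows "nilpotent_group (G\<lparr>carrier := L\<rparr>)"
  using assms(3-5)
proof (induction "card A" arbitrary: A i rule: less_induct)
  case less
  interpret A: normal A G by (rule less.prems)
  show ?case
  proof (cases "A = {\<one>}")
    case True
    then show ?thesis using nilpotent_groupI[OF L] less.prems by blast
  next
    case False
    obtain B where B: "B \<lhd> G" "B \<subset> A" and com: "\<And>l a. \<lbrakk>l \<in> L; a \<in> A\<rbrakk> \<Longrightarrow> commutator G l a \<in> B"
      using nilpotent_normal_descends[OF less.prems(1,2) False subgroup.subset[OF L] cent] by metis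
    interpret B: normal B G by (rule B)
    show ?thesis
    proof (rule less.hyps)
      show "card B < card A" using psubset_card_mono[OF finite_subgroup[OF A.is_subgroup] B(2)] .
      show "nilpotent_group (G\<lparr>carrier := B\<rparr>)"
        using nilpotent_subgroup[OF B.is_subgroup A.is_subgroup _ less.prems(2)] B(2) by blast
      show "lcs_of G L (Suc i) \<subseteq> B"
      proof (rule lcs_of_Suc_least[OF L B.is_subgroup])
        fix h g assume h: "h \<in> lcs_of G L i" and g: "g \<in> L"
        have hA: "h \<in> A" using h less.prems(3) by blast
        have gc: "g \<in> carrier G" using g subgroup.mem_carrier[OF L] by simp
        have "inv (commutator G g h) \<in> B" using com[OF g hA] by simp
        moreover have "inv (commutator G g h) = commutator G h g" using hA gc by (simp add: word_simps)
        ultimately show "commutator G h g \<in> B" by simp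
      qed
    qed (rule B(1))
  qed
qed

text \<open>Induction along the derived series: the derived subgroup of \<open>L\<close> is nilpotent and contains the second term of
  the lower central series of \<open>L\<close>, so from there on the series descends to \<open>1\<close>.\<close>

theorem nilpotent_if_centralizes_chief_pairs:
  assumes "L \<lhd> G" "(derived G ^^ n) L = {\<one>}"
    and "\<forall>p S T. chief_pair p S T \<longrightarrow> centralizes_factor L S T"
  shows "nilpotent_group (G\<lparr>carrier := L\<rparr>)"
  using assms
proof (induction n arbitrary: L)
  case 0
  then show ?case using nilpotent_groupI[OF normal_imp_subgroup[OF 0(1)], of 0] by simp
next
  case (Suc n)
  have L: "subgroup L G" using normal_imp_subgroup[OF Suc.prems(1)] .
  let ?D = "derived G L"
  have D: "?D \<lhd> G" using derived_is_normal[OF Suc.prems(1)] .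
  have DL: "?D \<subseteq> L" using derived_incl[OF subset_refl L] .
  have "nilpotent_group (G\<lparr>carrier := ?D\<rparr>)"
  proof (rule Suc.IH[OF D])
    show "(derived G ^^ n) ?D = {\<one>}" using Suc.prems(2) by (simp add: funpow_swap1)
    show "\<forall>p S T. chief_pair p S T \<longrightarrow> centralizes_factor ?D S T"
      using Suc.prems(3) DL unfolding centralizes_factor_def by blast
  qed
  moreover have "lcs_of G L (Suc 0) \<subseteq> ?D" by (rule lcs_of_one_le_derived[OF L])
  ultimately show ?case using lcs_of_reaches_one[OF L Suc.prems(3) D] by blast
qed

end

lemma (in group_hom) lcs_of_img:
  assumes A: "subgroup A G"
  shows "lcs_of H (h ` A) n = h ` lcs_of G A n"
proof (induction n)
  case 0 then show ?case by simp
next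
  case (Suc n)
  have hA: "subgroup (h ` A) H" using subgroup_img_is_subgroup[OF A] .
  have Ac: "A \<subseteq> carrier G" using subgroup.subset[OF A] .
  have lc: "lcs_of G A n \<subseteq> carrier G" using G.lcs_of_subset[OF A] Ac by blast
  let ?U = "\<Union>x\<in>lcs_of G A n. \<Union>g\<in>A. {commutator G x g}"
  have U: "?U \<subseteq> carrier G" using lc Ac by blast
  have cm: "commutator H (h x) (h g) = h (commutator G x g)" if "x \<in> lcs_of G A n" "g \<in> A" for x g
    using that lc Ac by (simp add: subset_iff)
  have "(\<Union>x\<in>h ` lcs_of G A n. \<Union>g\<in>h ` A. {commutator H x g}) = h ` ?U"
    using cm by (simp add: image_UN)
  then show ?case
    unfolding H.lcs_of_Suc[OF hA] G.lcs_of_Suc[OF A] Suc using generate_img[OF U] by simp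
qed

section \<open>Chief factors of order at most four\<close>

context group
begin

text \<open>The group acts on \<open>Y\<close> through permutations of three points. Those acting as a rotation of
  \<open>(a, b, c)\<close> form a subgroup that contains all commutators, and rotations commute.\<close>

lemma derived_derived_centralizes_three_points:
  assumes Y: "Y = {a, b, c}" "a \<noteq> b" "b \<noteq> c" "a \<noteq> c" "Y \<subseteq> carrier G"
    and act: "\<And>g y. \<lbrakk>g \<in> carrier G; y \<in> Y\<rbrakk> \<Longrightarrow> g \<otimes> y \<otimes> inv g \<in> Y"
    and l: "l \<in> derived G (derived G (carrier G))" and y: "y \<in> Y"
  shows "l \<otimes> y = y \<otimes> l"
proof -
  (* The permutations of a, b, c other than the three rotations are the three transpositions. *)
  define f where "f g v = g \<otimes> v \<otimes> inv g" for g v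
  define rot where "rot g \<longleftrightarrow> (f g a = a \<and> f g b = b \<and> f g c = c) \<or>
    (f g a = b \<and> f g b = c \<and> f g c = a) \<or> (f g a = c \<and> f g b = a \<and> f g c = b)" for g
  have abc: "a \<in> carrier G" "b \<in> carrier G" "c \<in> carrier G" using Y by auto
  have fc: "f g v \<in> carrier G" if "g \<in> carrier G" "v \<in> carrier G" for g v
    unfolding f_def using that by simp
  have f_mult: "f (g \<otimes> h) v = f g (f h v)" if "g \<in> carrier G" "h \<in> carrier G" "v \<in> carrier G" for g h v
    unfolding f_def using that by (simp add: word_simps)
  have f_one: "f \<one> v = v" if "v \<in> carrier G" for v
    unfolding f_def using that by simp
  have f_inj: "v = w" if "g \<in> carrier G" "v \<in> carrier G" "w \<in> carrier G" "f g v = f g w" for g v w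
    using that unfolding f_def by simp
  have six: "rot g \<or> (f g a = a \<and> f g b = c \<and> f g c = b) \<or>
      (f g a = b \<and> f g b = a \<and> f g c = c) \<or> (f g a = c \<and> f g b = b \<and> f g c = a)"
    if g: "g \<in> carrier G" for g
  proof -
    have "f g a \<in> {a, b, c}" "f g b \<in> {a, b, c}" "f g c \<in> {a, b, c}"
      using act[OF g] Y(1) unfolding f_def by auto
    moreover have "f g a \<noteq> f g b" "f g b \<noteq> f g c" "f g a \<noteq> f g c"
      using f_inj[OF g] abc Y(2-4) by blast+
    ultimately show ?thesis unfolding rot_def by auto
  qed
  have rot_mult: "rot (g \<otimes> h) \<longleftrightarrow> (rot g \<longleftrightarrow> rot h)" if g: "g \<in> carrier G" and h: "h \<in> carrier G" for g h
    using six[OF g] six[OF h] f_mult[OF g h abc(1)] f_mult[OF g h abc(2)] f_mult[OF g h abc(3)] Y(2-4)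
    unfolding rot_def by (elim disjE conjE) simp_all
  have rot_one: "rot \<one>"
    unfolding rot_def using f_one abc by simp
  have rot_inv: "rot (inv g) \<longleftrightarrow> rot g" if g: "g \<in> carrier G" for g
  proof -
    show ?thesis using rot_mult[OF inv_closed[OF g] g] g rot_one by simp
  qed
  let ?K = "{g \<in> carrier G. rot g}"
  have "subgroup ?K G"
  proof (rule subgroupI)
    show "?K \<subseteq> carrier G" by blast
    have "\<one> \<in> ?K" using rot_one by simp
    then show "?K \<noteq> {}" by blast
    show "inv g \<in> ?K" if "g \<in> ?K" for g using that rot_inv by simp
    show "g \<otimes> h \<in> ?K" if "g \<in> ?K" "h \<in> ?K" for g h using that rot_mult by simp
  qed
  have "derived_set G (carrier G) \<subseteq> ?K"
  proof
    fix x assume "x \<in> derived_set G (carrier G)"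
    then obtain g h where gh: "g \<in> carrier G" "h \<in> carrier G" "x = commutator G g h" by blast
    then have "rot x" using rot_mult rot_inv by simp blast
    then show "x \<in> ?K" using gh by simp
  qed
  then have DK: "derived G (carrier G) \<subseteq> ?K"
    unfolding derived_def by (rule generate_subgroup_incl) fact
  let ?C = "{g \<in> carrier G. g \<otimes> a = a \<otimes> g} \<inter> {g \<in> carrier G. g \<otimes> b = b \<otimes> g} \<inter> {g \<in> carrier G. g \<otimes> c = c \<otimes> g}"
  have C: "subgroup ?C G"
    using abc by (intro subgroups_Inter_pair subgroup_centralizer subgroup_self)
  have "derived_set G (derived G (carrier G)) \<subseteq> ?C"
  proof
    fix x assume "x \<in> derived_set G (derived G (carrier G))"
    then obtain g h where gh: "g \<in> derived G (carrier G)" "h \<in> derived G (carrier G)" "x = commutator G g h" by blast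
    have g: "g \<in> carrier G" "rot g" and h: "h \<in> carrier G" "rot h" using gh DK by blast+
    have gi: "inv g \<in> carrier G" "rot (inv g)" and hi: "inv h \<in> carrier G" "rot (inv h)"
      using g h rot_inv by simp_all
    have "x \<otimes> v = v \<otimes> x" if v: "v \<in> {a, b, c}" for v
    proof -
      have vc: "v \<in> carrier G" using v abc by blast
      have "f (inv g \<otimes> inv h) v = f (inv h \<otimes> inv g) v"
        using v gi(2) hi(2) f_mult[OF gi(1) hi(1)] f_mult[OF hi(1) gi(1)] abc unfolding rot_def
        by (elim disjE conjE insertE) simp_all
      then have "inv (inv h \<otimes> inv g) \<otimes> (inv g \<otimes> inv h) \<otimes> v = v \<otimes> (inv (inv h \<otimes> inv g) \<otimes> (inv g \<otimes> inv h))"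
        unfolding f_def using gi(1) hi(1) vc by (intro conj_eq_imp_commute) simp_all
      moreover have "inv (inv h \<otimes> inv g) \<otimes> (inv g \<otimes> inv h) = x"
        using gh(3) g h by (simp add: word_simps)
      ultimately show ?thesis by simp
    qed
    then show "x \<in> ?C" using gh(3) g h by simp
  qed
  then have "l \<in> ?C" using l generate_subgroup_incl[OF _ C] unfolding derived_def[of G "derived G (carrier G)"] by blast
  then show ?thesis using y Y(1) by auto
qed

end

context finite_group
begin

text \<open>At most three nontrivial elements are permuted. If there are two of them, the identity
  serves as a third point.\<close>

lemma derived_derived_centralizes_card_le_four:
  assumes V: "V \<lhd> G" and card: "card V \<le> 4"
    and l: "l \<in> derived G (derived G (carrier G))" and v: "v \<in> V"
  shows "l \<otimes> v = v \<otimes> l"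
proof -
  interpret V: normal V G by (rule V)
  have finV: "finite V" using finite_subgroup[OF V.is_subgroup] .
  have "derived G (derived G (carrier G)) \<subseteq> carrier G"
    by (intro derived_in_carrier subset_refl)
  then have lc: "l \<in> carrier G" using l by blast
  have "card (V - {\<one>}) \<le> 3" using card finV by simp
  then consider "card (V - {\<one>}) = 3" | "card (V - {\<one>}) = 2" | "card (V - {\<one>}) \<le> 1" by linarith
  then show ?thesis
  proof cases
    case 1
    then obtain a b c where abc: "V - {\<one>} = {a, b, c}" "a \<noteq> b" "b \<noteq> c" "a \<noteq> c"
      unfolding card_3_iff by blast
    have "g \<otimes> y \<otimes> inv g \<in> V - {\<one>}" if g: "g \<in> carrier G" and y: "y \<in> V - {\<one>}" for g y
    proof -
      have "g \<otimes> y \<otimes> inv g \<noteq> \<one>" using ord_conj[OF g, of y] y ord_eq_1[of y] by (auto simp del: One_nat_def)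
      then show ?thesis using V.inv_op_closed2[OF g] y by simp
    qed
    moreover have "V - {\<one>} \<subseteq> carrier G" using V.subset by blast
    ultimately have "l \<otimes> y = y \<otimes> l" if "y \<in> V - {\<one>}" for y
      using derived_derived_centralizes_three_points[OF abc _ _ l that] by blast
    then show ?thesis using v lc by (cases "v = \<one>") simp_all
  next
    case 2
    then obtain a b where ab: "V - {\<one>} = {a, b}" "a \<noteq> b" unfolding card_2_iff by blast
    then have "V = {a, b, \<one>}" "b \<noteq> \<one>" "a \<noteq> \<one>" using V.one_closed by blast+
    then show ?thesis
      using derived_derived_centralizes_three_points[of V a b \<one> l v] ab(2) V.subset V.inv_op_closed2 l v by blast
  next
    case 3
    show ?thesis
    proof (cases "v = \<one>")
      case True then show ?thesis using lc by simp
    next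
      case False
      then have "l \<otimes> v \<otimes> inv l \<in> V - {\<one>}"
        using V.inv_op_closed2[OF lc v] ord_conj[OF lc, of v] v ord_eq_1[of v] by (auto simp del: One_nat_def)
      moreover have "v \<in> V - {\<one>}" using v False by simp
      moreover have "card (V - {\<one>}) \<le> Suc 0" using 3 by simp
      then have "\<forall>x\<in>V - {\<one>}. \<forall>y\<in>V - {\<one>}. x = y"
        by (rule iffD1[OF card_le_Suc0_iff_eq[OF finite_Diff[OF finV]]])
      ultimately have "l \<otimes> v \<otimes> inv l = v" by blast
      then show ?thesis using commuting_if_conj[OF lc] v by simp
    qed
  qed
qed

text \<open>The centre of a nontrivial \<open>p\<close>-group is nontrivial, and that of \<open>V\<close> is normal in \<open>G\<close>.\<close>

lemma chief_pair_one_abelian: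
  assumes ch: "chief_pair p V {\<one>}" and x: "x \<in> V" and y: "y \<in> V"
  shows "x \<otimes> y = y \<otimes> x"
proof -
  obtain n where p: "prime p" and V: "V \<lhd> G" "V \<noteq> {\<one>}" "card V = p ^ n"
    and min: "\<And>K. \<lbrakk>K \<lhd> G; K \<subseteq> V\<rbrakk> \<Longrightarrow> K = {\<one>} \<or> K = V"
    using chief_pair_oneE[OF ch] by metis
  interpret V: normal V G by (rule V)
  obtain z where z: "z \<in> V" "z \<noteq> \<one>" and zc: "\<And>h. h \<in> V \<Longrightarrow> commutator G h z = \<one>"
    using p_group_central[OF V.is_subgroup V(3) p V(2)] by metis
  let ?Z = "{z \<in> V. \<forall>h\<in>V. h \<otimes> z = z \<otimes> h}"
  have "?Z \<lhd> G"
  proof (rule normal_invI)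
    have "?Z = {z \<in> V. \<forall>h\<in>V. commutator G h z \<in> {\<one>}}"
      using commutator_one_iff V.mem_carrier by (auto simp del: One_nat_def)
    also have "subgroup \<dots> G"
    proof (rule subgroup_centralizing_mod[OF V.is_subgroup triv_subgroup])
    qed auto
    finally show "subgroup ?Z G" .
    fix g u assume g: "g \<in> carrier G" and u: "u \<in> ?Z"
    have "h \<otimes> (g \<otimes> u \<otimes> inv g) = (g \<otimes> u \<otimes> inv g) \<otimes> h" if h: "h \<in> V" for h
    proof -
      let ?h = "inv g \<otimes> h \<otimes> g"
      have "?h \<in> V" using V.inv_op_closed1[OF g h] .
      then have "?h \<otimes> u = u \<otimes> ?h" using u by simp
      then have "g \<otimes> (?h \<otimes> u) \<otimes> inv g = g \<otimes> (u \<otimes> ?h) \<otimes> inv g" by simp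
      then show ?thesis using g h u by (simp add: word_simps)
    qed
    then show "g \<otimes> u \<otimes> inv g \<in> ?Z" using V.inv_op_closed2[OF g] u by simp
  qed
  moreover have "z \<in> ?Z" using z zc commutator_one_iff V.mem_carrier by simp
  then have "?Z \<noteq> {\<one>}" using z(2) by blast
  ultimately have "?Z = V" using min[of ?Z] by blast
  then show ?thesis using x y by blast
qed

text \<open>The elements of \<open>V\<close> with \<open>p\<close>-th power \<open>1\<close> form a nontrivial normal subgroup of \<open>G\<close>.\<close>

lemma chief_pair_one_exponent:
  assumes ch: "chief_pair p V {\<one>}" and x: "x \<in> V"
  shows "x [^] p = \<one>"
proof -
  obtain n where p: "prime p" and V: "V \<lhd> G" "V \<noteq> {\<one>}" "card V = p ^ n"
    and min: "\<And>K. \<lbrakk>K \<lhd> G; K \<subseteq> V\<rbrakk> \<Longrightarrow> K = {\<one>} \<or> K = V"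
    using chief_pair_oneE[OF ch] by metis
  interpret V: normal V G by (rule V)
  let ?P = "{x \<in> V. x [^] p = \<one>}"
  have "?P \<lhd> G"
  proof (rule normal_invI)
    show "subgroup ?P G"
    proof (rule subgroupI)
      show "?P \<subseteq> carrier G" using V.subset by blast
      have "\<one> \<in> ?P" by simp
      then show "?P \<noteq> {}" by blast
      show "inv a \<in> ?P" if "a \<in> ?P" for a using that by (simp add: nat_pow_inv)
      show "a \<otimes> b \<in> ?P" if "a \<in> ?P" "b \<in> ?P" for a b
        using that pow_mult_distrib[of a b p] chief_pair_one_abelian[OF ch, of a b] by simp
    qed
    show "g \<otimes> u \<otimes> inv g \<in> ?P" if "g \<in> carrier G" "u \<in> ?P" for g u
      using that conj_pow[of g u p] V.inv_op_closed2[of g u] by simp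
  qed
  moreover obtain z where z: "z \<in> V" "z \<noteq> \<one>" "z [^] p = \<one>"
    using p_group_central[OF V.is_subgroup V(3) p V(2)] by metis
  then have "?P \<noteq> {\<one>}" by blast
  ultimately have "?P = V" using min[of ?P] by blast
  then show ?thesis using x by blast
qed

end

context finite_group
begin

lemma chief_pair_Mod:
  assumes ch: "chief_pair p S T"
  shows "group.chief_pair (G Mod T) p ((\<lambda>s. T #> s) ` S) {\<one>\<^bsub>G Mod T\<^esub>}"
proof -
  obtain n where p: "prime p" and S: "S \<lhd> G" and T: "T \<lhd> G" and TS0: "T \<subseteq> S" "T \<noteq> S" and card: "card S = p ^ n"
    and min: "\<And>K. \<lbrakk>K \<lhd> G; T \<subseteq> K; K \<subseteq> S\<rbrakk> \<Longrightarrow> K = T \<or> K = S"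
    using chief_pairE[OF ch] by metis
  have TS: "T \<subset> S" using TS0 by blast
  interpret S: normal S G by (rule S)
  interpret T: normal T G by (rule T)
  let ?Q = "G Mod T" and ?h = "\<lambda>s. T #> s"
  interpret Q: finite_group ?Q by (rule finite_group_Mod[OF T])
  interpret h: group_hom G ?Q ?h by (rule T.group_hom_Mod)
  have surj: "?h ` carrier G = carrier ?Q" by (simp add: carrier_FactGroup)
  have N: "?h ` S \<lhd> ?Q" using S.surj_hom_normal_subgroup[OF h.group_hom_axioms surj] .
  have "\<one>\<^bsub>?Q\<^esub> \<in> ?h ` S" using N by (meson normal_imp_subgroup subgroup.one_closed)
  moreover have "?h ` S \<noteq> {\<one>\<^bsub>?Q\<^esub>}"
  proof
    assume eq: "?h ` S = {\<one>\<^bsub>?Q\<^esub>}"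
    obtain s where s: "s \<in> S" "s \<notin> T" using TS by blast
    then have "T #> s = T" using eq by auto
    then show False using T.Mod_eq_one_iff[of s] s by simp
  qed
  moreover have "\<exists>m. card (?h ` S) = p ^ m"
  proof -
    interpret SG: group "G\<lparr>carrier := S\<rparr>" using subgroup_imp_group[OF S.is_subgroup] .
    have TSs: "subgroup T (G\<lparr>carrier := S\<rparr>)"
      using subgroup_incl[OF T.is_subgroup S.is_subgroup] TS by blast
    have "?h ` S = rcosets\<^bsub>G\<lparr>carrier := S\<rparr>\<^esub> T" unfolding RCOSETS_def by auto
    then have "card (?h ` S) * card T = p ^ n" using SG.lagrange[OF TSs] card unfolding order_def by simp
    then have "card (?h ` S) dvd p ^ n" by (metis dvd_triv_left)
    then show ?thesis using divides_primepow_nat[OF p] by blast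
  qed
  moreover have "K = {\<one>\<^bsub>?Q\<^esub>} \<or> K = ?h ` S"
    if K: "K \<lhd> ?Q" and KS: "K \<subseteq> ?h ` S" for K
  proof -
    interpret K: normal K ?Q by (rule K)
    let ?P = "{g \<in> carrier G. ?h g \<in> K}"
    have P: "?P \<lhd> G" using normal_preimage_Mod[OF T K] .
    have TP: "T \<subseteq> ?P"
    proof
      fix t assume t: "t \<in> T"
      then have "?h t = T" using T.Mod_eq_one_iff[of t] by simp
      then show "t \<in> ?P" using t K.one_closed by simp
    qed
    have "?P \<subseteq> S"
    proof
      fix g assume g: "g \<in> ?P"
      then obtain s where s: "s \<in> S" "T #> g = T #> s" using KS by blast
      have "g \<in> T #> s" using rcos_self[OF _ T.is_subgroup, of g] g s(2) by simp
      then obtain t where "t \<in> T" "g = t \<otimes> s" unfolding r_coset_def by blast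
      then show "g \<in> S" using TS s(1) by blast
    qed
    then consider "?P = T" | "?P = S" using min[OF P TP] by blast
    moreover have Kim: "K = ?h ` ?P"
    proof
      show "K \<subseteq> ?h ` ?P"
      proof
        fix X assume X: "X \<in> K"
        then have "X \<in> ?h ` carrier G" using K.subset surj by blast
        then show "X \<in> ?h ` ?P" using X by blast
      qed
    qed blast
    ultimately show ?thesis
    proof cases
      case 1
      have "T #> t = T" if "t \<in> T" for t using T.Mod_eq_one_iff[of t] that by simp
      then have "?h ` T \<subseteq> {T}" by blast
      then have "K \<subseteq> {\<one>\<^bsub>?Q\<^esub>}" using Kim 1 by simp
      then show ?thesis using K.one_closed by blast
    next
      case 2 then show ?thesis using Kim by simp
    qed
  qed
  ultimately show ?thesis
    unfolding Q.chief_pair_def using p N Q.one_is_normal by (intro conjI) (simp_all add: psubset_eq)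
qed

end

section \<open>Groups whose normal r-subgroups have one subgroup of order r\<close>

context finite_group
begin

text \<open>The automorphisms of a cyclic group commute with each other.\<close>

lemma derived_centralizes_normal_cyclic:
  assumes R: "R \<lhd> G" and a: "a \<in> R" and pow: "\<And>b. b \<in> R \<Longrightarrow> \<exists>j::nat. b = a [^] j"
    and g: "g \<in> derived G (carrier G)" and b: "b \<in> R"
  shows "g \<otimes> b = b \<otimes> g"
proof -
  interpret R: normal R G by (rule R)
  have ac: "a \<in> carrier G" using a by simp
  let ?C = "{x \<in> carrier G. x \<otimes> a = a \<otimes> x}"
  have C: "subgroup ?C G" using subgroup_centralizer[OF subgroup_self ac] .
  have com: "(x \<otimes> y) \<otimes> a \<otimes> inv (x \<otimes> y) = (y \<otimes> x) \<otimes> a \<otimes> inv (y \<otimes> x)"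
    if x: "x \<in> carrier G" and y: "y \<in> carrier G" for x y
  proof -
    obtain i :: nat where i: "x \<otimes> a \<otimes> inv x = a [^] i" using pow R.inv_op_closed2[OF x a] by blast
    obtain j :: nat where j: "y \<otimes> a \<otimes> inv y = a [^] j" using pow R.inv_op_closed2[OF y a] by blast
    have "(x \<otimes> y) \<otimes> a \<otimes> inv (x \<otimes> y) = x \<otimes> (y \<otimes> a \<otimes> inv y) \<otimes> inv x"
      using x y ac by (simp add: word_simps)
    also have "\<dots> = a [^] (i * j)" unfolding j using conj_pow[OF x ac, of j] i ac by (simp add: nat_pow_pow)
    finally have 1: "(x \<otimes> y) \<otimes> a \<otimes> inv (x \<otimes> y) = a [^] (i * j)" .
    have "(y \<otimes> x) \<otimes> a \<otimes> inv (y \<otimes> x) = y \<otimes> (x \<otimes> a \<otimes> inv x) \<otimes> inv y"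
      using x y ac by (simp add: word_simps)
    also have "\<dots> = a [^] (j * i)" unfolding i using conj_pow[OF y ac, of i] j ac by (simp add: nat_pow_pow)
    finally show ?thesis using 1 by (simp add: mult.commute)
  qed
  have "derived_set G (carrier G) \<subseteq> ?C"
  proof
    fix c assume "c \<in> derived_set G (carrier G)"
    then obtain x y where xy: "x \<in> carrier G" "y \<in> carrier G" "c = commutator G x y" by blast
    have "inv (inv y \<otimes> inv x) \<otimes> (inv x \<otimes> inv y) \<otimes> a = a \<otimes> (inv (inv y \<otimes> inv x) \<otimes> (inv x \<otimes> inv y))"
      using com[of "inv x" "inv y"] xy ac by (intro conj_eq_imp_commute) simp_all
    moreover have "inv (inv y \<otimes> inv x) \<otimes> (inv x \<otimes> inv y) = c" using xy by (simp add: word_simps)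
    ultimately show "c \<in> ?C" using xy by simp
  qed
  then have "derived G (carrier G) \<subseteq> ?C"
    unfolding derived_def by (rule generate_subgroup_incl[OF _ C])
  then have gc: "g \<in> carrier G" "g \<otimes> a = a \<otimes> g" using g by blast+
  obtain j :: nat where "b = a [^] j" using pow b by blast
  then show ?thesis using group_commutes_pow[of a g j] gc ac by simp
qed

lemma derived_derived_centralizes_small_factor:
  assumes S: "S \<lhd> G" and T: "T \<lhd> G" and card: "card ((\<lambda>s. T #> s) ` S) \<le> 4"
  shows "centralizes_factor (derived G (derived G (carrier G))) S T"
proof -
  interpret S: normal S G by (rule S)
  interpret T: normal T G by (rule T)
  let ?Q = "G Mod T" and ?h = "\<lambda>s. T #> s"
  interpret Q: finite_group ?Q by (rule finite_group_Mod[OF T])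
  interpret h: group_hom G ?Q ?h by (rule T.group_hom_Mod)
  have surj: "?h ` carrier G = carrier ?Q" by (simp add: carrier_FactGroup)
  have N: "?h ` S \<lhd> ?Q" using S.surj_hom_normal_subgroup[OF h.group_hom_axioms surj] .
  have D: "?h ` derived G (derived G (carrier G)) = derived ?Q (derived ?Q (carrier ?Q))"
    using h.derived_img[OF derived_in_carrier[OF subset_refl]] h.derived_img[OF subset_refl] surj by metis
  show ?thesis
    unfolding centralizes_factor_def
  proof (intro ballI)
    fix l s assume l: "l \<in> derived G (derived G (carrier G))" and s: "s \<in> S"
    have lc: "l \<in> carrier G" using l derived_in_carrier[OF derived_in_carrier[OF subset_refl]] by blast
    have "?h l \<in> derived ?Q (derived ?Q (carrier ?Q))" using l D by blast
    then have "?h l \<otimes>\<^bsub>?Q\<^esub> ?h s = ?h s \<otimes>\<^bsub>?Q\<^esub> ?h l"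
      using Q.derived_derived_centralizes_card_le_four[OF N card] s by blast
    then show "commutator G l s \<in> T" using T.commute_Mod_iff[OF lc, of s] s by simp
  qed
qed

text \<open>The factor has exponent two, and a cyclic subgroup of index at most two has an image of order at most two.\<close>

lemma unique_involution_factor_card:
  assumes ch: "chief_pair 2 R T" and uniq: "unique_prime_subgroup 2 R"
  shows "card ((\<lambda>s. T #> s) ` R) \<le> 4"
proof -
  obtain n where R: "R \<lhd> G" and T: "T \<lhd> G" and card: "card R = 2 ^ n"
    using chief_pairE[OF ch] by metis
  interpret R: normal R G by (rule R)
  interpret T: normal T G by (rule T)
  let ?Q = "G Mod T" and ?h = "\<lambda>s. T #> s"
  interpret Q: finite_group ?Q by (rule finite_group_Mod[OF T])
  interpret h: group_hom G ?Q ?h by (rule T.group_hom_Mod)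
  obtain a where a: "a \<in> R"
    and ind: "\<And>x y. \<lbrakk>x \<in> R; y \<in> R; x \<notin> generate G {a}; y \<notin> generate G {a}\<rbrakk> \<Longrightarrow> x \<otimes> y \<in> generate G {a}"
    using unique_involution_cyclic_index_two[OF R.is_subgroup card uniq] by metis
  have ac: "a \<in> carrier G" using a by simp
  note mult_FactGroup [simp del] one_FactGroup [simp del]
  have sq: "?h x \<otimes>\<^bsub>?Q\<^esub> ?h x = \<one>\<^bsub>?Q\<^esub>" if "x \<in> R" for x
  proof -
    have "?h x [^]\<^bsub>?Q\<^esub> (2::nat) = \<one>\<^bsub>?Q\<^esub>"
      using Q.chief_pair_one_exponent[OF chief_pair_Mod[OF ch]] that by blast
    then show ?thesis using Q.l_one[OF h.hom_closed[of x]] that by (simp add: numeral_2_eq_2)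
  qed
  have apow: "?h x \<in> {\<one>\<^bsub>?Q\<^esub>, ?h a}" if x: "x \<in> generate G {a}" for x
  proof -
    obtain j :: nat where j: "x = a [^] j" using x mem_generate_singleton[OF ac, of x] by blast
    have "?h (a [^] i) \<in> {\<one>\<^bsub>?Q\<^esub>, ?h a}" for i :: nat
    proof (induction i)
      case 0 then show ?case using h.hom_one by simp
    next
      case (Suc i)
      have "?h (a [^] Suc i) = ?h (a [^] i) \<otimes>\<^bsub>?Q\<^esub> ?h a"
        using h.hom_mult[of "a [^] i" a] ac by simp
      then show ?case using Suc sq[OF a] Q.l_one[OF h.hom_closed[OF ac]] by (elim insertE) simp_all
    qed
    then show ?thesis using j by blast
  qed
  show ?thesis
  proof (cases "R \<subseteq> generate G {a}")
    case True
    then have "?h ` R \<subseteq> {\<one>\<^bsub>?Q\<^esub>, ?h a}" using apow by blast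
    then have "card (?h ` R) \<le> card {\<one>\<^bsub>?Q\<^esub>, ?h a}" by (intro card_mono) simp_all
    also have "\<dots> \<le> 2" by (simp add: card_insert_if)
    finally show ?thesis by simp
  next
    case False
    then obtain b where b: "b \<in> R" "b \<notin> generate G {a}" by blast
    have bc: "b \<in> carrier G" using b by simp
    let ?X = "{\<one>\<^bsub>?Q\<^esub>, ?h a, ?h b, ?h a \<otimes>\<^bsub>?Q\<^esub> ?h b}"
    have "?h x \<in> ?X" if x: "x \<in> R" for x
    proof (cases "x \<in> generate G {a}")
      case True then show ?thesis using apow by blast
    next
      case False
      have xc: "x \<in> carrier G" using x by simp
      have "?h (x \<otimes> b) \<in> {\<one>\<^bsub>?Q\<^esub>, ?h a}" using apow ind[OF x b(1) False b(2)] by blast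
      then have "?h x \<otimes>\<^bsub>?Q\<^esub> ?h b \<in> {\<one>\<^bsub>?Q\<^esub>, ?h a}" using h.hom_mult[OF xc bc] by simp
      moreover have "?h x = (?h x \<otimes>\<^bsub>?Q\<^esub> ?h b) \<otimes>\<^bsub>?Q\<^esub> ?h b"
        using sq[OF b(1)] Q.m_assoc[OF h.hom_closed[OF xc] h.hom_closed[OF bc] h.hom_closed[OF bc]]
          Q.r_one[OF h.hom_closed[OF xc]] by metis
      ultimately show ?thesis using Q.l_one[OF h.hom_closed[OF bc]] by (metis insertE insertI1 insertI2 singletonD)
    qed
    then have "?h ` R \<subseteq> ?X" by blast
    then have "card (?h ` R) \<le> card ?X" by (intro card_mono) simp_all
    also have "\<dots> = card (set [\<one>\<^bsub>?Q\<^esub>, ?h a, ?h b, ?h a \<otimes>\<^bsub>?Q\<^esub> ?h b])" by simp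
    also have "\<dots> \<le> length [\<one>\<^bsub>?Q\<^esub>, ?h a, ?h b, ?h a \<otimes>\<^bsub>?Q\<^esub> ?h b]" by (rule card_length)
    finally show ?thesis by simp
  qed
qed

text \<open>The Sylow subgroups of \<open>M\<close> for odd primes are central, so \<open>M\<close> is the product of its Sylow
  2-subgroup \<open>S\<close> and its centre \<open>Z\<close>, and factors from \<open>Z\<close> cancel in commutators.\<close>

lemma derived_le_derived_sylow_two:
  assumes M: "M \<lhd> G" and nil: "nilpotent_group (G\<lparr>carrier := M\<rparr>)"
    and central: "\<And>r R m x g. \<lbrakk>prime r; r \<noteq> 2; R \<lhd> G; R \<subseteq> M; card R = r ^ m; x \<in> R; g \<in> M\<rbrakk> \<Longrightarrow> g \<otimes> x = x \<otimes> g"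
  obtains S b where "S \<lhd> G" "S \<subseteq> M" "card S = 2 ^ b" "derived G M \<subseteq> derived G S"
proof -
  interpret M: normal M G by (rule M)
  obtain S b m where S: "S \<lhd> G" "S \<subseteq> M" "card S = 2 ^ b" "card M = 2 ^ b * m" "\<not> 2 dvd m"
    using normal_sylow_of_nilpotent[OF M nil two_is_prime_nat] .
  interpret S: normal S G by (rule S)
  define Z where "Z = {z \<in> M. \<forall>h\<in>M. commutator G h z \<in> {\<one>}}"
  have Z: "subgroup Z G"
    unfolding Z_def
  proof (rule subgroup_centralizing_mod[OF M.is_subgroup triv_subgroup])
  qed auto
  interpret Z: subgroup Z G by (rule Z)
  have Zcomm: "h \<otimes> z = z \<otimes> h" if "z \<in> Z" "h \<in> M" for z h
    using that commutator_one_iff[of h z] unfolding Z_def by simp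
  have ZM: "Z \<subseteq> M" unfolding Z_def by blast
  have SZ: "subgroup (S <#> Z) G"
  proof -
    interpret second_isomorphism_grp S G Z
      by (intro second_isomorphism_grp.intro second_isomorphism_grp_axioms.intro S(1) Z)
    show ?thesis by (rule normal_set_mult_subgroup)
  qed
  have sub: "S \<subseteq> S <#> Z" "Z \<subseteq> S <#> Z" "S <#> Z \<subseteq> M"
  proof -
    show "S \<subseteq> S <#> Z" "Z \<subseteq> S <#> Z" using set_mult_upper[OF S.is_subgroup Z] .
    show "S <#> Z \<subseteq> M" unfolding set_mult_def using S(2) ZM by blast
  qed
  obtain q where q: "card M = card (S <#> Z) * q"
    using card_subgroup_dvd[OF SZ M.is_subgroup sub(3)] by (metis dvd_def)
  (* The product of S and Z contains a full Sylow subgroup of M for every prime. *)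
  have "q = 1"
  proof (rule ccontr)
    assume "q \<noteq> 1"
    then obtain r where r: "prime r" "r dvd q" using prime_factor_nat by blast
    have "\<exists>R a m. subgroup R G \<and> R \<subseteq> S <#> Z \<and> card R = r ^ a \<and> card M = r ^ a * m \<and> \<not> r dvd m"
    proof (cases "r = 2")
      case True then show ?thesis using S S.is_subgroup sub(1) by blast
    next
      case False
      obtain R a m where R: "R \<lhd> G" "R \<subseteq> M" "card R = r ^ a" "card M = r ^ a * m" "\<not> r dvd m"
        using normal_sylow_of_nilpotent[OF M nil r(1)] .
      have "R \<subseteq> Z"
      proof
        fix x assume x: "x \<in> R"
        have "commutator G h x = \<one>" if h: "h \<in> M" for h
        proof -
          have "x \<in> carrier G" "h \<in> carrier G" using x h R(2) by auto
          then show ?thesis using central[OF r(1) False R(1-3) x h] commutator_one_iff[of h x] by blast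
        qed
        then show "x \<in> Z" unfolding Z_def using x R(2) by blast
      qed
      then show ?thesis using R sub(2) normal_imp_subgroup by blast
    qed
    then obtain R a m where R: "subgroup R G" "R \<subseteq> S <#> Z" "card R = r ^ a" "card M = r ^ a * m" "\<not> r dvd m"
      by blast
    obtain c where c: "card (S <#> Z) = card R * c" using card_subgroup_dvd[OF R(1) SZ R(2)] by (metis dvd_def)
    have "r ^ a * (c * q) = r ^ a * m" using q c R(3,4) by (metis mult.assoc)
    moreover have "r ^ a \<noteq> 0" using prime_gt_0_nat[OF r(1)] by simp
    ultimately have "c * q = m" by (metis mult_left_cancel)
    then show False using r(2) R(5) by (metis dvd_mult)
  qed
  then have "card (S <#> Z) = card M" using q by simp
  then have MSZ: "S <#> Z = M" using sub(3) card_subset_eq finite_subgroup[OF M.is_subgroup] by blast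
  have "derived_set G M \<subseteq> derived_set G S"
  proof
    fix x assume "x \<in> derived_set G M"
    then obtain g h where gh: "g \<in> M" "h \<in> M" "x = commutator G g h" by blast
    obtain s z where s: "s \<in> S" "z \<in> Z" "g = s \<otimes> z" using gh(1) MSZ unfolding set_mult_def by blast
    obtain t w where t: "t \<in> S" "w \<in> Z" "h = t \<otimes> w" using gh(2) MSZ unfolding set_mult_def by blast
    have "x = s \<otimes> (z \<otimes> h) \<otimes> inv z \<otimes> inv s \<otimes> inv h"
      using gh(3) s t by (simp add: inv_mult_group m_assoc)
    also have "z \<otimes> h = h \<otimes> z" using Zcomm[OF s(2) gh(2)] by simp
    finally have "x = s \<otimes> h \<otimes> inv s \<otimes> inv h" using s t gh(2) by (simp add: m_assoc)
    also have "\<dots> = s \<otimes> t \<otimes> (w \<otimes> inv s) \<otimes> inv w \<otimes> inv t"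
      using s t by (simp add: inv_mult_group m_assoc)
    also have "w \<otimes> inv s = inv s \<otimes> w" using Zcomm[OF t(2), of "inv s"] s S(2) by auto
    finally have "x = commutator G s t" using s t by (simp add: m_assoc)
    then show "x \<in> derived_set G S" using s t by blast
  qed
  then have "derived G M \<subseteq> derived G S" unfolding derived_def by (rule mono_generate)
  then show thesis using that S by blast
qed

text \<open>A normal subgroup of odd prime power order is cyclic, so \<open>D1\<close> centralizes it. The chief factors in
  normal 2-subgroups have order at most four, so \<open>D2\<close> centralizes them. Thus \<open>D2\<close> centralizes all
  chief factors and is nilpotent, its Sylow subgroups of odd order are central in it, and its Sylow
  2-subgroup is metabelian. In a group of odd order the same reasoning applies to \<open>D1\<close>.\<close>

lemma derived_length_four_if_unique_prime_subgroups:
  assumes solv: "(derived G ^^ n) (carrier G) = {\<one>}" and p: "prime p"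
    and Op: "\<And>P m. \<lbrakk>P \<lhd> G; card P = p ^ m\<rbrakk> \<Longrightarrow> P = {\<one>}"
    and uq: "\<And>r R m. \<lbrakk>prime r; r \<noteq> p; R \<lhd> G; card R = r ^ m\<rbrakk> \<Longrightarrow> unique_prime_subgroup r R"
  defines "D1 \<equiv> derived G (carrier G)"
  defines "D2 \<equiv> derived G D1"
  shows "nilpotent_group (G\<lparr>carrier := D2\<rparr>)" "derived G (derived G D2) = {\<one>}"
    "odd (order G) \<Longrightarrow> D2 = {\<one>}"
proof -
  have uq': "unique_prime_subgroup r R" if "prime r" "R \<lhd> G" "card R = r ^ m" for r R m
  proof (cases "r = p")
    case True
    then have "R = {\<one>}" using Op that by blast
    then show ?thesis unfolding unique_prime_subgroup_def by (metis nat_pow_0 singletonD)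
  next
    case False then show ?thesis using uq that by blast
  qed
  have D1: "D1 \<lhd> G" unfolding D1_def by (rule derived_self_is_normal)
  have D2: "D2 \<lhd> G" unfolding D2_def using derived_is_normal[OF D1] .
  have D21: "D2 \<subseteq> D1" unfolding D2_def using derived_incl[OF subset_refl normal_imp_subgroup[OF D1]] .
  have D1c: "D1 \<subseteq> carrier G" using subgroup.subset[OF normal_imp_subgroup[OF D1]] .
  have cent_odd: "g \<otimes> x = x \<otimes> g" if r: "prime r" "r \<noteq> 2" and R: "R \<lhd> G" "card R = r ^ m" and x: "x \<in> R" and g: "g \<in> D1"
    for r R m x g
  proof -
    obtain a where "a \<in> R" "\<And>b. b \<in> R \<Longrightarrow> \<exists>j::nat. b = a [^] j"
      using unique_prime_subgroup_cyclic[OF normal_imp_subgroup[OF R(1)] R(2) r(1) uq'[OF r(1) R]] r(2) by blast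
    then show ?thesis using derived_centralizes_normal_cyclic[OF R(1) _ _ _ x] g unfolding D1_def by blast
  qed
  have chief_odd: "centralizes_factor D1 R T" if ch: "chief_pair r R T" and r2: "r \<noteq> 2" for r R T
  proof -
    obtain m where r: "prime r" and R: "R \<lhd> G" and T: "T \<lhd> G" and card: "card R = r ^ m"
      using chief_pairE[OF ch] by metis
    have "commutator G g x \<in> T" if "g \<in> D1" "x \<in> R" for g x
    proof -
      have "g \<in> carrier G" "x \<in> carrier G"
        using that D1c subgroup.mem_carrier[OF normal_imp_subgroup[OF R]] by blast+
      then have "commutator G g x = \<one>"
        using cent_odd[OF r r2 R card that(2,1)] commutator_one_iff by blast
      then show ?thesis using subgroup.one_closed[OF normal_imp_subgroup[OF T]] by simp
    qed
    then show ?thesis unfolding centralizes_factor_def by blast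
  qed
  have solvD: "(derived G ^^ n) D = {\<one>}" if "D \<lhd> G" for D
  proof -
    have "subgroup D G" using normal_imp_subgroup[OF that] .
    then have "(derived G ^^ n) D \<subseteq> {\<one>}" "\<one> \<in> (derived G ^^ n) D"
      using mono_exp_of_derived[OF subgroup.subset, of D G n] solv
        subgroup.one_closed[OF exp_of_derived_is_subgroup] by auto
    then show ?thesis by blast
  qed
  have "\<forall>r R T. chief_pair r R T \<longrightarrow> centralizes_factor D2 R T"
  proof (intro allI impI)
    fix r R T assume ch: "chief_pair r R T"
    show "centralizes_factor D2 R T"
    proof (cases "r = 2")
      case True
      obtain m where R: "R \<lhd> G" and T: "T \<lhd> G" and card: "card R = r ^ m" and r: "prime r"
        using chief_pairE[OF ch] by metis
      have "card ((\<lambda>s. T #> s) ` R) \<le> 4"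
        using unique_involution_factor_card[of R T] ch uq'[OF r R card] True by blast
      then show ?thesis
        using derived_derived_centralizes_small_factor[OF R T] unfolding D2_def D1_def by blast
    next
      case False
      then show ?thesis using chief_odd[OF ch] D21 unfolding centralizes_factor_def by blast
    qed
  qed
  then show nil: "nilpotent_group (G\<lparr>carrier := D2\<rparr>)"
    using nilpotent_if_centralizes_chief_pairs[OF D2 solvD[OF D2]] by blast
  obtain S b where S: "S \<lhd> G" "card S = 2 ^ b" "derived G D2 \<subseteq> derived G S"
    using derived_le_derived_sylow_two[OF D2 nil] cent_odd D21 by (metis subsetD)
  have "derived G (derived G D2) \<subseteq> derived G (derived G S)" using mono_derived[OF S(3)] .
  also have "\<dots> = {\<one>}"
    using unique_involution_metabelian[OF normal_imp_subgroup[OF S(1)] S(2)] uq'[OF two_is_prime_nat S(1,2)] by blast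
  finally have "derived G (derived G D2) \<subseteq> {\<one>}" .
  moreover have "D2 \<subseteq> carrier G" using D21 D1c by blast
  then have "\<one> \<in> derived G (derived G D2)"
    using subgroup.one_closed[OF derived_is_subgroup[OF derived_in_carrier]] by blast
  ultimately show "derived G (derived G D2) = {\<one>}" by blast
  show "D2 = {\<one>}" if odd: "odd (order G)"
  proof -
    have odd_card: "odd (card R)" if "subgroup R G" for R
      using card_subgroup_dvd[OF that subgroup_self subgroup.subset[OF that]] odd dvd_trans unfolding order_def by blast
    have "\<forall>r R T. chief_pair r R T \<longrightarrow> centralizes_factor D1 R T"
    proof (intro allI impI)
      fix r R T assume ch: "chief_pair r R T"
      obtain m where R: "R \<lhd> G" and T: "T \<lhd> G" "T \<subseteq> R" "T \<noteq> R" and card: "card R = r ^ m"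
        using chief_pairE[OF ch] by metis
      have "r \<noteq> 2"
      proof
        assume "r = 2"
        then have "m = 0" using odd_card[OF normal_imp_subgroup[OF R]] card by simp
        then have "card R = 1" using card by simp
        then obtain u where "R = {u}" using card_1_singletonE by blast
        then show False using T subgroup.one_closed[OF normal_imp_subgroup[OF T(1)]] by blast
      qed
      then show "centralizes_factor D1 R T" using chief_odd[OF ch] by blast
    qed
    then have nil1: "nilpotent_group (G\<lparr>carrier := D1\<rparr>)"
      using nilpotent_if_centralizes_chief_pairs[OF D1 solvD[OF D1]] by blast
    obtain S b where S: "S \<lhd> G" "card S = 2 ^ b" "derived G D1 \<subseteq> derived G S"
      using derived_le_derived_sylow_two[OF D1 nil1] cent_odd by metis
    have "b = 0" using odd_card[OF normal_imp_subgroup[OF S(1)]] S(2) by simp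
    then have "card S = 1" using S(2) by simp
    then obtain u where u: "S = {u}" using card_1_singletonE by blast
    then have "S = {\<one>}" using subgroup.one_closed[OF normal_imp_subgroup[OF S(1)]] by blast
    then have "derived G S = {\<one>}" using derived_trivial_if_commuting[of S] by simp
    then have "D2 \<subseteq> {\<one>}" using S(3) unfolding D2_def by blast
    then show ?thesis using subgroup.one_closed[OF normal_imp_subgroup[OF D2]] by blast
  qed
qed

end

section \<open>Fixed-point-free action on a minimal normal subgroup\<close>

lemma (in comm_group) finprod_endomorphism:
  assumes phi: "\<phi> \<in> hom G G" and "finite A" "f \<in> A \<rightarrow> carrier G"
  shows "\<phi> (finprod G f A) = finprod G (\<lambda>i. \<phi> (f i)) A"
  using assms(2,3)
proof (induction A rule: finite_induct)
  case empty
  then show ?case using hom_one[OF phi is_group is_group] by simp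
next
  case (insert a A)
  have f: "f \<in> A \<rightarrow> carrier G" "f a \<in> carrier G" using insert.prems by auto
  have "(\<lambda>i. \<phi> (f i)) \<in> A \<rightarrow> carrier G" "\<phi> (f a) \<in> carrier G"
    using f hom_in_carrier[OF phi] by auto
  then show ?case
    using insert.hyps insert.IH[OF f(1)] f hom_mult[OF phi f(2) finprod_closed[OF f(1)]] by simp
qed

lemma (in comm_group) finprod_swap:
  assumes "finite A" "\<And>i j. \<lbrakk>i \<in> A; j \<in> B\<rbrakk> \<Longrightarrow> f i j \<in> carrier G"
  shows "finprod G (\<lambda>i. finprod G (f i) B) A = finprod G (\<lambda>j. finprod G (\<lambda>i. f i j) A) B"
  using assms
proof (induction A rule: finite_induct)
  case empty
  then show ?case by simp
next
  case (insert a A)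
  have 1: "finprod G (f i) B \<in> carrier G" if "i \<in> insert a A" for i
    using insert.prems that by (intro finprod_closed) blast
  have 2: "finprod G (\<lambda>i. f i j) A \<in> carrier G" if "j \<in> B" for j
    using insert.prems that by (intro finprod_closed) blast
  have "finprod G (\<lambda>i. finprod G (f i) B) (insert a A) = finprod G (f a) B \<otimes> finprod G (\<lambda>i. finprod G (f i) B) A"
    using insert.hyps 1 by (intro finprod_insert) auto
  also have "finprod G (\<lambda>i. finprod G (f i) B) A = finprod G (\<lambda>j. finprod G (\<lambda>i. f i j) A) B"
    using insert by blast
  also have "finprod G (f a) B \<otimes> \<dots> = finprod G (\<lambda>j. f a j \<otimes> finprod G (\<lambda>i. f i j) A) B"
    using insert.prems 2 by (intro finprod_multf[symmetric]) auto
  also have "\<dots> = finprod G (\<lambda>j. finprod G (\<lambda>i. f i j) (insert a A)) B"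
  proof (rule finprod_cong'[OF refl])
    show "(\<lambda>j. finprod G (\<lambda>i. f i j) (insert a A)) \<in> B \<rightarrow> carrier G"
      using insert.prems by (intro funcsetI finprod_closed) blast
    show "f a j \<otimes> finprod G (\<lambda>i. f i j) A = finprod G (\<lambda>i. f i j) (insert a A)" if "j \<in> B" for j
      using insert.hyps insert.prems that by (intro finprod_insert[symmetric]) auto
  qed
  finally show ?case .
qed

lemma (in group) funpow_endomorphism: "\<phi> \<in> hom G G \<Longrightarrow> (\<phi> ^^ i) \<in> hom G G"
proof (induction i)
  case 0 then show ?case using id_iso[of G] iso_imp_homomorphism by (simp add: id_def)
next
  case (Suc i) then show ?case using Group.hom_compose[of "\<phi> ^^ i" G G \<phi> G] by (simp add: comp_def)
qed

text \<open>The map \<open>\<phi>\<close> permutes the factors cyclically, so it fixes their product.\<close>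

lemma (in comm_group) finprod_orbit_trivial:
  assumes phi: "\<phi> \<in> hom G G" and v: "v \<in> carrier G" and per: "(\<phi> ^^ r) v = v" and r: "r > 0"
    and fpf: "\<And>w. \<lbrakk>w \<in> carrier G; \<phi> w = w\<rbrakk> \<Longrightarrow> w = \<one>"
  shows "finprod G (\<lambda>i. (\<phi> ^^ i) v) {..<r} = \<one>"
proof -
  let ?f = "\<lambda>i. (\<phi> ^^ i) v"
  have f: "?f i \<in> carrier G" for i using hom_in_carrier[OF funpow_endomorphism[OF phi] v] .
  obtain m where m: "r = Suc m" using r gr0_implies_Suc by blast
  have set: "{..<r} = {..m}" using m lessThan_Suc_atMost by simp
  let ?N = "finprod G ?f {..m}"
  have N: "?N \<in> carrier G" using f by simp
  have "\<phi> ?N \<otimes> v = finprod G (\<lambda>i. ?f (Suc i)) {..m} \<otimes> ?f 0"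
    using finprod_endomorphism[OF phi, of "{..m}" ?f] f by simp
  also have "\<dots> = finprod G ?f {..Suc m}" using f by (intro finprod_Suc2[symmetric]) auto
  also have "\<dots> = ?f (Suc m) \<otimes> ?N" using f by (intro finprod_Suc) auto
  also have "\<dots> = ?N \<otimes> v" using per m N v m_comm by simp
  finally have "\<phi> ?N = ?N" using N v hom_in_carrier[OF phi N] by simp
  then show ?thesis using fpf[OF N] set by simp
qed

text \<open>For each \<open>j < r\<close> the product of the orbit of \<open>v\<close> under \<open>\<lambda>w. \<alpha> ((\<beta> ^^ j) w)\<close> is trivial. Multiply these
  \<open>r\<close> products and collect the factors with the same power \<open>\<alpha> ^^ i\<close>. For \<open>i > 0\<close> they are the
  image under \<open>\<alpha> ^^ i\<close> of the orbit product of \<open>v\<close> under \<open>\<beta> ^^ i\<close>, which is trivial too, and for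
  \<open>i = 0\<close> they are \<open>r\<close> copies of \<open>v\<close>.\<close>

lemma (in comm_group) fixed_point_free_rank_two:
  assumes alpha: "\<alpha> \<in> hom G G" and beta: "\<beta> \<in> hom G G"
    and comm: "\<And>w. w \<in> carrier G \<Longrightarrow> \<alpha> (\<beta> w) = \<beta> (\<alpha> w)"
    and alpha_r: "\<And>w. w \<in> carrier G \<Longrightarrow> (\<alpha> ^^ r) w = w"
    and beta_r: "\<And>w. w \<in> carrier G \<Longrightarrow> (\<beta> ^^ r) w = w"
    and fpf1: "\<And>j w. \<lbrakk>j < r; w \<in> carrier G; \<alpha> ((\<beta> ^^ j) w) = w\<rbrakk> \<Longrightarrow> w = \<one>"
    and fpf2: "\<And>i w. \<lbrakk>0 < i; i < r; w \<in> carrier G; (\<beta> ^^ i) w = w\<rbrakk> \<Longrightarrow> w = \<one>"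
    and r: "r > 0" and v: "v \<in> carrier G"
  shows "v [^] r = \<one>"
proof -
  have ac: "(\<alpha> ^^ i) w \<in> carrier G" and bc: "(\<beta> ^^ i) w \<in> carrier G" if "w \<in> carrier G" for i w
    using hom_in_carrier[OF funpow_endomorphism[OF alpha] that] hom_in_carrier[OF funpow_endomorphism[OF beta] that] .
  have c1: "\<beta> ((\<alpha> ^^ i) w) = (\<alpha> ^^ i) (\<beta> w)" if "w \<in> carrier G" for i w
    using that by (induction i) (simp_all add: comm[symmetric] ac)
  have c2: "(\<beta> ^^ j) ((\<alpha> ^^ i) w) = (\<alpha> ^^ i) ((\<beta> ^^ j) w)" if "w \<in> carrier G" for i j w
    using that by (induction j) (simp_all add: c1 bc)
  have beta_rj: "(\<beta> ^^ (j * r)) w = w" if "w \<in> carrier G" for j w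
  proof (induction j)
    case (Suc j)
    have "(\<beta> ^^ (Suc j * r)) w = (\<beta> ^^ r) ((\<beta> ^^ (j * r)) w)" by (simp add: funpow_add)
    then show ?case using Suc beta_r that by simp
  qed simp
  have pow: "((\<lambda>w. \<alpha> ((\<beta> ^^ j) w)) ^^ i) w = (\<alpha> ^^ i) ((\<beta> ^^ (j * i)) w)" if w: "w \<in> carrier G" for i j w
  proof (induction i)
    case (Suc i)
    have "((\<lambda>w. \<alpha> ((\<beta> ^^ j) w)) ^^ Suc i) w = \<alpha> ((\<beta> ^^ j) ((\<alpha> ^^ i) ((\<beta> ^^ (j * i)) w)))"
      using Suc by simp
    also have "\<dots> = \<alpha> ((\<alpha> ^^ i) ((\<beta> ^^ j) ((\<beta> ^^ (j * i)) w)))" using c2 bc[OF w] by simp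
    also have "\<dots> = (\<alpha> ^^ Suc i) ((\<beta> ^^ (j * Suc i)) w)" by (simp add: funpow_add)
    finally show ?case .
  qed simp
  have row: "finprod G (\<lambda>i. (\<alpha> ^^ i) ((\<beta> ^^ (j * i)) v)) {..<r} = \<one>" if j: "j < r" for j
  proof -
    let ?p = "\<lambda>w. \<alpha> ((\<beta> ^^ j) w)"
    have "?p \<in> hom G G"
      using Group.hom_compose[OF funpow_endomorphism[OF beta, of j] alpha] by (simp add: comp_def)
    moreover have "(?p ^^ r) v = v" using pow[OF v] beta_rj[OF v] alpha_r[OF v] by simp
    ultimately have "finprod G (\<lambda>i. (?p ^^ i) v) {..<r} = \<one>"
      using finprod_orbit_trivial[OF _ v _ r] fpf1[OF j] by blast
    then show ?thesis using pow[OF v] by simp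
  qed
  have column: "finprod G (\<lambda>j. (\<alpha> ^^ i) ((\<beta> ^^ (j * i)) v)) {..<r} = (if 0 = i then v [^] r else \<one>)"
    if i: "i < r" for i
  proof (cases "i = 0")
    case True then show ?thesis using finprod_const[OF v, of "{..<r}"] by simp
  next
    case False
    have "finprod G (\<lambda>j. (\<alpha> ^^ i) ((\<beta> ^^ (j * i)) v)) {..<r}
        = (\<alpha> ^^ i) (finprod G (\<lambda>j. (\<beta> ^^ (j * i)) v) {..<r})"
      using bc[OF v] by (intro finprod_endomorphism[OF funpow_endomorphism[OF alpha], symmetric]) auto
    also have "finprod G (\<lambda>j. (\<beta> ^^ (j * i)) v) {..<r} = finprod G (\<lambda>j. ((\<beta> ^^ i) ^^ j) v) {..<r}"
      by (simp add: funpow_mult mult.commute)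
    also have "\<dots> = \<one>"
    proof (rule finprod_orbit_trivial[OF funpow_endomorphism[OF beta] v _ r])
      show "((\<beta> ^^ i) ^^ r) v = v" using beta_rj[OF v, of i] by (simp add: funpow_mult)
    qed (use fpf2 i False in blast)
    also have "(\<alpha> ^^ i) \<one> = \<one>"
      using hom_one[OF funpow_endomorphism[OF alpha] is_group is_group] .
    finally show ?thesis using False by simp
  qed
  have "\<one> = finprod G (\<lambda>j. finprod G (\<lambda>i. (\<alpha> ^^ i) ((\<beta> ^^ (j * i)) v)) {..<r}) {..<r}"
    using row by (intro finprod_one_eqI[symmetric]) simp
  also have "\<dots> = finprod G (\<lambda>i. finprod G (\<lambda>j. (\<alpha> ^^ i) ((\<beta> ^^ (j * i)) v)) {..<r}) {..<r}"
    using ac bc v by (intro finprod_swap) auto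
  also have "\<dots> = finprod G (\<lambda>i. if 0 = i then v [^] r else \<one>) {..<r}"
    using column v by (intro finprod_cong'[OF refl]) auto
  also have "\<dots> = v [^] r"
    using finprod_singleton[of 0 "{..<r}" "\<lambda>_. v [^] r"] r v by simp
  finally show ?thesis by simp
qed

locale automorphism_action = finite_group G + W: comm_group W for G (structure) and W +
  fixes \<rho>
  assumes act_hom: "x \<in> carrier G \<Longrightarrow> \<rho> x \<in> hom W W"
    and act_one: "w \<in> carrier W \<Longrightarrow> \<rho> \<one> w = w"
    and act_mult: "\<lbrakk>x \<in> carrier G; y \<in> carrier G; w \<in> carrier W\<rbrakk> \<Longrightarrow> \<rho> (x \<otimes> y) w = \<rho> x (\<rho> y w)"
begin

lemma act_pow:
  assumes x: "x \<in> carrier G" and w: "w \<in> carrier W"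
  shows "(\<rho> x ^^ i) w = \<rho> (x [^] i) w"
proof (induction i)
  case 0 then show ?case using act_one[OF w] by simp
next
  case (Suc i)
  have "\<rho> (x [^] Suc i) w = \<rho> (x \<otimes> x [^] i) w" using nat_pow_Suc2[OF x, of i] by simp
  then show ?case using act_mult[OF x nat_pow_closed[OF x] w] Suc by simp
qed

text \<open>Let \<open>z\<close> be a central element of order \<open>r\<close> in \<open>R\<close>. An element \<open>x\<close> of order \<open>r\<close> that is not a
  power of \<open>z\<close> generates with \<open>z\<close> a group of order \<open>r * r\<close>, which would act on \<open>W\<close> without
  fixed points.\<close>

lemma unique_prime_subgroup_if_fixed_point_free:
  assumes r: "prime r" and R: "subgroup R G" "card R = r ^ m"
    and fpf: "\<And>x w. \<lbrakk>x \<in> R; x \<noteq> \<one>; w \<in> carrier W; \<rho> x w = w\<rbrakk> \<Longrightarrow> w = \<one>\<^bsub>W\<^esub>"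
    and v: "v \<in> carrier W" "v [^]\<^bsub>W\<^esub> r \<noteq> \<one>\<^bsub>W\<^esub>"
  shows "unique_prime_subgroup r R"
proof (cases "R = {\<one>}")
  case True
  then show ?thesis unfolding unique_prime_subgroup_def by (metis nat_pow_0 singletonD)
next
  case False
  interpret R: subgroup R G by (rule R)
  have r0: "r > 0" using prime_gt_0_nat[OF r] .
  obtain z where z: "z \<in> R" "z \<noteq> \<one>" "z [^] r = \<one>" and zc: "\<And>x. x \<in> R \<Longrightarrow> commutator G x z = \<one>"
    using p_group_central[OF R r False] by metis
  have zcar: "z \<in> carrier G" using z by simp
  have oz: "ord z = r" using ord_eq_prime[OF zcar z(3,2) r] .
  have zpow: "\<exists>j::nat. x = z [^] j" if x: "x \<in> R" and ox: "ord x = r" for x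
  proof (rule ccontr)
    assume no: "\<not> (\<exists>j::nat. x = z [^] j)"
    have xcar: "x \<in> carrier G" using x by simp
    have xz: "x \<otimes> z = z \<otimes> x" using zc[OF x] commutator_one_iff[OF xcar zcar] by blast
    have "v [^]\<^bsub>W\<^esub> r = \<one>\<^bsub>W\<^esub>"
    proof (rule W.fixed_point_free_rank_two[OF act_hom[OF xcar] act_hom[OF zcar] _ _ _ _ _ r0 v(1)])
      show "\<rho> x (\<rho> z w) = \<rho> z (\<rho> x w)" if "w \<in> carrier W" for w
        using act_mult[OF xcar zcar that] act_mult[OF zcar xcar that] xz by simp
      show "(\<rho> x ^^ r) w = w" if "w \<in> carrier W" for w
        using act_pow[OF xcar that] act_one[OF that] pow_ord_eq_1[OF xcar] ox by simp
      show "(\<rho> z ^^ r) w = w" if "w \<in> carrier W" for w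
        using act_pow[OF zcar that] act_one[OF that] z(3) by simp
      show "w = \<one>\<^bsub>W\<^esub>" if "j < r" and w: "w \<in> carrier W" "\<rho> x ((\<rho> z ^^ j) w) = w" for j w
      proof -
        have "x \<otimes> z [^] j \<noteq> \<one>"
        proof
          assume eq: "x \<otimes> z [^] j = \<one>"
          have "z [^] j \<otimes> z [^] ((r - 1) * j) = z [^] (r * j)"
            using nat_pow_mult[OF zcar] r0 by (simp add: algebra_simps)
          also have "\<dots> = \<one>" using nat_pow_pow[OF zcar, of r j] z(3) by simp
          finally have "x \<otimes> z [^] j \<otimes> z [^] ((r - 1) * j) = x" using xcar zcar by (simp add: m_assoc)
          then have "x = z [^] ((r - 1) * j)" using eq zcar by simp
          then show False using no by blast
        qed
        moreover have "\<rho> (x \<otimes> z [^] j) w = w"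
          using act_mult[OF xcar nat_pow_closed[OF zcar] w(1)] act_pow[OF zcar w(1)] w(2) by simp
        ultimately show ?thesis using fpf[of "x \<otimes> z [^] j" w] x subgroup_pow_closed[OF R(1) z(1)] w(1) by simp
      qed
      show "w = \<one>\<^bsub>W\<^esub>" if i: "0 < i" "i < r" and w: "w \<in> carrier W" "(\<rho> z ^^ i) w = w" for i w
      proof -
        have "z [^] i \<noteq> \<one>" using pow_eq_id[OF zcar] oz i by (simp add: nat_dvd_not_less)
        then show ?thesis
          using fpf[OF subgroup_pow_closed[OF R(1) z(1)] _ w(1)] act_pow[OF zcar w(1)] w(2) by simp
      qed
    qed
    then show False using v(2) by simp
  qed
  show ?thesis
    unfolding unique_prime_subgroup_def
  proof (intro ballI impI)
    fix x y assume x: "x \<in> R" "ord x = r" and y: "y \<in> R" "ord y = r"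
    obtain i :: nat where i: "x = z [^] i" using zpow[OF x] by blast
    obtain j :: nat where j: "y = z [^] j" using zpow[OF y] by blast
    obtain l :: nat where "z = x [^] l" using pow_prime_ord_sym[OF zcar r oz, of i] i x(2) by blast
    then have "y = x [^] (l * j)" using j nat_pow_pow[OF R.mem_carrier[OF x(1)], of l j] by simp
    then show "\<exists>j::nat. y = x [^] j" by blast
  qed
qed

end

context finite_group
begin

lemma centralizer_of_normal:
  assumes V: "V \<lhd> G"
  shows "{g \<in> carrier G. \<forall>v\<in>V. g \<otimes> v = v \<otimes> g} \<lhd> G" (is "?C \<lhd> G")
proof (rule normal_invI)
  interpret V: normal V G by (rule V)
  show "subgroup ?C G"
  proof (rule subgroupI)
    have "\<one> \<in> ?C" by simp
    then show "?C \<noteq> {}" by blast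
    show "?C \<subseteq> carrier G" by blast
    show "inv a \<in> ?C" if "a \<in> ?C" for a using that commute_inv by simp
    show "a \<otimes> b \<in> ?C" if a: "a \<in> ?C" and b: "b \<in> ?C" for a b
    proof -
      have "a \<otimes> b \<otimes> v = v \<otimes> (a \<otimes> b)" if v: "v \<in> V" for v
      proof -
        have car: "a \<in> carrier G" "b \<in> carrier G" "v \<in> carrier G" using a b v by simp_all
        have "a \<otimes> b \<otimes> v = a \<otimes> (b \<otimes> v)" using car by (simp add: m_assoc)
        also have "b \<otimes> v = v \<otimes> b" using b v by simp
        also have "a \<otimes> (v \<otimes> b) = a \<otimes> v \<otimes> b" using car by (simp add: m_assoc)
        also have "a \<otimes> v = v \<otimes> a" using a v by simp
        finally show ?thesis using car by (simp add: m_assoc)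
      qed
      then show ?thesis using a b by simp
    qed
  qed
  fix g c assume g: "g \<in> carrier G" and c: "c \<in> ?C"
  have "(g \<otimes> c \<otimes> inv g) \<otimes> v = v \<otimes> (g \<otimes> c \<otimes> inv g)" if v: "v \<in> V" for v
  proof -
    let ?v = "inv g \<otimes> v \<otimes> g"
    have "?v \<in> V" using V.inv_op_closed1[OF g v] .
    then have "c \<otimes> ?v = ?v \<otimes> c" using c by simp
    then have "g \<otimes> (c \<otimes> ?v) \<otimes> inv g = g \<otimes> (?v \<otimes> c) \<otimes> inv g" by simp
    then show ?thesis using g c v by (simp add: word_simps)
  qed
  then show "g \<otimes> c \<otimes> inv g \<in> ?C" using g c by simp
qed

text \<open>The group \<open>H = G/C\<close> acts faithfully on \<open>V\<close>. A normal \<open>p\<close>-subgroup of \<open>H\<close> fixes a nontrivial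
  element of \<open>V\<close>; its fixed points form a normal subgroup of \<open>G\<close>, hence are all of \<open>V\<close>, and so it is
  trivial. For a prime \<open>r\<close> other than \<open>p\<close>, the nontrivial elements of \<open>H\<close> of \<open>r\<close>-power order lift to
  elements of \<open>r\<close>-power order that do not centralize \<open>V\<close>, so they act without fixed points, and the
  normal \<open>r\<close>-subgroups of \<open>H\<close> have at most one subgroup of order \<open>r\<close>. So the preceding result on
  derived lengths applies to \<open>H\<close>.\<close>

theorem derived_centralizes_minimal_normal:
  assumes ch: "chief_pair p V {\<one>}" and solv: "(derived G ^^ n) (carrier G) = {\<one>}"
    and fpf: "\<And>r k y v w. \<lbrakk>prime r; r \<noteq> p; y \<in> carrier G; ord y = r ^ k; v \<in> V; v \<noteq> \<one>; y \<otimes> v = v \<otimes> y; w \<in> V\<rbrakk>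
      \<Longrightarrow> y \<otimes> w = w \<otimes> y"
  defines "C \<equiv> {g \<in> carrier G. \<forall>v\<in>V. g \<otimes> v = v \<otimes> g}"
  defines "D2 \<equiv> derived G (derived G (carrier G))"
  shows "derived G (derived G D2) \<subseteq> C" "\<exists>m. lcs_of G D2 m \<subseteq> C" "odd (order G) \<Longrightarrow> D2 \<subseteq> C"
proof -
  obtain nV where p: "prime p" and V: "V \<lhd> G" and V1: "V \<noteq> {\<one>}" and cardV: "card V = p ^ nV"
    and min: "\<And>K. \<lbrakk>K \<lhd> G; K \<subseteq> V\<rbrakk> \<Longrightarrow> K = {\<one>} \<or> K = V"
    using chief_pair_oneE[OF ch] by metis
  interpret V: normal V G by (rule V)
  have C: "C \<lhd> G" unfolding C_def using centralizer_of_normal[OF V] .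
  interpret C: normal C G by (rule C)
  let ?H = "G Mod C" and ?h = "\<lambda>a. C #> a"
  interpret H: finite_group ?H by (rule finite_group_Mod[OF C])
  interpret h: group_hom G ?H ?h by (rule C.group_hom_Mod)
  note mult_FactGroup [simp del] one_FactGroup [simp del]
  have H1: "\<one>\<^bsub>?H\<^esub> = C" by (simp add: one_FactGroup)
  have surj: "?h ` carrier G = carrier ?H" by (simp add: carrier_FactGroup)
  have Hrep: "\<exists>g\<in>carrier G. X = ?h g" if "X \<in> carrier ?H" for X using that surj by blast
  let ?W = "G\<lparr>carrier := V\<rparr>"
  interpret W: comm_group ?W
  proof (rule group.group_comm_groupI)
    show "group ?W" using subgroup_imp_group[OF V.is_subgroup] .
  qed (use chief_pair_one_abelian[OF ch] in simp)
  (* Two representatives of a coset of C conjugate V in the same way. *)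
  define \<rho> where "\<rho> X v = (SOME g. g \<in> X) \<otimes> v \<otimes> inv (SOME g. g \<in> X)" for X v
  have rho: "\<rho> (?h g) v = g \<otimes> v \<otimes> inv g" if g: "g \<in> carrier G" and v: "v \<in> V" for g v
  proof -
    let ?u = "SOME u. u \<in> C #> g"
    have "?u \<in> C #> g" using rcos_self[OF g C.is_subgroup] by (rule someI)
    then obtain c where c: "c \<in> C" "?u = c \<otimes> g" unfolding r_coset_def by blast
    have gv: "g \<otimes> v \<otimes> inv g \<in> V" using V.inv_op_closed2[OF g v] .
    have cc: "c \<in> carrier G" using c(1) by simp
    have "\<rho> (?h g) v = c \<otimes> (g \<otimes> v \<otimes> inv g) \<otimes> inv c"
      unfolding \<rho>_def c(2) using g v cc by (simp add: word_simps)
    also have "\<dots> = g \<otimes> v \<otimes> inv g"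
      using c(1) gv commuting_if_conj[OF cc, of "g \<otimes> v \<otimes> inv g"] unfolding C_def by simp
    finally show ?thesis .
  qed
  have rho_closed: "\<rho> X v \<in> V" if "X \<in> carrier ?H" "v \<in> V" for X v
    using Hrep[OF that(1)] rho[OF _ that(2)] V.inv_op_closed2[OF _ that(2)] by metis
  have rho_one: "\<rho> \<one>\<^bsub>?H\<^esub> v = v" if "v \<in> V" for v
    using rho[OF one_closed that] h.hom_one that by simp
  have rho_mult: "\<rho> (X \<otimes>\<^bsub>?H\<^esub> Y) v = \<rho> X (\<rho> Y v)" if XY: "X \<in> carrier ?H" "Y \<in> carrier ?H" and v: "v \<in> V" for X Y v
  proof -
    obtain x y where xy: "x \<in> carrier G" "X = ?h x" "y \<in> carrier G" "Y = ?h y" using Hrep XY by metis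
    have "\<rho> (X \<otimes>\<^bsub>?H\<^esub> Y) v = \<rho> (?h (x \<otimes> y)) v" using h.hom_mult[OF xy(1,3)] xy by simp
    also have "\<dots> = x \<otimes> (y \<otimes> v \<otimes> inv y) \<otimes> inv x" using rho[of "x \<otimes> y" v] xy v by (simp add: word_simps)
    also have "\<dots> = \<rho> X (\<rho> Y v)" using rho xy v V.inv_op_closed2[OF xy(3) v] by simp
    finally show ?thesis .
  qed
  have rho_hom: "\<rho> X \<in> hom ?W ?W" if X: "X \<in> carrier ?H" for X
  proof (rule homI)
    obtain x where x: "x \<in> carrier G" "X = ?h x" using Hrep X by metis
    fix v w assume vw: "v \<in> carrier ?W" "w \<in> carrier ?W"
    then show "\<rho> X (v \<otimes>\<^bsub>?W\<^esub> w) = \<rho> X v \<otimes>\<^bsub>?W\<^esub> \<rho> X w"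
      using rho[OF x(1)] x by (simp add: word_simps)
  qed (use rho_closed X in simp)
  have rho_fpf: "w = \<one>"
    if r: "prime r" "r \<noteq> p" and R: "subgroup R ?H" "card R = r ^ m" and Y: "Y \<in> R" "Y \<noteq> \<one>\<^bsub>?H\<^esub>"
      and w: "w \<in> V" "\<rho> Y w = w" for r R m Y w
  proof (rule ccontr)
    assume w1: "w \<noteq> \<one>"
    obtain k where k: "H.ord Y = r ^ k" using H.ord_prime_power[OF R r(1) Y(1)] .
    have Yc: "Y \<in> carrier ?H" using subgroup.mem_carrier[OF R(1) Y(1)] .
    obtain y j where y: "y \<in> carrier G" "Y = ?h y" "ord y = r ^ j"
      using lift_prime_power_ord[OF C r(1) Yc k] .
    have "y \<otimes> w \<otimes> inv y = w" using rho[OF y(1) w(1)] y(2) w(2) by simp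
    then have "y \<otimes> w = w \<otimes> y" using commuting_if_conj[OF y(1), of w] w(1) by simp
    then have "y \<in> C" unfolding C_def using fpf[OF r y(1,3) w(1) w1] y(1) by blast
    then have "Y = \<one>\<^bsub>?H\<^esub>" using C.Mod_eq_one_iff[OF y(1)] y(2) H1 by simp
    then show False using Y(2) by simp
  qed
  have Op: "P = {\<one>\<^bsub>?H\<^esub>}" if P: "P \<lhd> ?H" and cardP: "card P = p ^ m" for P m
  proof -
    interpret P: normal P ?H by (rule P)
    let ?F = "{v \<in> V. \<forall>X\<in>P. \<rho> X v = v}"
    have Xc: "X \<in> carrier ?H" if "X \<in> P" for X using that by (rule P.mem_carrier)
    have "[card V = card ?F] (mod p)"
      by (rule H.fixed_points_cong[OF P.is_subgroup cardP p finite_subgroup[OF V.is_subgroup]])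
        (simp_all add: rho_closed rho_one rho_mult Xc)
    moreover have "p dvd card V"
    proof -
      have "nV \<noteq> 0"
      proof
        assume "nV = 0"
        then obtain u where "V = {u}" using cardV card_1_singletonE by (metis power_0)
        then show False using V1 V.one_closed by blast
      qed
      then show ?thesis using cardV by simp
    qed
    ultimately have pF: "p dvd card ?F" using cong_dvd_iff by blast
    have "?F \<noteq> {\<one>}"
    proof
      assume "?F = {\<one>}"
      then have "p dvd 1" using pF by simp
      then show False using p by simp
    qed
    moreover have F_iff: "v \<in> ?F \<longleftrightarrow> v \<in> V \<and> (\<forall>g\<in>carrier G. ?h g \<in> P \<longrightarrow> g \<otimes> v = v \<otimes> g)" for v
    proof -
      have "(\<forall>X\<in>P. \<rho> X v = v) \<longleftrightarrow> (\<forall>g\<in>carrier G. ?h g \<in> P \<longrightarrow> g \<otimes> v = v \<otimes> g)" if v: "v \<in> V"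
      proof
        assume L: "\<forall>X\<in>P. \<rho> X v = v"
        show "\<forall>g\<in>carrier G. ?h g \<in> P \<longrightarrow> g \<otimes> v = v \<otimes> g"
        proof (intro ballI impI)
          fix g assume g: "g \<in> carrier G" "?h g \<in> P"
          then have "g \<otimes> v \<otimes> inv g = v" using L rho[OF g(1) v] by simp
          then show "g \<otimes> v = v \<otimes> g" using commuting_if_conj[OF g(1), of v] v by simp
        qed
      next
        assume Rr: "\<forall>g\<in>carrier G. ?h g \<in> P \<longrightarrow> g \<otimes> v = v \<otimes> g"
        show "\<forall>X\<in>P. \<rho> X v = v"
        proof
          fix X assume X: "X \<in> P"
          obtain g where g: "g \<in> carrier G" "X = ?h g" using Hrep[OF Xc[OF X]] by blast
          then show "\<rho> X v = v" using Rr rho[OF g(1) v] commuting_if_conj[OF g(1), of v] v X by simp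
        qed
      qed
      then show ?thesis by blast
    qed
    have "?F \<lhd> G"
    proof (rule normal_invI)
      show "subgroup ?F G"
      proof (rule subgroupI)
        show "?F \<subseteq> carrier G" using V.subset by blast
        have "\<one> \<in> ?F" unfolding F_iff by simp
        then show "?F \<noteq> {}" by blast
        show "inv a \<in> ?F" if a: "a \<in> ?F" for a
        proof -
          have "g \<otimes> inv a = inv a \<otimes> g" if "g \<in> carrier G" "?h g \<in> P" for g
          proof -
            have "a \<otimes> g = g \<otimes> a" using a that unfolding F_iff by simp
            then show ?thesis using commute_inv[of a g] a that by simp
          qed
          then show ?thesis using a unfolding F_iff by simp
        qed
        show "a \<otimes> b \<in> ?F" if a: "a \<in> ?F" and b: "b \<in> ?F" for a b
        proof -
          have "\<rho> X (a \<otimes> b) = a \<otimes> b" if X: "X \<in> P" for X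
          proof -
            have "\<rho> X (a \<otimes> b) = \<rho> X a \<otimes> \<rho> X b"
              using hom_mult[OF rho_hom[OF Xc[OF X]], of a b] a b by simp
            then show ?thesis using a b X by simp
          qed
          then show ?thesis using a b by simp
        qed
      qed
      fix g v assume g: "g \<in> carrier G" and v: "v \<in> ?F"
      have vV: "v \<in> V" using v by simp
      have "x \<otimes> (g \<otimes> v \<otimes> inv g) = (g \<otimes> v \<otimes> inv g) \<otimes> x" if x: "x \<in> carrier G" "?h x \<in> P" for x
      proof -
        let ?x = "inv g \<otimes> x \<otimes> g"
        have "?h ?x = inv\<^bsub>?H\<^esub> (?h g) \<otimes>\<^bsub>?H\<^esub> ?h x \<otimes>\<^bsub>?H\<^esub> ?h g"
          using h.hom_mult[of "inv g \<otimes> x" g] h.hom_mult[of "inv g" x] h.hom_inv[OF g] g x by simp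
        then have "?h ?x \<in> P" using P.inv_op_closed1[OF h.hom_closed[OF g] x(2)] by simp
        then have "?x \<otimes> v = v \<otimes> ?x" using v g x unfolding F_iff by simp
        then have "g \<otimes> (?x \<otimes> v) \<otimes> inv g = g \<otimes> (v \<otimes> ?x) \<otimes> inv g" by simp
        then show ?thesis using g x vV by (simp add: word_simps)
      qed
      then show "g \<otimes> v \<otimes> inv g \<in> ?F" unfolding F_iff using V.inv_op_closed2[OF g vV] by blast
    qed
    ultimately have FV: "?F = V" using min[of ?F] by blast
    have "P \<subseteq> {\<one>\<^bsub>?H\<^esub>}"
    proof
      fix X assume X: "X \<in> P"
      obtain g where g: "g \<in> carrier G" "X = ?h g" using Hrep[OF Xc[OF X]] by blast
      have "g \<otimes> v = v \<otimes> g" if "v \<in> V" for v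
      proof -
        have "v \<in> ?F" unfolding FV using that .
        then show ?thesis using g X unfolding F_iff by blast
      qed
      then have "g \<in> C" unfolding C_def using g by blast
      then show "X \<in> {\<one>\<^bsub>?H\<^esub>}" using C.Mod_eq_one_iff[OF g(1)] g(2) H1 by simp
    qed
    then show ?thesis using P.one_closed by blast
  qed
  interpret A: automorphism_action ?H ?W \<rho>
    by unfold_locales (simp_all add: rho_hom rho_one rho_mult)
  have uq: "H.unique_prime_subgroup r R" if r: "prime r" "r \<noteq> p" and R: "R \<lhd> ?H" and cardR: "card R = r ^ m" for r R m
  proof -
    have R': "subgroup R ?H" using normal_imp_subgroup[OF R] .
    obtain v where v: "v \<in> V" "v \<noteq> \<one>" using V1 V.one_closed by blast
    have vc: "v \<in> carrier G" using v(1) by simp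
    obtain k where k: "ord v = p ^ k" using ord_prime_power[OF V.is_subgroup cardV p v(1)] .
    have "v [^] r \<noteq> \<one>"
    proof
      assume "v [^] r = \<one>"
      then have "p ^ k dvd r" using pow_eq_id[OF vc] k by simp
      moreover have "k \<noteq> 0" using k v(2) ord_eq_1[OF vc] by (cases k) simp_all
      ultimately have "p dvd r" by (metis dvd_power dvd_trans not_gr_zero)
      then show False using r p primes_dvd_imp_eq by blast
    qed
    then have "v [^]\<^bsub>?W\<^esub> r \<noteq> \<one>\<^bsub>?W\<^esub>" by (simp flip: nat_pow_consistent)
    then show ?thesis
      using A.unique_prime_subgroup_if_fixed_point_free[OF r(1) R' cardR] rho_fpf[OF r R' cardR] v(1) by simp
  qed
  have img: "(derived ?H ^^ i) (carrier ?H) = ?h ` ((derived G ^^ i) (carrier G))" for i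
    using h.exp_of_derived_img[OF subset_refl, of i] surj by simp
  have solvH: "(derived ?H ^^ n) (carrier ?H) = {\<one>\<^bsub>?H\<^esub>}"
    unfolding img solv using h.hom_one by simp
  have D2H: "derived ?H (derived ?H (carrier ?H)) = ?h ` D2"
    using img[of 2] unfolding D2_def by (simp add: numeral_2_eq_2)
  have D4H: "derived ?H (derived ?H (derived ?H (derived ?H (carrier ?H)))) = ?h ` derived G (derived G D2)"
    using img[of 4] unfolding D2_def by (simp add: numeral_eq_Suc)
  note main = H.derived_length_four_if_unique_prime_subgroups[OF solvH p]
  have main1: "nilpotent_group (?H\<lparr>carrier := ?h ` D2\<rparr>)"
    unfolding D2H[symmetric] by (rule main(1); (rule Op uq; assumption)?)
  have main2: "?h ` derived G (derived G D2) = {\<one>\<^bsub>?H\<^esub>}"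
    unfolding D4H[symmetric] by (rule main(2); (rule Op uq; assumption)?)
  have main3: "?h ` D2 = {\<one>\<^bsub>?H\<^esub>}" if "odd (order ?H)"
    unfolding D2H[symmetric] by (rule main(3)[OF _ _ that]; (rule Op uq; assumption)?)
  have into_C: "A \<subseteq> C" if "?h ` A = {\<one>\<^bsub>?H\<^esub>}" "A \<subseteq> carrier G" for A
  proof
    fix a assume a: "a \<in> A"
    then have "?h a = C" using that(1) H1 by blast
    then show "a \<in> C" using C.Mod_eq_one_iff a that(2) by blast
  qed
  have D2: "subgroup D2 G" and D2c: "D2 \<subseteq> carrier G"
    unfolding D2_def by (intro derived_is_subgroup derived_in_carrier subset_refl)+
  show "derived G (derived G D2) \<subseteq> C"
  proof (rule into_C)
    show "?h ` derived G (derived G D2) = {\<one>\<^bsub>?H\<^esub>}" by (rule main2)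
    show "derived G (derived G D2) \<subseteq> carrier G" by (intro derived_in_carrier D2c)
  qed
  show "\<exists>m. lcs_of G D2 m \<subseteq> C"
  proof -
    obtain m where "lcs_of ?H (?h ` D2) m = {\<one>\<^bsub>?H\<^esub>}"
      using main1 unfolding H.nilpotent_group_iff by blast
    then have "?h ` lcs_of G D2 m = {\<one>\<^bsub>?H\<^esub>}" using h.lcs_of_img[OF D2] by simp
    then have "lcs_of G D2 m \<subseteq> C"
      using subset_trans[OF lcs_of_subset[OF D2] D2c] by (rule into_C)
    then show ?thesis by (rule exI)
  qed
  show "D2 \<subseteq> C" if odd: "odd (order G)"
  proof (rule into_C[OF _ D2c])
    have "order ?H dvd order G"
      using lagrange[OF C.is_subgroup] unfolding order_def FactGroup_def by (metis dvd_triv_left partial_object.select_convs(1))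
    then have "odd (order ?H)" using odd dvd_trans by blast
    then show "?h ` D2 = {\<one>\<^bsub>?H\<^esub>}" by (rule main3)
  qed
qed

end

section \<open>Fitting height and derived length of solvable tidy groups\<close>

context finite_group
begin

text \<open>The coset \<open>T #> s\<close> is invariant under conjugation by \<open>g\<close> and its size is a power of \<open>p\<close>. So the
  \<open>r\<close>-group generated by \<open>g\<close> fixes an element of it, which is nontrivial because the coset is not \<open>T\<close>.\<close>

lemma tidy_coprime_action_on_factor:
  assumes tidy: "tidy G" and ch: "chief_pair p S T" and not2: "\<not> (p = 2 \<and> unique_prime_subgroup 2 S)"
    and r: "prime r" "r \<noteq> p" and g: "g \<in> carrier G" "ord g = r ^ j"
    and s: "s \<in> S" "s \<notin> T" "commutator G g s \<in> T" and w: "w \<in> S"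
  shows "g \<otimes> w = w \<otimes> g"
proof -
  obtain n where p: "prime p" and S: "S \<lhd> G" and T: "T \<lhd> G" and TS: "T \<subseteq> S" and card: "card S = p ^ n"
    using chief_pairE[OF ch] by metis
  interpret S: normal S G by (rule S)
  interpret T: normal T G by (rule T)
  have sc: "s \<in> carrier G" using s by simp
  let ?C = "{x \<in> carrier G. commutator G x s \<in> T}"
  let ?P = "generate G {g}"
  have P: "subgroup ?P G" using g by (intro generate_is_subgroup) simp
  have cardP: "card ?P = r ^ j" using generate_pow_card[OF g(1)] g(2) by simp
  have Pc: "a \<in> carrier G" if "a \<in> ?P" for a using that subgroup.mem_carrier[OF P] by blast
  have Tx: "x \<in> T #> s \<longleftrightarrow> x \<in> carrier G \<and> x \<otimes> inv s \<in> T" for x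
  proof
    assume x: "x \<in> T #> s"
    then have "x \<in> carrier G" using r_coset_subset_G[OF T.subset sc] by blast
    then show "x \<in> carrier G \<and> x \<otimes> inv s \<in> T" using T.rcos_module[OF is_group sc] x by blast
  next
    assume "x \<in> carrier G \<and> x \<otimes> inv s \<in> T"
    then show "x \<in> T #> s" using T.rcos_module[OF is_group sc] by blast
  qed
  have step: "g \<otimes> x \<otimes> inv g \<in> T #> s" if "x \<in> T #> s" for x
  proof -
    have x: "x \<in> carrier G" "x \<otimes> inv s \<in> T" using that Tx by simp_all
    have "g \<otimes> (x \<otimes> inv s) \<otimes> inv g \<in> T" using T.inv_op_closed2[OF g(1) x(2)] .
    then have "(g \<otimes> (x \<otimes> inv s) \<otimes> inv g) \<otimes> commutator G g s \<in> T" using s(3) by blast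
    moreover have "(g \<otimes> (x \<otimes> inv s) \<otimes> inv g) \<otimes> commutator G g s = (g \<otimes> x \<otimes> inv g) \<otimes> inv s"
      using x g sc by (simp add: word_simps)
    ultimately show ?thesis using Tx x g by simp
  qed
  have closed: "a \<otimes> x \<otimes> inv a \<in> T #> s" if a: "a \<in> ?P" and x: "x \<in> T #> s" for a x
  proof -
    obtain i :: nat where i: "a = g [^] i" using a mem_generate_singleton[OF g(1), of a] by blast
    have "g [^] i \<otimes> x \<otimes> inv (g [^] i) \<in> T #> s" for i :: nat
    proof (induction i)
      case 0 then show ?case using x Tx by simp
    next
      case (Suc i)
      have xc: "x \<in> carrier G" using x Tx by blast
      have "g [^] Suc i \<otimes> x \<otimes> inv (g [^] Suc i) = g \<otimes> (g [^] i \<otimes> x \<otimes> inv (g [^] i)) \<otimes> inv g"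
        unfolding nat_pow_Suc2[OF g(1)] using g xc by (simp add: word_simps)
      then show ?case using step[OF Suc] by simp
    qed
    then show ?thesis using i by simp
  qed
  let ?F = "{x \<in> T #> s. \<forall>a\<in>?P. a \<otimes> x \<otimes> inv a = x}"
  have "[card (T #> s) = card ?F] (mod r)"
  proof (rule fixed_points_cong[OF P cardP r(1)])
    show "finite (T #> s)" using fin r_coset_subset_G[OF T.subset sc] finite_subset by blast
    show "a \<otimes> x \<otimes> inv a \<in> T #> s" if "a \<in> ?P" "x \<in> T #> s" for a x using closed that .
    show "\<one> \<otimes> x \<otimes> inv \<one> = x" if "x \<in> T #> s" for x using that Tx by simp
    show "a \<otimes> b \<otimes> x \<otimes> inv (a \<otimes> b) = a \<otimes> (b \<otimes> x \<otimes> inv b) \<otimes> inv a"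
      if "a \<in> ?P" "b \<in> ?P" "x \<in> T #> s" for a b x
    proof -
      have "a \<in> carrier G" "b \<in> carrier G" "x \<in> carrier G" using that Pc Tx by blast+
      then show ?thesis by (simp add: word_simps)
    qed
  qed
  moreover have "\<not> r dvd card (T #> s)"
  proof
    assume "r dvd card (T #> s)"
    moreover have "card (T #> s) = card T"
      using card_rcosets_equal[OF rcosetsI[OF T.subset sc] T.subset] by simp
    moreover have "card T dvd p ^ n" using card_subgroup_dvd[OF T.is_subgroup S.is_subgroup TS] card by simp
    ultimately have "r dvd p ^ n" by (metis dvd_trans)
    then have "r dvd p" using prime_dvd_power[OF r(1)] by blast
    then show False using r p primes_dvd_imp_eq by blast
  qed
  ultimately have "\<not> r dvd card ?F" using cong_dvd_iff by blast
  then have "?F \<noteq> {}" by (metis card.empty dvd_0_right)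
  then obtain x where x: "x \<in> T #> s" "\<forall>a\<in>?P. a \<otimes> x \<otimes> inv a = x" by blast
  have xc: "x \<in> carrier G" using x Tx by blast
  have "g \<in> ?P" by (auto intro: generate.incl)
  then have gx: "g \<otimes> x = x \<otimes> g" using x(2) commuting_if_conj[OF g(1) xc] by blast
  obtain t where t: "t \<in> T" "x = t \<otimes> s" using x(1) unfolding r_coset_def by blast
  have xS: "x \<in> S" using t s TS by blast
  have x1: "x \<noteq> \<one>"
  proof
    assume "x = \<one>"
    then have "s = inv t" using t sc by (metis T.mem_carrier inv_equality inv_inv inv_closed)
    then show False using s(2) t(1) by simp
  qed
  have "coprime (r ^ j) p" using r p by (simp add: primes_coprime)
  then have cop: "coprime (ord g) p" using g(2) by simp
  show ?thesis
    using tidy_coprime_fixed_point[OF tidy S.is_subgroup card p g(1) S.inv_op_closed2[OF g(1)] cop xS x1 gx not2 w] .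
qed

text \<open>In the exceptional case that \<open>S\<close> is a 2-group with only one involution, the factor has order at most
  four and \<open>D2\<close> centralizes it. Otherwise the elements of \<open>G/T\<close> whose order is a power of a prime other than
  \<open>p\<close> act on \<open>S/T\<close> trivially or without fixed points.\<close>

theorem tidy_derived_centralizes_chief_pair:
  assumes tidy: "tidy G" and solv: "(derived G ^^ n) (carrier G) = {\<one>}" and ch: "chief_pair p S T"
  defines "D2 \<equiv> derived G (derived G (carrier G))"
  shows "centralizes_factor (derived G (derived G D2)) S T"
    "\<exists>m. centralizes_factor (lcs_of G D2 m) S T"
    "odd (order G) \<Longrightarrow> centralizes_factor D2 S T"
proof -
  obtain k where p: "prime p" and S: "S \<lhd> G" and T: "T \<lhd> G" and TS: "T \<subseteq> S" and card: "card S = p ^ k"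
    using chief_pairE[OF ch] by metis
  have D2: "subgroup D2 G" and D2c: "D2 \<subseteq> carrier G"
    unfolding D2_def by (intro derived_is_subgroup derived_in_carrier subset_refl)+
  have D42: "derived G (derived G D2) \<subseteq> D2"
    using derived_incl[OF derived_incl[OF subset_refl D2] D2] .
  have mono: "centralizes_factor A S T" if "centralizes_factor B S T" "A \<subseteq> B" for A B
    using that unfolding centralizes_factor_def by blast
  have "centralizes_factor (derived G (derived G D2)) S T \<and> (\<exists>m. centralizes_factor (lcs_of G D2 m) S T)
    \<and> (odd (order G) \<longrightarrow> centralizes_factor D2 S T)"
  proof (cases "p = 2 \<and> unique_prime_subgroup 2 S")
    case True
    then have "card ((\<lambda>s. T #> s) ` S) \<le> 4" using unique_involution_factor_card ch by blast
    then have D2cent: "centralizes_factor D2 S T"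
      unfolding D2_def by (rule derived_derived_centralizes_small_factor[OF S T])
    moreover have "centralizes_factor (lcs_of G D2 0) S T" using D2cent by simp
    ultimately show ?thesis using mono[OF _ D42] by blast
  next
    case False
    interpret S: normal S G by (rule S)
    interpret T: normal T G by (rule T)
    let ?Q = "G Mod T" and ?h = "\<lambda>s. T #> s"
    interpret Q: finite_group ?Q by (rule finite_group_Mod[OF T])
    interpret h: group_hom G ?Q ?h by (rule T.group_hom_Mod)
    note mult_FactGroup [simp del] one_FactGroup [simp del]
    have Q1: "\<one>\<^bsub>?Q\<^esub> = T" by (simp add: one_FactGroup)
    have surj: "?h ` carrier G = carrier ?Q" by (simp add: carrier_FactGroup)
    have img: "(derived ?Q ^^ i) (carrier ?Q) = ?h ` ((derived G ^^ i) (carrier G))" for i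
      using h.exp_of_derived_img[OF subset_refl, of i] surj by simp
    have solvQ: "(derived ?Q ^^ n) (carrier ?Q) = {\<one>\<^bsub>?Q\<^esub>}"
      unfolding img solv using h.hom_one by simp
    let ?V = "?h ` S"
    have fpf: "y \<otimes>\<^bsub>?Q\<^esub> w = w \<otimes>\<^bsub>?Q\<^esub> y"
      if r: "prime r" "r \<noteq> p" and y: "y \<in> carrier ?Q" "Q.ord y = r ^ k" and v: "v \<in> ?V" "v \<noteq> \<one>\<^bsub>?Q\<^esub>"
        and yv: "y \<otimes>\<^bsub>?Q\<^esub> v = v \<otimes>\<^bsub>?Q\<^esub> y" and w: "w \<in> ?V" for r k y v w
    proof -
      obtain g j where g: "g \<in> carrier G" "y = ?h g" "ord g = r ^ j"
        using lift_prime_power_ord[OF T r(1) y] .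
      obtain s where s: "s \<in> S" "v = ?h s" using v(1) by blast
      obtain u where u: "u \<in> S" "w = ?h u" using w by blast
      have sc: "s \<in> carrier G" and uc: "u \<in> carrier G" using s u by simp_all
      have "s \<notin> T" using v(2) s(2) T.Mod_eq_one_iff[OF sc] Q1 by simp
      moreover have "commutator G g s \<in> T" using yv T.commute_Mod_iff[OF g(1) sc] g(2) s(2) by simp
      ultimately have "g \<otimes> u = u \<otimes> g"
        using tidy_coprime_action_on_factor[OF tidy ch False r g(1,3) s(1) _ _ u(1)] by blast
      then show ?thesis using h.hom_mult[OF g(1) uc] h.hom_mult[OF uc g(1)] g(2) u(2) by simp
    qed
    note main = Q.derived_centralizes_minimal_normal[OF chief_pair_Mod[OF ch] solvQ]
    have D2Q: "derived ?Q (derived ?Q (carrier ?Q)) = ?h ` D2"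
      using img[of 2] unfolding D2_def by (simp add: numeral_2_eq_2)
    have D4Q: "derived ?Q (derived ?Q (derived ?Q (derived ?Q (carrier ?Q)))) = ?h ` derived G (derived G D2)"
      using img[of 4] unfolding D2_def by (simp add: numeral_eq_Suc)
    let ?C = "{g \<in> carrier ?Q. \<forall>v\<in>?V. g \<otimes>\<^bsub>?Q\<^esub> v = v \<otimes>\<^bsub>?Q\<^esub> g}"
    have lift_back: "centralizes_factor A S T" if "?h ` A \<subseteq> ?C" "A \<subseteq> carrier G" for A
      unfolding centralizes_factor_def
    proof (intro ballI)
      fix a s assume a: "a \<in> A" and s: "s \<in> S"
      have "?h a \<in> ?C" using that(1) a by blast
      then have "?h a \<otimes>\<^bsub>?Q\<^esub> ?h s = ?h s \<otimes>\<^bsub>?Q\<^esub> ?h a" using s by blast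
      then show "commutator G a s \<in> T" using T.commute_Mod_iff[of a s] a that(2) S.mem_carrier[OF s] by blast
    qed
    have "?h ` derived G (derived G D2) \<subseteq> ?C"
      unfolding D4Q[symmetric] by (rule main(1)) (rule fpf)
    then have "centralizes_factor (derived G (derived G D2)) S T"
      using subset_trans[OF D42 D2c] by (rule lift_back)
    moreover have "\<exists>m. lcs_of ?Q (?h ` D2) m \<subseteq> ?C"
      unfolding D2Q[symmetric] by (rule main(2)) (rule fpf)
    then obtain m where "lcs_of ?Q (?h ` D2) m \<subseteq> ?C" by (rule exE)
    then have "?h ` lcs_of G D2 m \<subseteq> ?C" unfolding h.lcs_of_img[OF D2] .
    then have "centralizes_factor (lcs_of G D2 m) S T"
      using subset_trans[OF lcs_of_subset[OF D2] D2c] by (rule lift_back)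
    moreover have "centralizes_factor D2 S T" if odd: "odd (order G)"
    proof (rule lift_back[OF _ D2c])
      have "order ?Q dvd order G"
        using lagrange[OF T.is_subgroup] unfolding order_def FactGroup_def by (metis dvd_triv_left partial_object.select_convs(1))
      then have "odd (order ?Q)" using odd dvd_trans by blast
      then show "?h ` D2 \<subseteq> ?C"
        unfolding D2Q[symmetric] by (intro main(3)) (rule fpf)
    qed
    ultimately show ?thesis by blast
  qed
  then show "centralizes_factor (derived G (derived G D2)) S T"
    "\<exists>m. centralizes_factor (lcs_of G D2 m) S T"
    "odd (order G) \<Longrightarrow> centralizes_factor D2 S T"
    by blast+
qed

text \<open>For solvable \<open>G\<close> this is a nilpotent normal subgroup, and so it is contained in the Fitting subgroup.\<close>

definition chief_centralizer :: "'a set" where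
  "chief_centralizer = {g \<in> carrier G. \<forall>p S T. chief_pair p S T \<longrightarrow> (\<forall>s\<in>S. commutator G g s \<in> T)}"

lemma chief_centralizer_normal: "chief_centralizer \<lhd> G"
proof (rule normal_invI)
  have factor: "commutator G (inv g) s \<in> T \<and> commutator G (g \<otimes> h) s \<in> T \<and> commutator G (k \<otimes> g \<otimes> inv k) s \<in> T"
    if g: "g \<in> chief_centralizer" and h: "h \<in> chief_centralizer" and k: "k \<in> carrier G"
      and ch: "chief_pair p S T" and s: "s \<in> S" for g h k p S T s
  proof -
    have S: "S \<lhd> G" and T: "T \<lhd> G" using chief_pairE[OF ch] by metis+
    interpret S: normal S G by (rule S)
    interpret T: normal T G by (rule T)
    have car: "g \<in> carrier G" "h \<in> carrier G" "s \<in> carrier G" using g h s unfolding chief_centralizer_def by simp_all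
    have com: "commutator G g x \<in> T" "commutator G h x \<in> T" if "x \<in> S" for x
      using g h ch that unfolding chief_centralizer_def by blast+
    have 1: "inv g \<otimes> inv (commutator G g s) \<otimes> g \<in> T"
      using T.inv_op_closed1[OF car(1)] com(1)[OF s] by simp
    have 2: "(g \<otimes> commutator G h s \<otimes> inv g) \<otimes> commutator G g s \<in> T"
      using T.inv_op_closed2[OF car(1) com(2)[OF s]] com(1)[OF s] by simp
    have "inv k \<otimes> s \<otimes> k \<in> S" using S.inv_op_closed1[OF k s] .
    then have 3: "k \<otimes> commutator G g (inv k \<otimes> s \<otimes> k) \<otimes> inv k \<in> T"
      using T.inv_op_closed2[OF k] com(1) by blast
    have "inv g \<otimes> inv (commutator G g s) \<otimes> g = commutator G (inv g) s"
      "(g \<otimes> commutator G h s \<otimes> inv g) \<otimes> commutator G g s = commutator G (g \<otimes> h) s"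
      "k \<otimes> commutator G g (inv k \<otimes> s \<otimes> k) \<otimes> inv k = commutator G (k \<otimes> g \<otimes> inv k) s"
      using car k by (simp_all add: word_simps)
    then show ?thesis using 1 2 3 by simp
  qed
  have sub: "chief_centralizer \<subseteq> carrier G" unfolding chief_centralizer_def by blast
  have one: "\<one> \<in> chief_centralizer"
  proof -
    have "commutator G \<one> s \<in> T" if ch: "chief_pair p S T" and s: "s \<in> S" for p S T s
    proof -
      have S: "S \<lhd> G" and T: "T \<lhd> G" using chief_pairE[OF ch] by metis+
      have "s \<in> carrier G" using subgroup.mem_carrier[OF normal_imp_subgroup[OF S] s] .
      then show ?thesis using subgroup.one_closed[OF normal_imp_subgroup[OF T]] by simp
    qed
    then show ?thesis unfolding chief_centralizer_def by blast
  qed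
  show "subgroup chief_centralizer G"
  proof (rule subgroupI[OF sub])
    show "chief_centralizer \<noteq> {}" using one by blast
    show "inv g \<in> chief_centralizer" if g: "g \<in> chief_centralizer" for g
    proof -
      have "inv g \<in> carrier G" using g sub by blast
      then show ?thesis using factor[OF g g one_closed] unfolding chief_centralizer_def by blast
    qed
    show "g \<otimes> h \<in> chief_centralizer" if g: "g \<in> chief_centralizer" and h: "h \<in> chief_centralizer" for g h
    proof -
      have "g \<otimes> h \<in> carrier G" using g h sub by blast
      then show ?thesis using factor[OF g h one_closed] unfolding chief_centralizer_def by blast
    qed
  qed
  fix k g assume k: "k \<in> carrier G" and g: "g \<in> chief_centralizer"
  have "k \<otimes> g \<otimes> inv k \<in> carrier G" using g k sub by blast
  then show "k \<otimes> g \<otimes> inv k \<in> chief_centralizer" using factor[OF g g k] unfolding chief_centralizer_def by blast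
qed

lemma mem_chief_centralizerI:
  assumes "A \<subseteq> carrier G" "\<And>p S T. chief_pair p S T \<Longrightarrow> centralizes_factor A S T"
  shows "A \<subseteq> chief_centralizer"
  using assms unfolding chief_centralizer_def centralizes_factor_def by blast

text \<open>A decreasing series of finite sets becomes stationary. Its last term lies in every subgroup
  that contains some term of it, so one \<open>m\<close> serves all chief factors at once.\<close>

lemma lcs_of_stabilizes:
  assumes A: "subgroup A G"
  obtains m where "\<And>k. lcs_of G A m \<subseteq> lcs_of G A k"
proof -
  let ?c = "\<lambda>k. card (lcs_of G A k)"
  obtain m where min: "\<And>k. ?c m \<le> ?c k" using ex_has_least_nat[of "\<lambda>_. True" 0 ?c] by blast
  have "lcs_of G A m \<subseteq> lcs_of G A k" for k
  proof (cases "k \<le> m")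
    case True then show ?thesis using lcs_of_antimono[OF A] by blast
  next
    case False
    then have "lcs_of G A k \<subseteq> lcs_of G A m" using lcs_of_antimono[OF A, of m k] by simp
    moreover have "finite (lcs_of G A m)" using finite_subgroup[OF lcs_of_subgroup[OF A]] .
    ultimately have "lcs_of G A k = lcs_of G A m" using min[of k] by (intro card_seteq)
    then show ?thesis by simp
  qed
  then show thesis using that by blast
qed

end

context group
begin

lemma Fitting_normal: "Fitting G \<lhd> G"
  unfolding Fitting_def
proof (rule normal_generateI)
  let ?U = "\<Union>{N. N \<lhd> G \<and> nilpotent_group (G\<lparr>carrier := N\<rparr>)}"
  show "?U \<subseteq> carrier G"
  proof
    fix x assume "x \<in> ?U"
    then obtain N where "N \<lhd> G" "x \<in> N" by blast
    then show "x \<in> carrier G" using subgroup.mem_carrier[OF normal_imp_subgroup] by metis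
  qed
  fix x g assume "x \<in> ?U" and g: "g \<in> carrier G"
  then obtain N where N: "N \<lhd> G" "nilpotent_group (G\<lparr>carrier := N\<rparr>)" "x \<in> N" by blast
  have "g \<otimes> x \<otimes> inv g \<in> N" using normal.inv_op_closed2[OF N(1) g N(3)] .
  then show "g \<otimes> x \<otimes> inv g \<in> ?U" using N by blast
qed

lemma nilpotent_normal_le_Fitting:
  assumes "N \<lhd> G" "nilpotent_group (G\<lparr>carrier := N\<rparr>)"
  shows "N \<subseteq> Fitting G"
  unfolding Fitting_def using assms by (blast intro: generate.incl)

lemma Fitting_series_normal: "Fitting_series G n \<lhd> G"
proof (induction n)
  case 0 then show ?case by (simp add: one_is_normal)
next
  case (Suc n)
  interpret F: normal "Fitting_series G n" G by (rule Suc)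
  interpret Q: group "G Mod Fitting_series G n" by (rule F.factorgroup_is_group)
  show ?case using normal_preimage_Mod[OF Suc Q.Fitting_normal] by simp
qed

text \<open>The image of \<open>B\<close> in the quotient by the \<open>n\<close>-th term is a nilpotent normal subgroup.\<close>

lemma le_Fitting_series_Suc:
  assumes B: "B \<lhd> G" and lcs: "lcs_of G B m \<subseteq> Fitting_series G n"
  shows "B \<subseteq> Fitting_series G (Suc n)"
proof -
  let ?F = "Fitting_series G n"
  interpret B: normal B G by (rule B)
  interpret F: normal ?F G by (rule Fitting_series_normal)
  let ?Q = "G Mod ?F" and ?h = "\<lambda>a. ?F #> a"
  interpret Q: group ?Q by (rule F.factorgroup_is_group)
  interpret h: group_hom G ?Q ?h by (rule F.group_hom_Mod)
  have surj: "?h ` carrier G = carrier ?Q" by (simp add: carrier_FactGroup)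
  have N: "?h ` B \<lhd> ?Q" using B.surj_hom_normal_subgroup[OF h.group_hom_axioms surj] .
  have "lcs_of ?Q (?h ` B) m = ?h ` lcs_of G B m" using h.lcs_of_img[OF B.is_subgroup] .
  also have "\<dots> \<subseteq> {\<one>\<^bsub>?Q\<^esub>}"
  proof
    fix X assume "X \<in> ?h ` lcs_of G B m"
    then obtain x where x: "x \<in> ?F" "X = ?h x" using lcs by blast
    then show "X \<in> {\<one>\<^bsub>?Q\<^esub>}" using F.Mod_eq_one_iff[OF F.mem_carrier[OF x(1)]] by simp
  qed
  finally have "nilpotent_group (?Q\<lparr>carrier := ?h ` B\<rparr>)"
    using Q.nilpotent_groupI[OF normal_imp_subgroup[OF N]] by blast
  then have "?h ` B \<subseteq> Fitting ?Q" using Q.nilpotent_normal_le_Fitting[OF N] by blast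
  then show ?thesis by auto
qed

lemma Fitting_height_le:
  assumes "carrier G \<subseteq> Fitting_series G n"
  shows "Fitting_height G \<le> enat n"
proof -
  have "Fitting_series G n = carrier G"
    using assms subgroup.subset[OF normal_imp_subgroup[OF Fitting_series_normal]] by blast
  then show ?thesis unfolding Fitting_height_def by (intro Inf_lower imageI) simp
qed

lemma derived_length_le:
  assumes "(derived G ^^ n) (carrier G) = {\<one>}"
  shows "derived_length G \<le> enat n"
  unfolding derived_length_def using assms by (intro Inf_lower imageI) simp

lemma metabelianI:
  assumes "derived G (derived G (carrier G)) = {\<one>}"
  shows "metabelian G"
proof -
  let ?D = "derived G (carrier G)"
  have D: "subgroup ?D G" by (rule derived_is_subgroup[OF subset_refl])
  show ?thesis
    unfolding metabelian_def
  proof (rule group.group_comm_groupI[OF subgroup_imp_group[OF D]])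
    fix x y assume "x \<in> carrier (G\<lparr>carrier := ?D\<rparr>)" "y \<in> carrier (G\<lparr>carrier := ?D\<rparr>)"
    then have xy: "x \<in> ?D" "y \<in> ?D" by simp_all
    have "commutator G x y \<in> derived_set G ?D" using xy by blast
    then have "commutator G x y \<in> derived G ?D" unfolding derived_def[of G ?D] by (rule generate.incl)
    then have "commutator G x y = \<one>" using assms by simp
    then show "x \<otimes>\<^bsub>G\<lparr>carrier := ?D\<rparr>\<^esub> y = y \<otimes>\<^bsub>G\<lparr>carrier := ?D\<rparr>\<^esub> x"
      using commutator_one_iff[of x y] subgroup.mem_carrier[OF D] xy by simp
  qed
qed

end

theorem theorem1:
  fixes G :: "('a, 'b) monoid_scheme"
  assumes "group G" and "finite (carrier G)" and "solvable G" and "tidy G"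
  shows "Fitting_height G \<le> 4 \<and> derived_length (G Mod Fitting G) \<le> 4 \<and>
    (odd (order G) \<longrightarrow>
      Fitting_height G \<le> 3 \<and>
      (comm_group (G Mod Fitting G) \<or> metabelian (G Mod Fitting G)))"
proof -
  interpret group G by (rule assms(1))
  interpret finite_group G by unfold_locales (rule assms(2))
  obtain n where solv: "(derived G ^^ n) (carrier G) = {\<one>\<^bsub>G\<^esub>}"
    using assms(3) solvable_iff_trivial_derived_seq by blast
  let ?N = "chief_centralizer"
  let ?D1 = "derived G (carrier G)"
  let ?D2 = "derived G ?D1"
  note cent = tidy_derived_centralizes_chief_pair[OF assms(4) solv]
  have N: "?N \<lhd> G" by (rule chief_centralizer_normal)
  have D1: "?D1 \<lhd> G" by (rule derived_self_is_normal)
  have D2: "?D2 \<lhd> G" by (rule derived_is_normal[OF D1])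
  have D2c: "?D2 \<subseteq> carrier G" using subgroup.subset[OF normal_imp_subgroup[OF D2]] .
  have D4N: "derived G (derived G ?D2) \<subseteq> ?N"
    using mem_chief_centralizerI[OF derived_in_carrier[OF derived_in_carrier[OF D2c]]] cent(1) by blast
  obtain m where m: "\<And>k. lcs_of G ?D2 m \<subseteq> lcs_of G ?D2 k"
    using lcs_of_stabilizes[OF normal_imp_subgroup[OF D2]] by blast
  have lcsN: "lcs_of G ?D2 m \<subseteq> ?N"
  proof (rule mem_chief_centralizerI)
    show "lcs_of G ?D2 m \<subseteq> carrier G"
      using subset_trans[OF lcs_of_subset[OF normal_imp_subgroup[OF D2]] D2c] .
    fix p S T assume "chief_pair p S T"
    then obtain k where "centralizes_factor (lcs_of G ?D2 k) S T" using cent(2) by blast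
    then show "centralizes_factor (lcs_of G ?D2 m) S T" using m[of k] unfolding centralizes_factor_def by blast
  qed
  have nilN: "nilpotent_group (G\<lparr>carrier := ?N\<rparr>)"
  proof (rule nilpotent_if_centralizes_chief_pairs[OF N, of n])
    have "(derived G ^^ n) ?N \<subseteq> {\<one>\<^bsub>G\<^esub>}"
      using mono_exp_of_derived[OF subgroup.subset[OF normal_imp_subgroup[OF N]], of n] solv by simp
    then show "(derived G ^^ n) ?N = {\<one>\<^bsub>G\<^esub>}"
      using subgroup.one_closed[OF exp_of_derived_is_subgroup[OF normal_imp_subgroup[OF N]]] by blast
    show "\<forall>p S T. chief_pair p S T \<longrightarrow> centralizes_factor ?N S T"
      unfolding centralizes_factor_def chief_centralizer_def by blast
  qed
  have NF: "?N \<subseteq> Fitting G" using nilpotent_normal_le_Fitting[OF N nilN] .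
  have N1: "?N \<subseteq> Fitting_series G 1"
  proof -
    obtain k where "lcs_of G ?N k = {\<one>\<^bsub>G\<^esub>}" using nilN nilpotent_group_iff by blast
    then have "lcs_of G ?N k \<subseteq> Fitting_series G 0" by simp
    then have "?N \<subseteq> Fitting_series G (Suc 0)" by (rule le_Fitting_series_Suc[OF N])
    then show ?thesis by (simp only: One_nat_def)
  qed
  have D1F: "?D1 \<subseteq> Fitting_series G (Suc k)" if "?D2 \<subseteq> Fitting_series G k" for k
    using le_Fitting_series_Suc[OF D1, of 1 k] lcs_of_one_le_derived[OF normal_imp_subgroup[OF D1]] that by simp
  have GF: "carrier G \<subseteq> Fitting_series G (Suc k)" if "?D1 \<subseteq> Fitting_series G k" for k
    using le_Fitting_series_Suc[OF normal_self, of 1 k] lcs_of_one_le_derived[OF subgroup_self] that by simp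
  have D2F: "?D2 \<subseteq> Fitting_series G 2"
    using le_Fitting_series_Suc[OF D2, of m 1] lcsN N1 by (simp add: numeral_2_eq_2)
  have height4: "Fitting_height G \<le> 4"
    using Fitting_height_le[OF GF[OF D1F[OF D2F]]] by (simp add: numeral_eq_enat)
  interpret F: normal "Fitting G" G by (rule Fitting_normal)
  let ?Q = "G Mod Fitting G" and ?h = "\<lambda>a. Fitting G #>\<^bsub>G\<^esub> a"
  interpret Q: group ?Q by (rule F.factorgroup_is_group)
  interpret h: group_hom G ?Q ?h by (rule F.group_hom_Mod)
  have surj: "?h ` carrier G = carrier ?Q" by (simp add: carrier_FactGroup)
  have img: "(derived ?Q ^^ i) (carrier ?Q) = ?h ` ((derived G ^^ i) (carrier G))" for i
    using h.exp_of_derived_img[OF subset_refl, of i] surj by simp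
  have trivial: "(derived ?Q ^^ i) (carrier ?Q) = {\<one>\<^bsub>?Q\<^esub>}" if "(derived G ^^ i) (carrier G) \<subseteq> Fitting G" for i
  proof -
    have "?h x = \<one>\<^bsub>?Q\<^esub>" if "x \<in> (derived G ^^ i) (carrier G)" for x
      using F.Mod_eq_one_iff[of x] that \<open>(derived G ^^ i) (carrier G) \<subseteq> Fitting G\<close> by auto
    moreover have "\<one>\<^bsub>G\<^esub> \<in> (derived G ^^ i) (carrier G)"
      using subgroup.one_closed[OF exp_of_derived_is_subgroup[OF subgroup_self]] .
    ultimately show ?thesis unfolding img by blast
  qed
  have "(derived G ^^ 4) (carrier G) \<subseteq> Fitting G"
    using D4N NF by (simp add: numeral_eq_Suc)
  then have length4: "derived_length ?Q \<le> 4"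
    using Q.derived_length_le[OF trivial, of 4] by (simp add: numeral_eq_enat)
  have "Fitting_height G \<le> 3 \<and> metabelian ?Q" if odd: "odd (order G)"
  proof
    have D2N: "?D2 \<subseteq> ?N"
      using mem_chief_centralizerI[OF D2c] cent(3)[OF _ odd] by blast
    then have "?D2 \<subseteq> Fitting_series G 1" using N1 by blast
    then show "Fitting_height G \<le> 3"
      using Fitting_height_le[OF GF[OF D1F, of 1]] by (simp add: numeral_eq_enat numeral_3_eq_3)
    have "(derived G ^^ 2) (carrier G) \<subseteq> Fitting G"
      using D2N NF by (simp add: numeral_2_eq_2)
    then show "metabelian ?Q"
      using Q.metabelianI trivial[of 2] by (simp add: numeral_2_eq_2)
  qed
  then show ?thesis using height4 length4 by blast
qed

end
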